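(* Let $\mathcal{H}$ be a real Hilbert space, $\eta\colon\mathcal{H}\to\mathbb{R}$ a smooth convex function, and $f\colon[0,T]\times\mathcal{H}\to\mathcal{H}$ smooth. Let a Runge--Kutta method with coefficients $A=(a_{ij})\in\mathbb{R}^{s\times s}$, $b,c\in\mathbb{R}^s$ be $p$-th order accurate and satisfy $\sum_{i,j=1}^s b_ia_{ij}>0$ and $\sum_{i,j=1}^s b_i(a_{ij}-b_j)<0$. Fix $t_n\in[0,T)$ and $u^n\in\mathcal{H}$, let $f_0=f(t_n,u^n)$, and suppose $\eta''(u^n)(f_0,f_0)>0$. Let $u$ be the solution of $u'(t)=f(t,u(t))$, $u(t_n)=u^n$. For $\Delta t>0$ let $$r(\gamma)=\eta\Bigl(u^n+\gamma\Delta t\sum_{i=1}^s b_if_i\Bigr)-\eta(u^n)-\gamma\Delta t\sum_{i=1}^s b_i\langle\eta'(y_i),f_i\rangle ,$$ where $y_i$ are the stage values and $f_i=f(t_n+c_i\Delta t,y_i)$. Then for all sufficiently small $\Delta t>0$ the function $r$ has a unique positive root $\gamma_n$, and with $u^{n+1}_\gamma=u^n+\gamma_n\Delta t\sum_{i=1}^s b_if_i$ the following hold: (1) The method interpreting $u^{n+1}_\gamma\approx u(t_n+\Delta t)$ (IDT method) has order $p-1$, i.e. $u^{n+1}_\gamma-u(t_n+\Delta t)=\mathcal{O}(\Delta t^{p})$ as $\Delta t\to0$. (2) The method interpreting $u^{n+1}_\gamma\approx u(t_n+\gamma_n\Delta t)$ (relaxation method) has order $p$, i.e. $u^{n+1}_\gamma-u(t_n+\gamma_n\Delta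 t)=\mathcal{O}(\Delta t^{p+1})$ as $\Delta t\to0$.
   Context: Stage values: $y_i=u^n+\Delta t\sum_{j=1}^s a_{ij}f(t_n+c_j\Delta t,y_j)$, $i=1,\dots,s$. It is assumed that $A\mathbf{1}=c$ with $\mathbf{1}=(1,\dots,1)^T$. For implicit methods, $y_i=y_i(\Delta t)$ denotes the solution branch with $y_i\to u^n$ as $\Delta t\to0$ (unique for small $\Delta t$). Only step sizes with all stage times and evaluation times in $[0,T]$ are considered. $\eta'(u)$ is the gradient of $\eta$ at $u$ and $\eta''(u)(\cdot,\cdot)$ its second derivative as a bilinear form. A Runge--Kutta method is $p$-th order accurate if its coefficients satisfy all Runge--Kutta order conditions up to order $p$; equivalently, for every smooth ODE $x'=g(t,x)$ (in a real Banach space) one step from $x(t_n)$ with the unmodified update $x^{n+1}=x(t_n)+\Delta t\sum_i b_ig_i$, where $g_i$ is $g$ evaluated at the $i$-th stage time and stage value, satisfies $x^{n+1}-x(t_n+\Delta t)=\mathcal{O}(\Delta t^{p+1})$. *)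

theory Defs
  imports "HOL-Analysis.Analysis" "HOL-Library.Landau_Symbols"
begin

section \<open>Smooth maps between real normed spaces\<close>

text \<open>A bounded \<open>k\<close>-linear map is represented by a function on lists of length \<open>k\<close>; its values on
  lists of other lengths are irrelevant.\<close>

definition bounded_multilinear ::
    "nat \<Rightarrow> ('a::real_normed_vector list \<Rightarrow> 'b::real_normed_vector) \<Rightarrow> bool" where
  "bounded_multilinear k M \<longleftrightarrow>
     (\<forall>vs i. length vs = k \<longrightarrow> i < k \<longrightarrow> linear (\<lambda>v. M (vs[i := v]))) \<and>
     (\<exists>K. \<forall>vs. length vs = k \<longrightarrow> norm (M vs) \<le> K * prod_list (map norm vs))"

text \<open>Infinite Frechet differentiability on \<open>S\<close>. The space of \<open>k\<close>-linear maps is a different type for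
  each \<open>k\<close>, so the sequence of iterated derivatives is spelled out: \<open>D k x\<close> is a bounded \<open>k\<close>-linear
  map, \<open>D 0 = f\<close>, and \<open>D (k + 1)\<close> is the Frechet derivative (within \<open>S\<close>) of \<open>D k\<close> with respect to
  the operator norm on \<open>k\<close>-linear maps.\<close>

definition smooth_on ::
    "'a::real_normed_vector set \<Rightarrow> ('a \<Rightarrow> 'b::real_normed_vector) \<Rightarrow> bool" where
  "smooth_on S f \<longleftrightarrow>
     (\<exists>D :: nat \<Rightarrow> 'a \<Rightarrow> 'a list \<Rightarrow> 'b.
        (\<forall>x\<in>S. D 0 x [] = f x) \<and>
        (\<forall>k. \<forall>x\<in>S. bounded_multilinear k (D k x)) \<and>
        (\<forall>k. \<forall>x\<in>S. \<forall>e>0. \<exists>d>0. \<forall>y\<in>S. norm (y - x) < d \<longrightarrow>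
           (\<forall>vs. length vs = k \<longrightarrow>
              norm (D k y vs - D k x vs - D (Suc k) x ((y - x) # vs))
                \<le> e * norm (y - x) * prod_list (map norm vs))))"

definition gradient :: "('a::real_inner \<Rightarrow> real) \<Rightarrow> 'a \<Rightarrow> 'a" where
  "gradient \<eta> x = (THE D. GDERIV \<eta> x :> D)"

text \<open>The derivative of the map \<open>x \<mapsto> D\<eta>(x)\<close> into the dual space, read as a bilinear form.\<close>

definition second_derivative :: "('a::real_normed_vector \<Rightarrow> real) \<Rightarrow> 'a \<Rightarrow> 'a \<Rightarrow> 'a \<Rightarrow> real" where
  "second_derivative \<eta> x v w =
     blinfun_apply (frechet_derivative (\<lambda>y. Blinfun (frechet_derivative \<eta> (at y))) (at x) v) w"


section \<open>Runge--Kutta order conditions\<close>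

text \<open>Rooted trees, with the subtrees of the root given as a list. The order condition of a tree does
  not depend on the order of the subtrees, so distinguishing plane trees only repeats conditions.\<close>

datatype rtree = Node "rtree list"

fun tree_order :: "rtree \<Rightarrow> nat" where
  "tree_order (Node ts) = 1 + (\<Sum>t\<leftarrow>ts. tree_order t)"

fun tree_density :: "rtree \<Rightarrow> nat" where
  "tree_density (Node ts) = tree_order (Node ts) * prod_list (map tree_density ts)"

fun stage_weight :: "real^'s^'s \<Rightarrow> rtree \<Rightarrow> 's \<Rightarrow> real" where
  "stage_weight A (Node ts) i =
     prod_list (map (\<lambda>t. \<Sum>j\<in>UNIV. A $ i $ j * stage_weight A t j) ts)"

definition rk_order_accurate :: "real^'s^'s \<Rightarrow> real^'s \<Rightarrow> nat \<Rightarrow> bool" where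
  "rk_order_accurate A b p \<longleftrightarrow>
     (\<forall>t. tree_order t \<le> p \<longrightarrow>
        (\<Sum>i\<in>UNIV. b $ i * stage_weight A t i) = 1 / real (tree_density t))"


section \<open>One relaxed Runge--Kutta step\<close>

text \<open>The limit \<open>\<Delta>t \<rightarrow> 0\<close> through positive step sizes whose stage times all lie in \<open>[0, T]\<close>. It is
  \<open>at_right 0\<close>, except that no step size is admissible if \<open>t\<^sub>n = 0\<close> and some \<open>c\<^sub>i < 0\<close>.\<close>

definition small_steps :: "real \<Rightarrow> real \<Rightarrow> real^'s \<Rightarrow> real filter" where
  "small_steps T tn c = at 0 within {h. 0 < h \<and> (\<forall>i. tn + c $ i * h \<in> {0..T})}"

text \<open>\<open>y h i\<close> is the \<open>i\<close>-th stage value for step size \<open>h\<close>.\<close>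

definition stage_branch ::
    "(real \<Rightarrow> 'a::real_normed_vector \<Rightarrow> 'a) \<Rightarrow> real^'s^'s \<Rightarrow> real^'s \<Rightarrow> real \<Rightarrow> real \<Rightarrow> 'a \<Rightarrow>
     (real \<Rightarrow> 's \<Rightarrow> 'a) \<Rightarrow> bool" where
  "stage_branch f A c T tn un y \<longleftrightarrow>
     (\<forall>\<^sub>F h in small_steps T tn c. \<forall>i.
        y h i = un + h *\<^sub>R (\<Sum>j\<in>UNIV. A $ i $ j *\<^sub>R f (tn + c $ j * h) (y h j))) \<and>
     (\<forall>i. ((\<lambda>h. y h i) \<longlongrightarrow> un) (small_steps T tn c))"

definition rk_update ::
    "(real \<Rightarrow> 'a::real_normed_vector \<Rightarrow> 'a) \<Rightarrow> real^'s \<Rightarrow> real^'s \<Rightarrow> real \<Rightarrow> 'a \<Rightarrow>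
     (real \<Rightarrow> 's \<Rightarrow> 'a) \<Rightarrow> real \<Rightarrow> real \<Rightarrow> 'a" where
  "rk_update f b c tn un y h \<gamma> =
     un + (\<gamma> * h) *\<^sub>R (\<Sum>i\<in>UNIV. b $ i *\<^sub>R f (tn + c $ i * h) (y h i))"

definition relaxation_residual ::
    "('a::real_inner \<Rightarrow> real) \<Rightarrow> (real \<Rightarrow> 'a \<Rightarrow> 'a) \<Rightarrow> real^'s \<Rightarrow> real^'s \<Rightarrow> real \<Rightarrow> 'a \<Rightarrow>
     (real \<Rightarrow> 's \<Rightarrow> 'a) \<Rightarrow> real \<Rightarrow> real \<Rightarrow> real" where
  "relaxation_residual \<eta> f b c tn un y h \<gamma> =
     \<eta> (rk_update f b c tn un y h \<gamma>) - \<eta> un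
       - \<gamma> * h * (\<Sum>i\<in>UNIV. b $ i * (gradient \<eta> (y h i) \<bullet> f (tn + c $ i * h) (y h i)))"

definition relaxation_parameter ::
    "('a::real_inner \<Rightarrow> real) \<Rightarrow> (real \<Rightarrow> 'a \<Rightarrow> 'a) \<Rightarrow> real^'s \<Rightarrow> real^'s \<Rightarrow> real \<Rightarrow> 'a \<Rightarrow>
     (real \<Rightarrow> 's \<Rightarrow> 'a) \<Rightarrow> real \<Rightarrow> real" where
  "relaxation_parameter \<eta> f b c tn un y h =
     (THE \<gamma>. \<gamma> > 0 \<and> relaxation_residual \<eta> f b c tn un y h \<gamma> = 0)"

end

theory Submission
  imports Defs
begin

text \<open>Order conditions are turned into orders of convergence by expanding the stages and the exact solution
  in the same B-series. The right-hand side enters only through its Taylor coefficients at the initial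
  value, so both expansions follow by induction on the truncation order: one more factor \<open>h\<close> is gained by
  the factor in front of \<open>f\<close> in the stage equations, respectively by the mean value inequality.

  Applied to the system augmented by time and by \<open>\<eta>\<close>, this gives \<open>r(1) = O(h^(p+1))\<close>. Moreover
  \<open>r(\<gamma>) / h^2\<close> tends to \<open>\<kappa> (B^2 \<gamma>^2 / 2 - S \<gamma>)\<close> with \<open>B = \<Sum> b\<^sub>i\<close>, \<open>S = \<Sum> b\<^sub>i a\<^sub>i\<^sub>j\<close> and \<open>\<kappa> = \<eta>''(f\<^sub>0, f\<^sub>0)\<close>.
  As \<open>r\<close> is convex with \<open>r(0) = 0\<close>, it has exactly one positive root, and its slope there
  is at least of order \<open>h^2\<close>, so that \<open>\<gamma>\<^sub>n - 1 = O(h^(p-1))\<close>. The two error bounds then follow from the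
  order of the unmodified step by moving along the numerical and the exact flow for the time
  \<open>(\<gamma>\<^sub>n - 1) h\<close>.\<close>

text \<open>The augmented field contains \<open>\<eta>'(x) f(t, x)\<close>, and \<open>f\<close> is
  smooth only for times in [0, T], of which \<open>tn\<close> may be an end point. A field is
  therefore only asked to have Taylor expansions of every order at one point, within a set. Products
  inherit this property by multiplying truncated sums, so no chain rule of higher order is needed.
  The limiting parabola has the positive root 2 S / B^2, which the two sign conditions place between
  0 and 2; its minimum lies at S / B^2 < 1. There the residual is at most -\<epsilon> h^2, and the
  chord from that point to the root converts the size of r(1) into the distance of the root from 1.
  A derivative of r at the root is never formed. Moving only the numerical flow for the time
  \<open>(\<gamma>\<^sub>n - 1) h\<close> costs one power of h, which gives (1). In (2) both flows
  are moved; each has velocity f0 + O(h), so the parts along f0 cancel and a factor h is regained.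
  For p = 0 there is no order condition, and crude bounds give both claims.\<close>

section \<open>Norms and Landau symbols\<close>

text \<open>Landau symbols relate functions with values in a normed field, so bounds on vectors are
  stated for their norms throughout; these rules carry the arithmetic over.\<close>

lemma norm_add_bigo:
  assumes "(\<lambda>h. norm (a h)) \<in> O[F](g)" "(\<lambda>h. norm (b h)) \<in> O[F](g)"
  shows "(\<lambda>h. norm (a h + b h)) \<in> O[F](g)"
  by (rule landau_o.big_mono[THEN landau_o.big_trans, OF _ sum_in_bigo(1)[OF assms]])
     (auto intro!: always_eventually norm_triangle_ineq)

lemma norm_diff_bigo:
  assumes "(\<lambda>h. norm (a h)) \<in> O[F](g)" "(\<lambda>h. norm (b h)) \<in> O[F](g)"
  shows "(\<lambda>h. norm (a h - b h)) \<in> O[F](g)"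
  using norm_add_bigo[of a F g "\<lambda>h. - b h"] assms by simp

lemma norm_sum_bigo:
  assumes "\<And>i. i \<in> S \<Longrightarrow> (\<lambda>h. norm (a i h)) \<in> O[F](g)"
  shows "(\<lambda>h. norm (\<Sum>i\<in>S. a i h)) \<in> O[F](g)"
  using assms
proof (induction S rule: infinite_finite_induct)
  case (insert i S)
  then show ?case using norm_add_bigo[of "a i" F g "\<lambda>h. \<Sum>i\<in>S. a i h"] by simp
qed simp_all

lemma norm_scaleR_bigo:
  assumes "(\<lambda>h. r h) \<in> O[F](g1)" "(\<lambda>h. norm (a h)) \<in> O[F](g2)"
  shows "(\<lambda>h. norm (r h *\<^sub>R a h)) \<in> O[F](\<lambda>h. g1 h * g2 h)"
  using landau_o.big.mult[of "\<lambda>h. \<bar>r h\<bar>" F g1 "\<lambda>h. norm (a h)" g2] assms by simp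

lemma norm_bigoI:
  assumes "\<forall>\<^sub>F h in F. norm (a h) \<le> C * g h"
  shows "(\<lambda>h. norm (a h)) \<in> O[F](g :: _ \<Rightarrow> real)"
proof (rule bigoI[of _ "\<bar>C\<bar>"])
  show "\<forall>\<^sub>F h in F. norm (norm (a h)) \<le> \<bar>C\<bar> * norm (g h)"
    using assms
  proof eventually_elim
    case (elim h)
    have "C * g h \<le> \<bar>C\<bar> * \<bar>g h\<bar>" by (metis abs_ge_self abs_mult)
    with elim show ?case by simp
  qed
qed

lemma norm_bigoE:
  assumes "(\<lambda>h. norm (a h)) \<in> O[F](g)"
  obtains C where "C > 0" "\<forall>\<^sub>F h in F. norm (a h) \<le> C * \<bar>g h :: real\<bar>"
  using assms by (elim landau_o.bigE) simp

lemma norm_bigo_le: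
  assumes "(\<lambda>h. norm (b h)) \<in> O[F](g)" "\<forall>\<^sub>F h in F. norm (a h) \<le> norm (b h)"
  shows "(\<lambda>h. norm (a h)) \<in> O[F](g)"
  by (rule landau_o.big_mono[THEN landau_o.big_trans, OF _ assms(1)]) (use assms(2) in simp)

lemma bigo_power_mono:
  assumes "F \<le> at_right (0::real)" "m \<le> n"
  shows "(\<lambda>h. h ^ n) \<in> O[F](\<lambda>h. h ^ m)"
proof (rule bigoI[of _ 1])
  have "\<forall>\<^sub>F h in at_right (0::real). h \<in> {0<..<1}"
    by (rule eventually_at_right_real) simp
  then have "\<forall>\<^sub>F h in F. h \<in> {0<..<1}" by (rule filter_leD[OF assms(1)])
  then show "\<forall>\<^sub>F h in F. norm (h ^ n) \<le> 1 * norm (h ^ m)"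
    by eventually_elim (use assms(2) in \<open>auto intro: power_decreasing\<close>)
qed

lemma norm_tendsto_bigo_one:
  assumes "(a \<longlongrightarrow> l) F"
  shows "(\<lambda>h. norm (a h)) \<in> O[F](\<lambda>h. 1::real)"
proof (rule norm_bigoI)
  have "\<forall>\<^sub>F h in F. norm (a h) < norm l + 1"
    using order_tendstoD(2)[OF tendsto_norm[OF assms]] by simp
  then show "\<forall>\<^sub>F h in F. norm (a h) \<le> (norm l + 1) * 1"
    by eventually_elim simp
qed

lemma norm_bigo_ident_tendsto:
  assumes "F \<le> at_right (0::real)" "(\<lambda>h. norm (a h)) \<in> O[F](\<lambda>h. h)"
  shows "(a \<longlongrightarrow> 0) F"
proof -
  obtain C where "\<forall>\<^sub>F h in F. norm (a h) \<le> C * \<bar>h\<bar>" using assms(2) by (rule norm_bigoE)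
  moreover have "((\<lambda>h. h) \<longlongrightarrow> 0) F"
    using assms(1) by (rule tendsto_mono) (rule tendsto_ident_at)
  then have "((\<lambda>h. C * \<bar>h\<bar>) \<longlongrightarrow> 0) F"
    by (auto intro!: tendsto_eq_intros)
  ultimately show ?thesis by (rule Lim_null_comparison)
qed


section \<open>Multilinear maps on lists\<close>

text \<open>The form \<open>us @ v # ws\<close> in place of a list update keeps the active slot
  visible to inductions that walk through the argument list.\<close>

lemma bounded_multilinear_linear:
  assumes "bounded_multilinear k M" "Suc (length us + length ws) = k"
  shows "linear (\<lambda>v. M (us @ v # ws))"
proof -
  have "linear (\<lambda>v. M ((us @ 0 # ws)[length us := v]))"
    using assms unfolding bounded_multilinear_def by (metis length_append length_Cons add_Suc_right less_add_Suc1)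
  then show ?thesis by simp
qed

lemma bounded_multilinear_bound:
  assumes "bounded_multilinear k M"
  obtains K where "K > 0" "\<And>vs. length vs = k \<Longrightarrow> norm (M vs) \<le> K * prod_list (map norm vs)"
proof -
  obtain K where K: "\<And>vs. length vs = k \<Longrightarrow> norm (M vs) \<le> K * prod_list (map norm vs)"
    using assms unfolding bounded_multilinear_def by blast
  have "norm (M vs) \<le> (\<bar>K\<bar> + 1) * prod_list (map norm vs)" if "length vs = k" for vs
  proof -
    have "0 \<le> prod_list (map norm vs)" by (induction vs) auto
    then have "K * prod_list (map norm vs) \<le> (\<bar>K\<bar> + 1) * prod_list (map norm vs)"
      by (intro mult_right_mono) auto
    with K[OF that] show ?thesis by linarith
  qed
  then show thesis by (intro that[of "\<bar>K\<bar> + 1"]) auto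
qed

lemma prod_list_norm_nonneg [simp]: "0 \<le> prod_list (map norm (vs :: 'a::real_normed_vector list))"
  by (induction vs) auto

lemma bounded_multilinearI:
  assumes "\<And>us ws. Suc (length us + length ws) = k \<Longrightarrow> linear (\<lambda>v. M (us @ v # ws))"
    and "\<And>vs. length vs = k \<Longrightarrow> norm (M vs) \<le> K * prod_list (map norm vs)"
  shows "bounded_multilinear k M"
  unfolding bounded_multilinear_def
proof (intro conjI allI impI)
  fix vs :: "'a list" and i assume "length vs = k" "i < k"
  then have "linear (\<lambda>v. M (take i vs @ v # drop (Suc i) vs))"
    by (intro assms(1)) auto
  then show "linear (\<lambda>v. M (vs[i := v]))"
    using \<open>length vs = k\<close> \<open>i < k\<close> by (simp add: upd_conv_take_nth_drop)
qed (use assms(2) in blast)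

text \<open>The prefix \<open>ps\<close> makes the induction work: each vector whose factor has been
  pulled out moves from \<open>ts\<close> into it.\<close>

lemma multilinear_scale_list:
  assumes "bounded_multilinear k M" "length ps + length ts + length us = k"
  shows "M (ps @ map (\<lambda>t. a t *\<^sub>R x t) ts @ us) = prod_list (map a ts) *\<^sub>R M (ps @ map x ts @ us)"
  using assms(2)
proof (induction ts arbitrary: ps)
  case (Cons t ts)
  interpret linear "\<lambda>v. M (ps @ v # map (\<lambda>t. a t *\<^sub>R x t) ts @ us)"
    by (rule bounded_multilinear_linear[OF assms(1)]) (use Cons.prems in simp)
  show ?case
    using Cons.IH[of "ps @ [x t]"] Cons.prems scaleR[of "a t" "x t"] by simp
qed simp

lemma multilinear_scale_replicate:
  assumes "bounded_multilinear k M" "j + length us = k"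
  shows "M (replicate j (a *\<^sub>R v) @ us) = a ^ j *\<^sub>R M (replicate j v @ us)"
  \<comment> \<open>A list of units serves as index list, so that mapping a constant over it
    produces \<open>replicate\<close>.\<close>
  using multilinear_scale_list[OF assms(1), of "[]" "replicate j ()" us "\<lambda>_. a" "\<lambda>_. v"] assms(2)
  by (simp add: prod_list_replicate)

text \<open>Without symmetry of \<open>M\<close> the expansion has one summand for each word over
  \<open>S\<close>. Words of trees are the lists of subtrees of plane trees, so no multinomial
  coefficients appear later.\<close>

lemma multilinear_sum_list:
  assumes "bounded_multilinear k M" "length us + j = k" "finite S"
  shows "M (us @ replicate j (\<Sum>t\<in>S. x t)) =
    (\<Sum>ts\<in>{ts. set ts \<subseteq> S \<and> length ts = j}. M (us @ map x ts))"
  using assms(2)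
proof (induction j arbitrary: us)
  case 0
  have "{ts. set ts \<subseteq> S \<and> ts = []} = {[]}" by auto
  then show ?case by simp
next
  case (Suc j)
  let ?L = "\<lambda>j. {ts. set ts \<subseteq> S \<and> length ts = j}"
  interpret linear "\<lambda>v. M (us @ v # replicate j (\<Sum>t\<in>S. x t))"
    by (rule bounded_multilinear_linear[OF assms(1)]) (use Suc.prems in simp)
  have "M (us @ replicate (Suc j) (\<Sum>t\<in>S. x t)) =
      (\<Sum>t\<in>S. M ((us @ [x t]) @ replicate j (\<Sum>t\<in>S. x t)))"
    using sum[of x S] by simp
  also have "\<dots> = (\<Sum>t\<in>S. \<Sum>ts\<in>?L j. M (us @ map x (t # ts)))"
  proof (intro sum.cong refl)
    fix t assume "t \<in> S"
    show "M ((us @ [x t]) @ replicate j (\<Sum>t\<in>S. x t)) = (\<Sum>ts\<in>?L j. M (us @ map x (t # ts)))"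
      using Suc.IH[of "us @ [x t]"] Suc.prems by simp
  qed
  also have "\<dots> = (\<Sum>(t, ts)\<in>S \<times> ?L j. M (us @ map x (t # ts)))"
    by (rule sum.cartesian_product)
  also have "\<dots> = (\<Sum>ts\<in>?L (Suc j). M (us @ map x ts))"
    by (rule sum.reindex_bij_witness[of _ "\<lambda>ts. (hd ts, tl ts)" "\<lambda>(t, ts). t # ts"])
       (auto simp: length_Suc_conv)
  finally show ?case .
qed

lemma list_all2_replicate: "P x y \<Longrightarrow> list_all2 P (replicate n x) (replicate n y)"
  by (induction n) auto

text \<open>The list \<open>es\<close> records the order of each argument separately, because in the
  telescoping below one slot is smaller than the others.\<close>

lemma multilinear_bigo:
  assumes "bounded_multilinear k M" "length as = k"
    and "list_all2 (\<lambda>a e. (\<lambda>h. norm (a h)) \<in> O[F](\<lambda>h. h ^ e)) as es"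
  shows "(\<lambda>h. norm (M (map (\<lambda>a. a h) as))) \<in> O[F](\<lambda>h::real. h ^ sum_list es)"
proof -
  obtain K where "K > 0" and K: "\<And>vs. length vs = k \<Longrightarrow> norm (M vs) \<le> K * prod_list (map norm vs)"
    using bounded_multilinear_bound[OF assms(1)] by blast
  have "(\<lambda>h. prod_list (map norm (map (\<lambda>a. a h) as))) \<in> O[F](\<lambda>h. h ^ sum_list es)"
    using assms(3)
    by (induction rule: list_all2_induct) (auto simp: power_add intro: landau_o.big.mult)
  then have "(\<lambda>h. norm (K * prod_list (map norm (map (\<lambda>a. a h) as)))) \<in> O[F](\<lambda>h. h ^ sum_list es)"
    unfolding real_norm_def landau_o.big.abs_in_iff
    using landau_o.big.cmult_in_iff[THEN iffD2, of K] \<open>K > 0\<close> less_irrefl by metis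
  then show ?thesis
  proof (rule norm_bigo_le)
    show "\<forall>\<^sub>F h in F. norm (M (map (\<lambda>a. a h) as)) \<le>
        norm (K * prod_list (map norm (map (\<lambda>a. a h) as)))"
    proof (intro always_eventually allI)
      fix h
      show "norm (M (map (\<lambda>a. a h) as)) \<le> norm (K * prod_list (map norm (map (\<lambda>a. a h) as)))"
        using K[of "map (\<lambda>a. a h) as"] assms(2) by simp
    qed
  qed
qed

text \<open>Telescoping: \<open>v\<close> is exchanged for \<open>w\<close> one slot at a time. Each
  exchange leaves a term with \<open>v h - w h\<close> in one slot and vectors of size O(h) in the
  others, whose additional powers of \<open>h\<close> are given away.\<close>

lemma multilinear_perturbation_bigo:
  assumes M: "bounded_multilinear k M" and F: "F \<le> at_right (0::real)"
    and v: "(\<lambda>h. norm (v h)) \<in> O[F](\<lambda>h. h)" and w: "(\<lambda>h. norm (w h)) \<in> O[F](\<lambda>h. h)"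
    and vw: "(\<lambda>h. norm (v h - w h)) \<in> O[F](\<lambda>h. h ^ n)"
  shows "(\<lambda>h. norm (M (replicate k (v h)) - M (replicate k (w h)))) \<in> O[F](\<lambda>h. h ^ n)"
proof -
  have "(\<lambda>h. norm (M (replicate i (v h) @ replicate j (v h)) - M (replicate i (v h) @ replicate j (w h))))
      \<in> O[F](\<lambda>h. h ^ n)" if "i + j = k" for i j
    using that
  proof (induction j arbitrary: i)
    case (Suc j)
    have "(\<lambda>h. norm (M (map (\<lambda>a. a h) (replicate i v @ (\<lambda>h. v h - w h) # replicate j w))))
        \<in> O[F](\<lambda>h. h ^ sum_list (replicate i 1 @ n # replicate j 1))"
      using Suc.prems v w vw
      by (intro multilinear_bigo[OF M]) (auto simp: list_all2_append list_all2_replicate)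
    then have "(\<lambda>h. norm (M (replicate i (v h) @ (v h - w h) # replicate j (w h))))
        \<in> O[F](\<lambda>h. h ^ (i + (n + j)))"
      by (simp add: sum_list_replicate)
    also have "(\<lambda>h. h ^ (i + (n + j))) \<in> O[F](\<lambda>h. h ^ n)"
      by (rule bigo_power_mono[OF F]) simp
    finally have *: "(\<lambda>h. norm (M (replicate i (v h) @ (v h - w h) # replicate j (w h)))) \<in> O[F](\<lambda>h. h ^ n)" .
    have eq: "M (replicate i (v h) @ (v h - w h) # replicate j (w h)) =
        M (replicate i (v h) @ v h # replicate j (w h)) - M (replicate i (v h) @ replicate (Suc j) (w h))" for h
    proof -
      interpret linear "\<lambda>x. M (replicate i (v h) @ x # replicate j (w h))"
        by (rule bounded_multilinear_linear[OF M]) (use Suc.prems in simp)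
      show ?thesis using diff[of "v h" "w h"] by simp
    qed
    have split: "replicate (Suc i) x @ zs = replicate i x @ x # zs" for x :: 'a and zs
      by (simp add: replicate_app_Cons_same)
    have "(\<lambda>h. norm (M (replicate (Suc i) (v h) @ replicate j (v h)) - M (replicate (Suc i) (v h) @ replicate j (w h))))
        \<in> O[F](\<lambda>h. h ^ n)"
      using Suc.IH[of "Suc i"] Suc.prems by (simp only: add_Suc add_Suc_right)
    from norm_add_bigo[OF this[unfolded split] *[unfolded eq]] show ?case
      by simp
  qed simp
  from this[of 0 k] show ?thesis by simp
qed

section \<open>Taylor expansion of smooth maps\<close>

text \<open>\<open>smooth_on\<close> with its witness exposed: gradient, Hessian and Taylor
  coefficients have to come from one and the same sequence \<open>D\<close>.\<close>

definition derivative_tower ::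
    "'a::real_normed_vector set \<Rightarrow> (nat \<Rightarrow> 'a \<Rightarrow> 'a list \<Rightarrow> 'b::real_normed_vector) \<Rightarrow> bool" where
  "derivative_tower S D \<longleftrightarrow>
     (\<forall>k. \<forall>x\<in>S. bounded_multilinear k (D k x)) \<and>
     (\<forall>k. \<forall>x\<in>S. \<forall>e>0. \<exists>d>0. \<forall>y\<in>S. norm (y - x) < d \<longrightarrow>
        (\<forall>vs. length vs = k \<longrightarrow>
           norm (D k y vs - D k x vs - D (Suc k) x ((y - x) # vs))
             \<le> e * norm (y - x) * prod_list (map norm vs)))"

lemma smooth_on_iff_tower:
  "smooth_on S f \<longleftrightarrow> (\<exists>D. (\<forall>x\<in>S. D 0 x [] = f x) \<and> derivative_tower S D)"
  unfolding smooth_on_def derivative_tower_def by (rule refl)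

lemma smooth_on_tower:
  assumes "smooth_on S f"
  obtains D where "derivative_tower S D" "\<And>x. x \<in> S \<Longrightarrow> D 0 x [] = f x"
  using assms unfolding smooth_on_iff_tower by blast

lemma tower_multilinear: "derivative_tower S D \<Longrightarrow> x \<in> S \<Longrightarrow> bounded_multilinear k (D k x)"
  unfolding derivative_tower_def by simp

lemma tower_differentiable:
  assumes "derivative_tower S D" "x \<in> S" "e > 0"
  obtains d where "d > 0" "\<And>y vs. y \<in> S \<Longrightarrow> norm (y - x) < d \<Longrightarrow> length vs = k \<Longrightarrow>
    norm (D k y vs - D k x vs - D (Suc k) x ((y - x) # vs)) \<le> e * norm (y - x) * prod_list (map norm vs)"
proof -
  have "\<exists>d>0. \<forall>y\<in>S. norm (y - x) < d \<longrightarrow> (\<forall>vs. length vs = k \<longrightarrow>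
      norm (D k y vs - D k x vs - D (Suc k) x ((y - x) # vs)) \<le> e * norm (y - x) * prod_list (map norm vs))"
    using assms unfolding derivative_tower_def by simp
  then show thesis using that by blast
qed

lemma multilinear_bounded_linear_Cons:
  assumes "bounded_multilinear (Suc k) M" "length vs = k"
  shows "bounded_linear (\<lambda>v. M (v # vs))"
proof -
  obtain K where K: "\<And>vs. length vs = Suc k \<Longrightarrow> norm (M vs) \<le> K * prod_list (map norm vs)"
    using bounded_multilinear_bound[OF assms(1)] by blast
  have "linear (\<lambda>v. M ([] @ v # vs))"
    by (rule bounded_multilinear_linear[OF assms(1)]) (use assms(2) in simp)
  moreover have "norm (M (v # vs)) \<le> norm v * (K * prod_list (map norm vs))" for v
    using K[of "v # vs"] assms(2) by (simp add: mult.left_commute)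
  ultimately show ?thesis
    unfolding bounded_linear_def bounded_linear_axioms_def by auto
qed

lemma tower_has_derivative:
  assumes D: "derivative_tower S D" and x: "x \<in> S" and vs: "length vs = k"
  shows "((\<lambda>y. D k y vs) has_derivative (\<lambda>v. D (Suc k) x (v # vs))) (at x within S)"
  unfolding has_derivative_within_alt
proof (intro conjI allI impI)
  show "bounded_linear (\<lambda>v. D (Suc k) x (v # vs))"
    by (rule multilinear_bounded_linear_Cons[OF tower_multilinear[OF D x] vs])
next
  fix e :: real assume e: "e > 0"
  define P where "P = prod_list (map norm vs)"
  have P: "P \<ge> 0" unfolding P_def by simp
  \<comment> \<open>Dividing by \<open>P + 1\<close> rather than \<open>P\<close> covers the case
    that some vector of \<open>vs\<close> is zero.\<close>
  obtain d where d: "d > 0" and est: "\<And>y vs. y \<in> S \<Longrightarrow> norm (y - x) < d \<Longrightarrow> length vs = k \<Longrightarrow>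
    norm (D k y vs - D k x vs - D (Suc k) x ((y - x) # vs)) \<le> e / (P + 1) * norm (y - x) * prod_list (map norm vs)"
    using tower_differentiable[OF D x, of "e / (P + 1)" k] e P by auto
  have "norm (D k y vs - D k x vs - D (Suc k) x ((y - x) # vs)) \<le> e * norm (y - x)"
    if "y \<in> S" "norm (y - x) < d" for y
  proof -
    have "e / (P + 1) * norm (y - x) * P = e * norm (y - x) * (P / (P + 1))" by simp
    also have "\<dots> \<le> e * norm (y - x) * 1"
      using e P by (intro mult_left_mono) auto
    finally show ?thesis using est[OF that vs] unfolding P_def by linarith
  qed
  with d show "\<exists>d>0. \<forall>y\<in>S. norm (y - x) < d \<longrightarrow>
      norm (D k y vs - D k x vs - D (Suc k) x ((y - x) # vs)) \<le> e * norm (y - x)"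
    by blast
qed

lemma tower_has_vector_derivative_segment:
  assumes D: "derivative_tower S D" and S: "convex S" "x \<in> S" "x + w \<in> S" and vs: "length vs = k"
    and \<tau>: "\<tau> \<in> {0..1}"
  shows "((\<lambda>\<tau>. D k (x + \<tau> *\<^sub>R w) vs) has_vector_derivative D (Suc k) (x + \<tau> *\<^sub>R w) (w # vs))
    (at \<tau> within {0..1})"
proof -
  have seg: "x + \<sigma> *\<^sub>R w \<in> S" if "\<sigma> \<in> {0..1}" for \<sigma>
    using convexD_alt[OF S(1,2,3), of \<sigma>] that by (simp add: algebra_simps)
  have "((\<lambda>\<sigma>. D k (x + \<sigma> *\<^sub>R w) vs) has_derivative (\<lambda>s. D (Suc k) (x + \<tau> *\<^sub>R w) ((s *\<^sub>R w) # vs)))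
      (at \<tau> within {0..1})"
    by (rule has_derivative_in_compose2[where t = S and g = "\<lambda>y. D k y vs"
          and g' = "\<lambda>y v. D (Suc k) y (v # vs)", OF tower_has_derivative[OF D _ vs]])
       (use seg \<tau> in \<open>auto intro!: derivative_eq_intros\<close>)
  moreover have "D (Suc k) (x + \<tau> *\<^sub>R w) ((s *\<^sub>R w) # vs) = s *\<^sub>R D (Suc k) (x + \<tau> *\<^sub>R w) (w # vs)" for s
    using multilinear_scale_replicate[OF tower_multilinear[OF D seg[OF \<tau>]], of 1 vs "Suc k" s w] vs
    by simp
  ultimately show ?thesis
    unfolding has_vector_derivative_def by simp
qed

text \<open>The induction on \<open>q\<close> runs over all \<open>k\<close> at once: along the
  segment from \<open>x\<close> to \<open>y\<close>, the derivative of the remainder of degree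
  \<open>Suc q\<close> of \<open>D k\<close> is a remainder of degree \<open>q\<close> of
  \<open>D (Suc k)\<close>. The mean value inequality then gains one factor
  \<open>norm (y - x)\<close>, without any integral. Convexity keeps the segment in
  \<open>S\<close>.\<close>

lemma tower_taylor:
  assumes D: "derivative_tower S D" and S: "convex S" "x \<in> S"
  shows "\<exists>C d. C \<ge> 0 \<and> d > 0 \<and> (\<forall>y\<in>S. norm (y - x) < d \<longrightarrow> (\<forall>vs. length vs = k \<longrightarrow>
    norm (D k y vs - (\<Sum>m\<le>q. (1 / fact m) *\<^sub>R D (k + m) x (replicate m (y - x) @ vs)))
      \<le> C * norm (y - x) ^ Suc q * prod_list (map norm vs)))"
proof (induction q arbitrary: k)
  case 0
  obtain d where d: "d > 0" and est: "\<And>y vs. y \<in> S \<Longrightarrow> norm (y - x) < d \<Longrightarrow> length vs = k \<Longrightarrow>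
    norm (D k y vs - D k x vs - D (Suc k) x ((y - x) # vs)) \<le> 1 * norm (y - x) * prod_list (map norm vs)"
    using tower_differentiable[OF D S(2), of 1 k] by auto
  obtain K where K: "K > 0" "\<And>vs. length vs = Suc k \<Longrightarrow> norm (D (Suc k) x vs) \<le> K * prod_list (map norm vs)"
    using bounded_multilinear_bound[OF tower_multilinear[OF D S(2)]] by blast
  have "norm (D k y vs - D k x vs) \<le> (1 + K) * norm (y - x) * prod_list (map norm vs)"
    if "y \<in> S" "norm (y - x) < d" "length vs = k" for y vs
  proof -
    have "norm (D k y vs - D k x vs) \<le>
        norm (D k y vs - D k x vs - D (Suc k) x ((y - x) # vs)) + norm (D (Suc k) x ((y - x) # vs))"
      by (metis add.commute norm_triangle_sub)
    also have "\<dots> \<le> 1 * norm (y - x) * prod_list (map norm vs) + K * prod_list (map norm ((y - x) # vs))"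
      using that by (intro add_mono est K) auto
    also have "\<dots> = (1 + K) * norm (y - x) * prod_list (map norm vs)" by (simp add: algebra_simps)
    finally show ?thesis .
  qed
  with d K(1) show ?case by (intro exI[of _ "1 + K"] exI[of _ d]) auto
next
  case (Suc q)
  obtain C d where C: "C \<ge> 0" "d > 0" and IH: "\<And>y vs. y \<in> S \<Longrightarrow> norm (y - x) < d \<Longrightarrow> length vs = Suc k \<Longrightarrow>
    norm (D (Suc k) y vs - (\<Sum>m\<le>q. (1 / fact m) *\<^sub>R D (Suc k + m) x (replicate m (y - x) @ vs)))
      \<le> C * norm (y - x) ^ Suc q * prod_list (map norm vs)"
    using Suc.IH[of "Suc k"] by blast
  have "norm (D k y vs - (\<Sum>m\<le>Suc q. (1 / fact m) *\<^sub>R D (k + m) x (replicate m (y - x) @ vs)))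
      \<le> C * norm (y - x) ^ Suc (Suc q) * prod_list (map norm vs)"
    if y: "y \<in> S" and yx: "norm (y - x) < d" and vs: "length vs = k" for y vs
  proof -
    define w where "w = y - x"
    define T where "T m = D (k + m) x (replicate m w @ vs)" for m
    \<comment> \<open>\<open>\<phi>\<close> is the remainder with powers of \<open>\<tau>\<close>
      inserted, so that it vanishes at 0 and is the wanted remainder at 1. By multilinearity
      \<open>\<phi>' \<tau>\<close> is exactly the quantity bounded by \<open>IH\<close> at the
      point \<open>x + \<tau> *\<^sub>R w\<close>, with \<open>w\<close> as an additional
      argument.\<close>
    define \<phi> where "\<phi> \<tau> = D k (x + \<tau> *\<^sub>R w) vs - (\<Sum>m\<le>Suc q. (\<tau> ^ m / fact m) *\<^sub>R T m)" for \<tau> :: real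
    define \<phi>' where "\<phi>' \<tau> = D (Suc k) (x + \<tau> *\<^sub>R w) (w # vs) - (\<Sum>m\<le>q. (\<tau> ^ m / fact m) *\<^sub>R T (Suc m))" for \<tau> :: real
    define B where "B = C * norm w ^ Suc (Suc q) * prod_list (map norm vs)"
    have xw: "x + w \<in> S" using y by (simp add: w_def)
    have seg: "x + \<tau> *\<^sub>R w \<in> S" if "\<tau> \<in> {0..1}" for \<tau>
      using convexD_alt[OF S xw, of \<tau>] that by (simp add: algebra_simps)
    have der: "(\<phi> has_vector_derivative \<phi>' \<tau>) (at \<tau> within {0..1})" if "\<tau> \<in> {0..1}" for \<tau>
    proof -
      have mono_deriv: "((\<lambda>\<tau>. (\<tau> ^ m / fact m) *\<^sub>R T m) has_vector_derivative
          (of_nat m * \<tau> ^ (m - 1) / fact m) *\<^sub>R T m) (at \<tau> within {0..1})" for m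
        by (auto intro!: derivative_eq_intros)
      have "of_nat (Suc m) * \<tau> ^ m / fact (Suc m) = \<tau> ^ m / fact m" for m
        unfolding fact_Suc by (rule nonzero_mult_divide_mult_cancel_left) simp
      then have eq: "(\<Sum>m\<le>Suc q. (of_nat m * \<tau> ^ (m - 1) / fact m) *\<^sub>R T m) = (\<Sum>m\<le>q. (\<tau> ^ m / fact m) *\<^sub>R T (Suc m))"
        unfolding sum.atMost_Suc_shift by (simp del: fact_Suc of_nat_Suc)
      have "((\<lambda>\<tau>. \<Sum>m\<le>Suc q. (\<tau> ^ m / fact m) *\<^sub>R T m) has_vector_derivative
          (\<Sum>m\<le>Suc q. (of_nat m * \<tau> ^ (m - 1) / fact m) *\<^sub>R T m)) (at \<tau> within {0..1})"
        by (rule has_vector_derivative_sum) (rule mono_deriv)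
      from this[unfolded eq] show ?thesis
        unfolding \<phi>_def \<phi>'_def
        by (rule has_vector_derivative_diff[OF tower_has_vector_derivative_segment[OF D S xw vs that]])
    qed
    have bnd: "norm (\<phi>' \<tau>) \<le> B" if \<tau>: "\<tau> \<in> {0..1}" for \<tau>
    proof -
      have le: "norm (\<tau> *\<^sub>R w) \<le> norm w" using \<tau> by (simp add: mult_left_le_one_le)
      have "(1 / fact m) *\<^sub>R D (Suc k + m) x (replicate m (\<tau> *\<^sub>R w) @ w # vs) = (\<tau> ^ m / fact m) *\<^sub>R T (Suc m)" for m
        using multilinear_scale_replicate[OF tower_multilinear[OF D S(2)], of m "w # vs" "Suc k + m" \<tau> w] vs
        by (simp add: T_def replicate_app_Cons_same)
      then have "norm (\<phi>' \<tau>) \<le> C * norm (\<tau> *\<^sub>R w) ^ Suc q * prod_list (map norm (w # vs))"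
        using IH[OF seg[OF \<tau>], of "w # vs"] vs le yx unfolding \<phi>'_def by (simp add: w_def)
      also have "\<dots> \<le> C * norm w ^ Suc q * prod_list (map norm (w # vs))"
        by (intro mult_right_mono mult_left_mono power_mono le C) auto
      finally show ?thesis by (simp add: B_def mult_ac)
    qed
    have "norm (\<phi> 1 - \<phi> 0) \<le> B * 1 - B * 0"
    proof (rule differentiable_bound_general[of 0 1 \<phi> "\<lambda>t. B * t" \<phi>' "\<lambda>_. B"])
      show "continuous_on {0..1} \<phi>"
        by (rule continuous_on_vector_derivative) (use der in auto)
      show "(\<phi> has_vector_derivative \<phi>' \<tau>) (at \<tau>)" if "0 < \<tau>" "\<tau> < 1" for \<tau>
        using der[of \<tau>] that at_within_interior[of \<tau> "{0..1}"] by simp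
    qed (auto intro!: continuous_intros derivative_eq_intros bnd)
    moreover have "\<phi> 0 = 0"
      unfolding \<phi>_def sum.atMost_Suc_shift by (simp add: T_def)
    moreover have "\<phi> 1 = D k y vs - (\<Sum>m\<le>Suc q. (1 / fact m) *\<^sub>R D (k + m) x (replicate m (y - x) @ vs))"
      unfolding \<phi>_def T_def by (simp add: w_def)
    ultimately show ?thesis by (simp add: B_def w_def)
  qed
  with C show ?case by blast
qed

section \<open>B-series\<close>

lemma tree_order_pos: "tree_order t > 0"
  by (cases t) simp

lemma no_tree_order_0: "{t. tree_order t \<le> 0} = {}"
  using tree_order_pos by (auto simp: not_le)

lemma length_le_order_sum: "length ts \<le> (\<Sum>t\<leftarrow>ts. tree_order t)"
proof (induction ts)
  case (Cons t ts)
  then show ?case using tree_order_pos[of t] by simp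
qed simp

text \<open>Serves both the finiteness of the set of trees and, in
  \<open>bseries_field_bigo\<close>, the claim that a Taylor polynomial of degree \<open>n\<close>
  produces every tree of order up to \<open>Suc n\<close>.\<close>

lemma subtrees_of_order_le:
  assumes "tree_order (Node ts) \<le> Suc n"
  shows "set ts \<subseteq> {t. tree_order t \<le> n} \<and> length ts \<le> n"
proof -
  have sum: "(\<Sum>t\<leftarrow>ts. tree_order t) \<le> n" using assms by simp
  have "tree_order s \<le> (\<Sum>t\<leftarrow>ts. tree_order t)" if "s \<in> set ts" for s
    using that by (intro member_le_sum_list) auto
  with sum have "set ts \<subseteq> {t. tree_order t \<le> n}" using order_trans by blast
  moreover have "length ts \<le> n" using length_le_order_sum sum by (rule order_trans)
  ultimately show ?thesis by blast
qed

lemma finite_trees_order_le: "finite {t. tree_order t \<le> n}"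
proof (induction n)
  case 0
  show ?case unfolding no_tree_order_0 by simp
next
  case (Suc n)
  have "{t. tree_order t \<le> Suc n} \<subseteq> Node ` {ts. set ts \<subseteq> {t. tree_order t \<le> n} \<and> length ts \<le> n}"
  proof
    fix t assume t: "t \<in> {t. tree_order t \<le> Suc n}"
    obtain ts where ts: "t = Node ts" by (cases t)
    then show "t \<in> Node ` {ts. set ts \<subseteq> {t. tree_order t \<le> n} \<and> length ts \<le> n}"
      using t subtrees_of_order_le[of ts n] by blast
  qed
  moreover have "finite {ts. set ts \<subseteq> {t. tree_order t \<le> n} \<and> length ts \<le> n}"
    by (rule finite_lists_length_le[OF Suc])
  ultimately show ?case by (meson finite_imageI finite_subset)
qed

text \<open>\<open>M m\<close> is the \<open>m\<close>-th Taylor coefficient of \<open>g\<close> at \<open>z0\<close>, with the factor \<open>1 / m!\<close> included. Because of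
  this factor, the elementary differentials below need no symmetry coefficients: expanding
  \<open>M m (v, \<dots>, v)\<close> for a sum \<open>v\<close> indexed by trees yields every plane tree exactly once.\<close>

locale taylor_field =
  fixes g :: "'z::real_normed_vector \<Rightarrow> 'z" and z0 :: 'z and S :: "'z set"
    and M :: "nat \<Rightarrow> 'z list \<Rightarrow> 'z"
  assumes multilinear: "bounded_multilinear m (M m)"
    and taylor: "(\<lambda>z. norm (g z - (\<Sum>m\<le>q. M m (replicate m (z - z0)))))
      \<in> O[inf (nhds z0) (principal S)](\<lambda>z. norm (z - z0) ^ Suc q)"
begin

section \<open>Elementary differentials and truncated B-series\<close>

fun elem_diff :: "rtree \<Rightarrow> 'z" where
  "elem_diff (Node ts) = M (length ts) (map elem_diff ts)"

definition bseries :: "nat \<Rightarrow> (rtree \<Rightarrow> real) \<Rightarrow> real \<Rightarrow> 'z" where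
  "bseries k \<alpha> h = (\<Sum>t\<in>{t. tree_order t \<le> k}. (h ^ tree_order t * \<alpha> t) *\<^sub>R elem_diff t)"

text \<open>The B-series of \<open>g (z0 + v)\<close> for \<open>v = bseries k \<alpha>\<close>; the shifted exponent accounts for the missing
  factor \<open>h\<close>.\<close>

definition bseries_field :: "nat \<Rightarrow> (rtree \<Rightarrow> real) \<Rightarrow> real \<Rightarrow> 'z" where
  "bseries_field k \<alpha> h = (\<Sum>ts\<in>{ts. tree_order (Node ts) \<le> Suc k}.
     (h ^ (tree_order (Node ts) - 1) * prod_list (map \<alpha> ts)) *\<^sub>R elem_diff (Node ts))"

text \<open>Grafting a list of subtrees onto a new root is a bijection onto trees, and the factor
  \<open>h\<close> pays for the root. So \<open>h\<close> times the field along a B-series is again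
  a B-series, valid for trees of one more order.\<close>

lemma bseries_field_eq:
  assumes "\<And>ts. \<beta> (Node ts) = prod_list (map \<alpha> ts)"
  shows "h *\<^sub>R bseries_field k \<alpha> h = bseries (Suc k) \<beta> h"
  unfolding bseries_def bseries_field_def scaleR_sum_right
proof (rule sum.reindex_bij_witness[of _ "\<lambda>t. case t of Node ts \<Rightarrow> ts" Node])
  fix ts
  show "(h ^ tree_order (Node ts) * \<beta> (Node ts)) *\<^sub>R elem_diff (Node ts) =
    h *\<^sub>R (h ^ (tree_order (Node ts) - 1) * prod_list (map \<alpha> ts)) *\<^sub>R elem_diff (Node ts)"
    using assms by (simp del: elem_diff.simps add: mult.assoc)
qed (auto split: rtree.splits simp del: tree_order.simps)

lemma bseries_bigo:
  assumes F: "F \<le> at_right (0::real)"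
  shows "(\<lambda>h. norm (bseries k \<alpha> h)) \<in> O[F](\<lambda>h. h)"
  unfolding bseries_def
proof (rule norm_sum_bigo)
  fix t
  have "(\<lambda>h. h ^ tree_order t * \<alpha> t) \<in> O[F](\<lambda>h. h ^ 1)"
    using bigo_power_mono[OF F, of 1 "tree_order t"] tree_order_pos[of t]
    by (cases "\<alpha> t = 0") auto
  from norm_scaleR_bigo[OF this, of "\<lambda>_. elem_diff t" "\<lambda>_. 1"]
  show "(\<lambda>h. norm ((h ^ tree_order t * \<alpha> t) *\<^sub>R elem_diff t)) \<in> O[F](\<lambda>h. h)"
    by simp
qed

text \<open>Three errors are added: the Taylor remainder of \<open>g\<close>, the exchange of
  \<open>v\<close> for its B-series inside the Taylor polynomial, and the surplus words of trees
  that arise when the polynomial is multiplied out.\<close>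

lemma bseries_field_bigo:
  assumes F: "F \<le> at_right (0::real)"
    and v: "(\<lambda>h. norm (v h - bseries k \<alpha> h)) \<in> O[F](\<lambda>h. h ^ Suc k)"
    and S: "\<forall>\<^sub>F h in F. z0 + v h \<in> S"
  shows "(\<lambda>h. norm (g (z0 + v h) - bseries_field k \<alpha> h)) \<in> O[F](\<lambda>h. h ^ Suc k)"
proof -
  let ?L = "\<lambda>m. {ts. set ts \<subseteq> {t. tree_order t \<le> k} \<and> length ts = m}"
  let ?T = "\<lambda>ts h. (h ^ (tree_order (Node ts) - 1) * prod_list (map \<alpha> ts)) *\<^sub>R elem_diff (Node ts)"
  let ?A = "{ts. set ts \<subseteq> {t. tree_order t \<le> k} \<and> length ts \<le> k}"
  let ?B = "{ts. tree_order (Node ts) \<le> Suc k}"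
  have Lfin: "finite (?L m)" for m
    by (rule finite_lists_length_eq[OF finite_trees_order_le])
  have vO: "(\<lambda>h. norm (v h)) \<in> O[F](\<lambda>h. h)"
    using norm_add_bigo[OF landau_o.big_trans[OF v bigo_power_mono[OF F, of 1 "Suc k"]], of "bseries k \<alpha>"]
      bseries_bigo[OF F, of k \<alpha>] by simp
  have "(v \<longlongrightarrow> 0) F" by (rule norm_bigo_ident_tendsto[OF F vO])
  then have "((\<lambda>h. z0 + v h) \<longlongrightarrow> z0) F" by (auto intro!: tendsto_eq_intros)
  \<comment> \<open>The expansion of \<open>g\<close> holds within \<open>S\<close> only, so
    composing it with \<open>z0 + v h\<close> requires eventual membership besides
    convergence.\<close>
  then have lim: "filterlim (\<lambda>h. z0 + v h) (inf (nhds z0) (principal S)) F"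
    using S by (simp add: filterlim_inf filterlim_principal)
  have "(\<lambda>h. norm (g (z0 + v h) - (\<Sum>m\<le>k. M m (replicate m (v h))))) \<in> O[F](\<lambda>h. norm (v h) ^ Suc k)"
    using landau_o.big.compose[OF taylor[of k] lim] by simp
  also have "(\<lambda>h. norm (v h) ^ Suc k) \<in> O[F](\<lambda>h. h ^ Suc k)"
    by (rule landau_o.big_power[OF vO])
  finally have 1: "(\<lambda>h. norm (g (z0 + v h) - (\<Sum>m\<le>k. M m (replicate m (v h))))) \<in> O[F](\<lambda>h. h ^ Suc k)" .
  have 2: "(\<lambda>h. norm (\<Sum>m\<le>k. M m (replicate m (v h)) - M m (replicate m (bseries k \<alpha> h)))) \<in> O[F](\<lambda>h. h ^ Suc k)"
    by (intro norm_sum_bigo multilinear_perturbation_bigo[OF multilinear F vO bseries_bigo[OF F] v])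
  have expand: "M m (replicate m (bseries k \<alpha> h)) = (\<Sum>ts\<in>?L m. ?T ts h)" for m h
  proof -
    have "M m (replicate m (bseries k \<alpha> h)) =
        (\<Sum>ts\<in>?L m. M m (map (\<lambda>t. (h ^ tree_order t * \<alpha> t) *\<^sub>R elem_diff t) ts))"
      using multilinear_sum_list[OF multilinear, of "[]" m m "{t. tree_order t \<le> k}"] finite_trees_order_le
      by (simp add: bseries_def)
    also have "\<dots> = (\<Sum>ts\<in>?L m. ?T ts h)"
    proof (intro sum.cong refl)
      fix ts assume ts: "ts \<in> ?L m"
      have "prod_list (map (\<lambda>t. h ^ tree_order t * \<alpha> t) ts) =
          h ^ (\<Sum>t\<leftarrow>ts. tree_order t) * prod_list (map \<alpha> ts)"
        by (induction ts) (auto simp: power_add mult_ac)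
      then show "M m (map (\<lambda>t. (h ^ tree_order t * \<alpha> t) *\<^sub>R elem_diff t) ts) = ?T ts h"
        using multilinear_scale_list[OF multilinear, of "[]" ts "[]" m "\<lambda>t. h ^ tree_order t * \<alpha> t" elem_diff] ts
        by simp
    qed
    finally show ?thesis .
  qed
  have fin: "finite ?A" by (rule finite_lists_length_le[OF finite_trees_order_le])
  have sub: "?B \<subseteq> ?A"
    using subtrees_of_order_le by blast
  have sum_eq: "(\<Sum>m\<le>k. M m (replicate m (bseries k \<alpha> h))) - bseries_field k \<alpha> h = (\<Sum>ts\<in>?A - ?B. ?T ts h)" for h
  proof -
    have "(\<Sum>m\<le>k. M m (replicate m (bseries k \<alpha> h))) = (\<Sum>ts\<in>(\<Union>m\<le>k. ?L m). ?T ts h)"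
      unfolding expand using Lfin by (intro sum.UNION_disjoint[symmetric]) auto
    also have "(\<Union>m\<le>k. ?L m) = ?A" by auto
    finally show ?thesis
      unfolding bseries_field_def using sum_diff[OF fin sub, of "\<lambda>ts. ?T ts h"] by simp
  qed
  have 3: "(\<lambda>h. norm ((\<Sum>m\<le>k. M m (replicate m (bseries k \<alpha> h))) - bseries_field k \<alpha> h)) \<in> O[F](\<lambda>h. h ^ Suc k)"
    unfolding sum_eq
  proof (rule norm_sum_bigo)
    fix ts assume "ts \<in> ?A - ?B"
    \<comment> \<open>A word outside \<open>?B\<close> belongs to a tree of order at least k + 2;
      its root contributes no power of \<open>h\<close>, which leaves the exponent at least k +
      1.\<close>
    then have "Suc k \<le> tree_order (Node ts) - 1" by auto
    then have "(\<lambda>h. h ^ (tree_order (Node ts) - 1) * prod_list (map \<alpha> ts)) \<in> O[F](\<lambda>h. h ^ Suc k)"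
      using bigo_power_mono[OF F] by (cases "prod_list (map \<alpha> ts) = 0") (auto simp del: tree_order.simps power_Suc)
    from norm_scaleR_bigo[OF this, of "\<lambda>_. elem_diff (Node ts)" "\<lambda>_. 1"]
    show "(\<lambda>h. norm (?T ts h)) \<in> O[F](\<lambda>h. h ^ Suc k)" by simp
  qed
  have eq: "g (z0 + v h) - bseries_field k \<alpha> h =
      (g (z0 + v h) - (\<Sum>m\<le>k. M m (replicate m (v h)))) +
      ((\<Sum>m\<le>k. M m (replicate m (v h)) - M m (replicate m (bseries k \<alpha> h))) +
      ((\<Sum>m\<le>k. M m (replicate m (bseries k \<alpha> h))) - bseries_field k \<alpha> h))" for h
    by (simp add: sum_subtractf)
  show ?thesis
    unfolding eq by (rule norm_add_bigo[OF 1 norm_add_bigo[OF 2 3]])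
qed

section \<open>B-series of the stage values\<close>

lemma bseries_0: "bseries 0 \<alpha> h = 0"
  unfolding bseries_def no_tree_order_0 by simp

text \<open>The coefficients of the displacement of stage \<open>i\<close>. Those of
  \<open>h\<close> times the slope at this stage are given by \<open>stage_weight\<close>, which at
  \<open>Node ts\<close> is the product of \<open>stage_coeff A i\<close> over
  \<open>ts\<close>.\<close>

definition stage_coeff :: "real^'s^'s \<Rightarrow> 's \<Rightarrow> rtree \<Rightarrow> real" where
  "stage_coeff A i t = (\<Sum>j\<in>UNIV. A $ i $ j * stage_weight A t j)"

lemma bseries_stage_coeff:
  "bseries k (stage_coeff A i) h = (\<Sum>j\<in>UNIV. A $ i $ j *\<^sub>R bseries k (\<lambda>t. stage_weight A t j) h)"
  unfolding bseries_def stage_coeff_def scaleR_sum_right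
  by (subst sum.swap) (simp add: sum_distrib_left scaleR_sum_left mult_ac)

text \<open>The truncated B-series satisfy the stage equations with \<open>bseries_field\<close> in
  place of \<open>g\<close>. Subtraction leaves \<open>h\<close> times the slope errors, which the
  induction hypothesis controls; the empty series and the assumed bound O(h) start the
  induction.\<close>

lemma stages_bigo:
  fixes A :: "real^'s^'s" and v :: "real \<Rightarrow> 's \<Rightarrow> 'z"
  assumes F: "F \<le> at_right (0::real)"
    and stage: "\<forall>\<^sub>F h in F. \<forall>i. v h i = h *\<^sub>R (\<Sum>j\<in>UNIV. A $ i $ j *\<^sub>R g (z0 + v h j))"
    and S: "\<forall>\<^sub>F h in F. \<forall>i. z0 + v h i \<in> S"
    and v: "\<And>i. (\<lambda>h. norm (v h i)) \<in> O[F](\<lambda>h. h)"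
  shows "(\<lambda>h. norm (v h i - bseries k (stage_coeff A i) h)) \<in> O[F](\<lambda>h. h ^ Suc k)"
proof (induction k arbitrary: i)
  case 0
  then show ?case using v by (simp add: bseries_0)
next
  case (Suc k)
  have Sj: "\<forall>\<^sub>F h in F. z0 + v h j \<in> S" for j using S by eventually_elim simp
  have est: "(\<lambda>h. norm (g (z0 + v h j) - bseries_field k (stage_coeff A j) h)) \<in> O[F](\<lambda>h. h ^ Suc k)" for j
    by (rule bseries_field_bigo[OF F Suc.IH Sj])
  have "(\<lambda>h. norm (h *\<^sub>R (\<Sum>j\<in>UNIV. A $ i $ j *\<^sub>R (g (z0 + v h j) - bseries_field k (stage_coeff A j) h))))
      \<in> O[F](\<lambda>h. h * (1 * h ^ Suc k))"
    by (intro norm_scaleR_bigo norm_sum_bigo est) auto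
  moreover have "\<forall>\<^sub>F h in F. norm (h *\<^sub>R (\<Sum>j\<in>UNIV. A $ i $ j *\<^sub>R (g (z0 + v h j) - bseries_field k (stage_coeff A j) h))) =
      norm (v h i - bseries (Suc k) (stage_coeff A i) h)"
    using stage
  proof eventually_elim
    case (elim h)
    have "h *\<^sub>R bseries_field k (stage_coeff A j) h = bseries (Suc k) (\<lambda>t. stage_weight A t j) h" for j
      by (rule bseries_field_eq) (simp add: stage_coeff_def[abs_def])
    note bf = this[symmetric]
    have "bseries (Suc k) (stage_coeff A i) h =
        h *\<^sub>R (\<Sum>j\<in>UNIV. A $ i $ j *\<^sub>R bseries_field k (stage_coeff A j) h)"
      unfolding bseries_stage_coeff bf by (simp add: scaleR_sum_right mult.commute)
    moreover have "v h i = h *\<^sub>R (\<Sum>j\<in>UNIV. A $ i $ j *\<^sub>R g (z0 + v h j))" using elim by blast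
    ultimately show ?case
      by (simp only: scaleR_diff_right[symmetric] sum_subtractf[symmetric])
  qed
  ultimately show ?case by (subst landau_o.big.in_cong[symmetric]) simp_all
qed

section \<open>B-series of the exact solution and the order of the method\<close>

definition exact_coeff :: "rtree \<Rightarrow> real" where
  "exact_coeff t = 1 / real (tree_density t)"

text \<open>Differentiation brings down the order of the tree. Since the density is the order times
  the densities of the subtrees, what remains is the product of the coefficients of the subtrees:
  the truncated series solves the differential equation with the truncated field.\<close>

lemma bseries_exact_deriv:
  "(bseries (Suc k) exact_coeff has_vector_derivative bseries_field k exact_coeff h) (at h within X)"
proof -
  have "((\<lambda>h. (h ^ tree_order t * exact_coeff t) *\<^sub>R elem_diff t) has_vector_derivative
      (real (tree_order t) * h ^ (tree_order t - 1) * exact_coeff t) *\<^sub>R elem_diff t) (at h within X)" for t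
    by (auto intro!: derivative_eq_intros)
  then have "(bseries (Suc k) exact_coeff has_vector_derivative (\<Sum>t\<in>{t. tree_order t \<le> Suc k}.
      (real (tree_order t) * h ^ (tree_order t - 1) * exact_coeff t) *\<^sub>R elem_diff t)) (at h within X)"
    unfolding bseries_def[abs_def] by (intro has_vector_derivative_sum)
  moreover have "(\<Sum>t\<in>{t. tree_order t \<le> Suc k}.
      (real (tree_order t) * h ^ (tree_order t - 1) * exact_coeff t) *\<^sub>R elem_diff t) = bseries_field k exact_coeff h"
    unfolding bseries_field_def
  proof (rule sum.reindex_bij_witness[of _ Node "\<lambda>t. case t of Node ts \<Rightarrow> ts"])
    fix t
    obtain ts where t: "t = Node ts" by (cases t)
    have "prod_list (map exact_coeff ts) = 1 / real (prod_list (map tree_density ts))"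
      by (induction ts) (auto simp: exact_coeff_def)
    then have "real (tree_order t) * exact_coeff t = prod_list (map exact_coeff ts)"
      using tree_order_pos[of t] by (simp add: t exact_coeff_def del: tree_order.simps)
    then have "real (tree_order t) * h ^ (tree_order t - 1) * exact_coeff t =
        h ^ (tree_order t - 1) * prod_list (map exact_coeff ts)"
      by (metis mult.assoc mult.left_commute)
    then show "(h ^ (tree_order (Node (case t of Node ts \<Rightarrow> ts)) - 1) * prod_list (map exact_coeff (case t of Node ts \<Rightarrow> ts))) *\<^sub>R
        elem_diff (Node (case t of Node ts \<Rightarrow> ts)) =
      (real (tree_order t) * h ^ (tree_order t - 1) * exact_coeff t) *\<^sub>R elem_diff t"
      by (simp only: t rtree.case)
  qed (auto split: rtree.splits simp del: tree_order.simps)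
  ultimately show ?thesis by simp
qed

lemma exact_solution_bigo:
  assumes "\<delta> > 0" and v0: "v 0 = 0"
    and ode: "\<And>h. h \<in> {0..\<delta>} \<Longrightarrow> (v has_vector_derivative g (z0 + v h)) (at h within {0..\<delta>})"
    and S: "\<And>h. h \<in> {0..\<delta>} \<Longrightarrow> z0 + v h \<in> S"
  shows "(\<lambda>h. norm (v h - bseries k exact_coeff h)) \<in> O[at_right 0](\<lambda>h. h ^ Suc k)"
proof (induction k)
  case 0
  \<comment> \<open>Differentiability of \<open>v\<close> at 0, used with tolerance 1, already
    yields the bound O(h) that starts the induction.\<close>
  have "\<exists>d>0. \<forall>h\<in>{0..\<delta>}. \<bar>h\<bar> < d \<longrightarrow> norm (v h - h *\<^sub>R g z0) \<le> 1 * \<bar>h\<bar>"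
    using ode[of 0, unfolded has_vector_derivative_def has_derivative_within_alt, THEN conjunct2,
        rule_format, of 1] \<open>\<delta> > 0\<close> v0 by simp
  then obtain d where d: "d > 0" "\<And>h. h \<in> {0..\<delta>} \<Longrightarrow> \<bar>h\<bar> < d \<Longrightarrow> norm (v h - h *\<^sub>R g z0) \<le> 1 * \<bar>h\<bar>"
    by blast
  have "norm (v h) \<le> (1 + norm (g z0)) * h" if "0 < h" "h < min d \<delta>" for h
    using d(2)[of h] that norm_triangle_sub[of "v h" "h *\<^sub>R g z0"] by (simp add: algebra_simps)
  then have "\<forall>\<^sub>F h in at_right 0. norm (v h) \<le> (1 + norm (g z0)) * h"
    using d(1) \<open>\<delta> > 0\<close> by (auto simp: eventually_at_right_field intro!: exI[of _ "min d \<delta>"])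
  then show ?case by (simp add: bseries_0 norm_bigoI)
next
  case (Suc k)
  let ?e = "\<lambda>h. v h - bseries (Suc k) exact_coeff h"
  have ev: "\<forall>\<^sub>F h in at_right 0. h \<in> {0<..<\<delta>}" by (rule eventually_at_right_real[OF \<open>\<delta> > 0\<close>])
  have "(\<lambda>h. norm (g (z0 + v h) - bseries_field k exact_coeff h)) \<in> O[at_right 0](\<lambda>h. h ^ Suc k)"
    by (rule bseries_field_bigo[OF order_refl Suc.IH]) (use ev in eventually_elim, use S in auto)
  then obtain C where C: "C > 0"
    "\<forall>\<^sub>F h in at_right 0. norm (g (z0 + v h) - bseries_field k exact_coeff h) \<le> C * \<bar>h ^ Suc k\<bar>"
    by (rule norm_bigoE)
  from eventually_conj[OF C(2) ev] obtain d where d: "d > 0" "\<And>h. 0 < h \<Longrightarrow> h < d \<Longrightarrow>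
      norm (g (z0 + v h) - bseries_field k exact_coeff h) \<le> C * \<bar>h ^ Suc k\<bar> \<and> h < \<delta>"
    unfolding eventually_at_right_field by auto
  have "norm (?e h) \<le> C * h ^ Suc (Suc k)" if h: "h > 0" "h < d" for h
  proof -
    have der: "(?e has_vector_derivative g (z0 + v s) - bseries_field k exact_coeff s) (at s within {0..h})"
      if "s \<in> {0..h}" for s
      by (rule has_vector_derivative_diff[OF has_vector_derivative_within_subset[OF ode] bseries_exact_deriv])
         (use that h d(2)[of h] in auto)
    \<comment> \<open>With \<open>h\<close> fixed, the derivative of the error is bounded on the
      whole interval by its bound at the right end point; this loses a constant only.\<close>
    have "norm (?e h - ?e 0) \<le> (C * h ^ Suc k) * h - (C * h ^ Suc k) * 0"
    proof (rule differentiable_bound_general[of 0 h ?e "\<lambda>t. (C * h ^ Suc k) * t"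
          "\<lambda>s. g (z0 + v s) - bseries_field k exact_coeff s" "\<lambda>_. C * h ^ Suc k"])
      show "continuous_on {0..h} ?e"
        by (rule continuous_on_vector_derivative) (use der in auto)
      show "(?e has_vector_derivative g (z0 + v s) - bseries_field k exact_coeff s) (at s)" if "0 < s" "s < h" for s
        using der[of s] that at_within_interior[of s "{0..h}"] by simp
      show "norm (g (z0 + v s) - bseries_field k exact_coeff s) \<le> C * h ^ Suc k" if "0 < s" "s < h" for s
      proof -
        have "s ^ Suc k \<le> h ^ Suc k" using that by (intro power_mono) auto
        then have "C * \<bar>s ^ Suc k\<bar> \<le> C * h ^ Suc k" using C(1) that by (intro mult_left_mono) auto
        then show ?thesis using d(2)[of s] that h by auto
      qed
    qed (use h in \<open>auto intro!: continuous_intros derivative_eq_intros\<close>)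
    moreover have "bseries (Suc k) exact_coeff 0 = 0"
      unfolding bseries_def by (intro sum.neutral ballI) (simp add: tree_order_pos)
    ultimately show ?thesis using v0 by (simp add: mult_ac)
  qed
  then show ?case
    by (intro norm_bigoI[where C = C]) (auto simp: eventually_at_right_field intro!: exI[of _ d] d(1))
qed

text \<open>The filter is a parameter because \<open>small_steps\<close> can be trivial instead of
  \<open>at_right 0\<close>. The truncated series of update and solution coincide, so both distances
  to that common series are bounded and subtracted.\<close>

theorem runge_kutta_order:
  fixes A :: "real^'s^'s" and b :: "real^'s" and v :: "real \<Rightarrow> 's \<Rightarrow> 'z" and z :: "real \<Rightarrow> 'z"
  assumes F: "F \<le> at_right (0::real)"
    and stage: "\<forall>\<^sub>F h in F. \<forall>i. v h i = h *\<^sub>R (\<Sum>j\<in>UNIV. A $ i $ j *\<^sub>R g (z0 + v h j))"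
    and S: "\<forall>\<^sub>F h in F. \<forall>i. z0 + v h i \<in> S"
    and v: "\<And>i. (\<lambda>h. norm (v h i)) \<in> O[F](\<lambda>h. h)"
    and "\<delta> > 0" and z: "z 0 = z0"
    and ode: "\<And>h. h \<in> {0..\<delta>} \<Longrightarrow> (z has_vector_derivative g (z h)) (at h within {0..\<delta>})"
    and zS: "\<And>h. h \<in> {0..\<delta>} \<Longrightarrow> z h \<in> S"
    and order: "rk_order_accurate A b (Suc k)"
  shows "(\<lambda>h. norm (z0 + h *\<^sub>R (\<Sum>i\<in>UNIV. b $ i *\<^sub>R g (z0 + v h i)) - z h)) \<in> O[F](\<lambda>h. h ^ Suc (Suc k))"
proof -
  have Sj: "\<forall>\<^sub>F h in F. z0 + v h j \<in> S" for j using S by eventually_elim simp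
  have est: "(\<lambda>h. norm (g (z0 + v h j) - bseries_field k (stage_coeff A j) h)) \<in> O[F](\<lambda>h. h ^ Suc k)" for j
    by (rule bseries_field_bigo[OF F stages_bigo[OF F stage S v] Sj])
  have 1: "(\<lambda>h. norm (h *\<^sub>R (\<Sum>j\<in>UNIV. b $ j *\<^sub>R (g (z0 + v h j) - bseries_field k (stage_coeff A j) h))))
      \<in> O[F](\<lambda>h. h * (1 * h ^ Suc k))"
    by (intro norm_scaleR_bigo norm_sum_bigo est) auto
  have "(\<lambda>h. norm ((z h - z0) - bseries (Suc k) exact_coeff h)) \<in> O[at_right 0](\<lambda>h. h ^ Suc (Suc k))"
  proof (rule exact_solution_bigo[OF \<open>\<delta> > 0\<close>])
    fix h assume h: "h \<in> {0..\<delta>}"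
    show "((\<lambda>h. z h - z0) has_vector_derivative g (z0 + (z h - z0))) (at h within {0..\<delta>})"
      using has_vector_derivative_diff[OF ode[OF h] has_vector_derivative_const[of z0]] by simp
  qed (use z zS in auto)
  then have 2: "(\<lambda>h. norm ((z h - z0) - bseries (Suc k) exact_coeff h)) \<in> O[F](\<lambda>h. h ^ Suc (Suc k))"
    by (rule landau_o.big.filter_mono[OF F])
  have bs: "h *\<^sub>R (\<Sum>j\<in>UNIV. b $ j *\<^sub>R bseries_field k (stage_coeff A j) h) = bseries (Suc k) exact_coeff h" for h
  proof -
    have "h *\<^sub>R bseries_field k (stage_coeff A j) h = bseries (Suc k) (\<lambda>t. stage_weight A t j) h" for j
      by (rule bseries_field_eq) (simp add: stage_coeff_def[abs_def])
    note bf = this[symmetric]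
    have "h *\<^sub>R (\<Sum>j\<in>UNIV. b $ j *\<^sub>R bseries_field k (stage_coeff A j) h) =
        (\<Sum>j\<in>UNIV. b $ j *\<^sub>R bseries (Suc k) (\<lambda>t. stage_weight A t j) h)"
      unfolding bf by (simp add: scaleR_sum_right mult.commute)
    also have "\<dots> = (\<Sum>t\<in>{t. tree_order t \<le> Suc k}.
        (h ^ tree_order t * (\<Sum>j\<in>UNIV. b $ j * stage_weight A t j)) *\<^sub>R elem_diff t)"
      unfolding bseries_def scaleR_sum_right
      by (subst sum.swap) (simp add: sum_distrib_left scaleR_sum_left mult_ac)
    \<comment> \<open>Here the order conditions enter: they equate the coefficients tree by tree up
      to order \<open>Suc k\<close>.\<close>
    also have "\<dots> = bseries (Suc k) exact_coeff h"
      unfolding bseries_def using order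
      by (intro sum.cong) (auto simp: rk_order_accurate_def exact_coeff_def)
    finally show ?thesis .
  qed
  have eq: "z0 + h *\<^sub>R (\<Sum>i\<in>UNIV. b $ i *\<^sub>R g (z0 + v h i)) - z h =
      h *\<^sub>R (\<Sum>j\<in>UNIV. b $ j *\<^sub>R (g (z0 + v h j) - bseries_field k (stage_coeff A j) h)) -
      ((z h - z0) - bseries (Suc k) exact_coeff h)" for h
    unfolding bs[symmetric] by (simp add: scaleR_diff_right sum_subtractf)
  show ?thesis
    unfolding eq using norm_diff_bigo[OF _ 2] 1 by simp
qed

end

section \<open>Maps with a Taylor expansion at a point\<close>

text \<open>The assumptions of \<open>taylor_field\<close> as a property of a single map, with an
  independent codomain, so that the augmented field can be assembled from its components.\<close>

definition taylor_expandable ::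
    "'a::real_normed_vector set \<Rightarrow> 'a \<Rightarrow> ('a \<Rightarrow> 'b::real_normed_vector) \<Rightarrow> bool" where
  "taylor_expandable S z0 g \<longleftrightarrow> (\<exists>M. (\<forall>m. bounded_multilinear m (M m)) \<and>
     (\<forall>q. (\<lambda>z. norm (g z - (\<Sum>m\<le>q. M m (replicate m (z - z0)))))
       \<in> O[inf (nhds z0) (principal S)](\<lambda>z. norm (z - z0) ^ Suc q)))"

lemma taylor_expandableE:
  assumes "taylor_expandable S z0 g"
  obtains M where "\<And>m. bounded_multilinear m (M m)"
    and "\<And>q. (\<lambda>z. norm (g z - (\<Sum>m\<le>q. M m (replicate m (z - z0)))))
      \<in> O[inf (nhds z0) (principal S)](\<lambda>z. norm (z - z0) ^ Suc q)"
  using assms unfolding taylor_expandable_def by blast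

lemma eventually_near_within:
  assumes "d > 0"
  shows "\<forall>\<^sub>F z in inf (nhds z0) (principal S). z \<in> S \<and> norm (z - z0) < d"
  using eventually_nhds_metric[of "\<lambda>z. norm (z - z0) < d" z0] assms
  by (auto simp: eventually_inf_principal dist_norm elim: eventually_mono)

section \<open>Algebra of bounded multilinear maps\<close>

lemma bounded_multilinear_scaleR:
  assumes "bounded_multilinear k M"
  shows "bounded_multilinear k (\<lambda>vs. c *\<^sub>R M vs)"
proof -
  obtain K where K: "\<And>vs. length vs = k \<Longrightarrow> norm (M vs) \<le> K * prod_list (map norm vs)"
    using bounded_multilinear_bound[OF assms] by blast
  show ?thesis
  proof (rule bounded_multilinearI)
    show "linear (\<lambda>v. c *\<^sub>R M (us @ v # ws))" if "Suc (length us + length ws) = k" for us ws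
      by (intro linear_compose_scale_right bounded_multilinear_linear[OF assms that])
    show "norm (c *\<^sub>R M vs) \<le> (\<bar>c\<bar> * K) * prod_list (map norm vs)" if "length vs = k" for vs
      using mult_left_mono[OF K[OF that], of "\<bar>c\<bar>"] by (simp add: mult.assoc)
  qed
qed

lemma bounded_multilinear_sum:
  assumes "\<And>i. i \<in> I \<Longrightarrow> bounded_multilinear k (M i)"
  shows "bounded_multilinear k (\<lambda>vs. \<Sum>i\<in>I. M i vs)"
proof -
  have "\<exists>K. \<forall>vs. length vs = k \<longrightarrow> norm (M i vs) \<le> K * prod_list (map norm vs)" if "i \<in> I" for i
    using assms[OF that] unfolding bounded_multilinear_def by blast
  then obtain K where K: "\<And>i vs. i \<in> I \<Longrightarrow> length vs = k \<Longrightarrow> norm (M i vs) \<le> K i * prod_list (map norm vs)"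
    by metis
  show ?thesis
  proof (rule bounded_multilinearI)
    show "linear (\<lambda>v. \<Sum>i\<in>I. M i (us @ v # ws))" if "Suc (length us + length ws) = k" for us ws
      by (intro linear_compose_sum ballI bounded_multilinear_linear[OF assms that])
    show "norm (\<Sum>i\<in>I. M i vs) \<le> sum K I * prod_list (map norm vs)" if "length vs = k" for vs
      unfolding sum_distrib_right using that by (intro sum_norm_le K)
  qed
qed

lemma bounded_multilinear_Pair:
  assumes "bounded_multilinear k M" "bounded_multilinear k N"
  shows "bounded_multilinear k (\<lambda>vs. (M vs, N vs))"
proof -
  obtain K where K: "\<And>vs. length vs = k \<Longrightarrow> norm (M vs) \<le> K * prod_list (map norm vs)"
    using bounded_multilinear_bound[OF assms(1)] by blast
  obtain L where L: "\<And>vs. length vs = k \<Longrightarrow> norm (N vs) \<le> L * prod_list (map norm vs)"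
    using bounded_multilinear_bound[OF assms(2)] by blast
  show ?thesis
  proof (rule bounded_multilinearI)
    show "linear (\<lambda>v. (M (us @ v # ws), N (us @ v # ws)))" if "Suc (length us + length ws) = k" for us ws
    proof -
      interpret M: linear "\<lambda>v. M (us @ v # ws)" by (rule bounded_multilinear_linear[OF assms(1) that])
      interpret N: linear "\<lambda>v. N (us @ v # ws)" by (rule bounded_multilinear_linear[OF assms(2) that])
      show ?thesis by (rule linearI) (auto simp: M.add N.add M.scaleR N.scaleR)
    qed
    show "norm (M vs, N vs) \<le> (K + L) * prod_list (map norm vs)" if "length vs = k" for vs
      using norm_Pair_le[of "M vs" "N vs"] K[OF that] L[OF that] by (simp add: distrib_right)
  qed
qed

lemma prod_list_norm_map_le:
  assumes "B \<ge> 0" "\<And>v. norm (L v) \<le> norm v * B"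
  shows "prod_list (map norm (map L vs)) \<le> B ^ length vs * prod_list (map norm vs)"
proof (induction vs)
  case (Cons v vs)
  have "norm (L v) * prod_list (map norm (map L vs)) \<le> (norm v * B) * (B ^ length vs * prod_list (map norm vs))"
    using assms by (intro mult_mono Cons.IH) (auto simp del: map_map)
  then show ?case by (simp add: mult_ac)
qed simp

lemma bounded_multilinear_map:
  assumes M: "bounded_multilinear k M" and L: "bounded_linear L"
  shows "bounded_multilinear k (\<lambda>vs. M (map L vs))"
proof -
  interpret L: bounded_linear L by fact
  obtain K where K: "K > 0" "\<And>vs. length vs = k \<Longrightarrow> norm (M vs) \<le> K * prod_list (map norm vs)"
    using bounded_multilinear_bound[OF M] by blast
  obtain B where B: "B > 0" "\<And>v. norm (L v) \<le> norm v * B" using L.pos_bounded by blast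
  show ?thesis
  proof (rule bounded_multilinearI)
    show "linear (\<lambda>v. M (map L (us @ v # ws)))" if "Suc (length us + length ws) = k" for us ws
      using linear_compose[OF L.linear_axioms bounded_multilinear_linear[OF M, of "map L us" "map L ws"]] that
      by (simp add: o_def)
    show "norm (M (map L vs)) \<le> (K * B ^ k) * prod_list (map norm vs)" if "length vs = k" for vs
      using order_trans[OF K(2)[of "map L vs"] mult_left_mono[OF prod_list_norm_map_le[of B L vs], of K]] K(1) B that
      by (simp add: mult.assoc)
  qed
qed

text \<open>The general term in the product of two expansions: the first \<open>i\<close> vectors
  feed a derivative of the outer map, the remaining ones a coefficient of the inner map, whose value
  fills the last slot.\<close>

lemma bounded_multilinear_insert_last:
  assumes N: "bounded_multilinear (Suc i) N" and M: "bounded_multilinear j M" and P: "bounded_linear P"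
  shows "bounded_multilinear (i + j) (\<lambda>vs. N (map P (take i vs) @ [M (drop i vs)]))"
proof -
  interpret P: bounded_linear P by fact
  obtain K where K: "K > 0" "\<And>vs. length vs = Suc i \<Longrightarrow> norm (N vs) \<le> K * prod_list (map norm vs)"
    using bounded_multilinear_bound[OF N] by blast
  obtain L where L: "L > 0" "\<And>vs. length vs = j \<Longrightarrow> norm (M vs) \<le> L * prod_list (map norm vs)"
    using bounded_multilinear_bound[OF M] by blast
  obtain B where B: "B > 0" "\<And>v. norm (P v) \<le> norm v * B" using P.pos_bounded by blast
  show ?thesis
  proof (rule bounded_multilinearI)
    fix us ws :: "'c list" assume len: "Suc (length us + length ws) = i + j"
    show "linear (\<lambda>v. N (map P (take i (us @ v # ws)) @ [M (drop i (us @ v # ws))]))"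
    \<comment> \<open>The varied slot lies either among the arguments passed to \<open>N\<close>
      directly or inside those of \<open>M\<close>; in the second case linearity passes through the
      last slot of \<open>N\<close>.\<close>
    proof (cases "length us < i")
      case True
      then obtain l where l: "i - length us = Suc l" by (metis Suc_diff_Suc)
      have "linear (\<lambda>v. N (map P us @ v # (map P (take l ws) @ [M (drop l ws)])))"
        by (rule bounded_multilinear_linear[OF N]) (use l len True in auto)
      from linear_compose[OF P.linear_axioms this] show ?thesis using True l by (simp add: o_def)
    next
      case False
      then have "linear (\<lambda>v. M (drop i us @ v # ws))"
        by (intro bounded_multilinear_linear[OF M]) (use len in auto)
      moreover have "linear (\<lambda>w. N (map P (take i us) @ w # []))"
        by (rule bounded_multilinear_linear[OF N]) (use False in auto)
      ultimately show ?thesis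
        using False linear_compose[of "\<lambda>v. M (drop i us @ v # ws)" "\<lambda>w. N (map P (take i us) @ w # [])"]
        by (simp add: o_def)
    qed
  next
    fix vs :: "'c list" assume len: "length vs = i + j"
    have "norm (N (map P (take i vs) @ [M (drop i vs)]))
        \<le> K * (prod_list (map norm (map P (take i vs))) * norm (M (drop i vs)))"
      using K(2)[of "map P (take i vs) @ [M (drop i vs)]"] len by simp
    also have "\<dots> \<le> K * ((B ^ i * prod_list (map norm (take i vs))) * (L * prod_list (map norm (drop i vs))))"
      using K(1) L(2)[of "drop i vs"] prod_list_norm_map_le[of B P "take i vs"] B len
      by (intro mult_left_mono mult_mono) auto
    also have "\<dots> = (K * B ^ i * L) * (prod_list (map norm (take i vs)) * prod_list (map norm (drop i vs)))"
      by (simp add: mult_ac)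
    also have "prod_list (map norm (take i vs)) * prod_list (map norm (drop i vs)) = prod_list (map norm vs)"
      unfolding prod_list.append[symmetric] map_append[symmetric] append_take_drop_id ..
    finally show "norm (N (map P (take i vs) @ [M (drop i vs)])) \<le> (K * B ^ i * L) * prod_list (map norm vs)" .
  qed
qed

section \<open>Taylor expandability of the components of the augmented field\<close>

lemma taylor_expandable_tower:
  assumes D: "derivative_tower S D" and S: "convex S" "x \<in> S"
  shows "taylor_expandable S x (\<lambda>y. D 0 y [])"
  unfolding taylor_expandable_def
proof (intro exI[of _ "\<lambda>m vs. (1 / fact m) *\<^sub>R D m x vs"] conjI allI)
  show "bounded_multilinear m (\<lambda>vs. (1 / fact m) *\<^sub>R D m x vs)" for m
    by (rule bounded_multilinear_scaleR[OF tower_multilinear[OF D S(2)]])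
  fix q
  obtain C d where d: "d > 0" and est: "\<forall>y\<in>S. norm (y - x) < d \<longrightarrow> (\<forall>vs. length vs = 0 \<longrightarrow>
    norm (D 0 y vs - (\<Sum>m\<le>q. (1 / fact m) *\<^sub>R D (0 + m) x (replicate m (y - x) @ vs)))
      \<le> C * norm (y - x) ^ Suc q * prod_list (map norm vs))"
    using tower_taylor[OF D S, of 0 q] by blast
  show "(\<lambda>z. norm (D 0 z [] - (\<Sum>m\<le>q. (1 / fact m) *\<^sub>R D m x (replicate m (z - x)))))
      \<in> O[inf (nhds x) (principal S)](\<lambda>z. norm (z - x) ^ Suc q)"
  proof (rule norm_bigoI)
    show "\<forall>\<^sub>F y in inf (nhds x) (principal S). norm (D 0 y [] -
        (\<Sum>m\<le>q. (1 / fact m) *\<^sub>R D m x (replicate m (y - x)))) \<le> C * norm (y - x) ^ Suc q"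
      using eventually_near_within[OF d] by eventually_elim (use est in auto)
  qed
qed

lemma taylor_expandable_const: "taylor_expandable S z0 (\<lambda>_. c)"
  unfolding taylor_expandable_def
proof (intro exI[of _ "\<lambda>m vs. if m = 0 then c else 0"] conjI allI)
  show "bounded_multilinear m (\<lambda>vs. if m = 0 then c else 0)" for m
    by (rule bounded_multilinearI[where K = "norm c"]) (auto simp: linear_zero)
  have "(\<Sum>m\<le>q. if m = 0 then c else 0) = c" for q :: nat by simp
  then show "(\<lambda>z. norm (c - (\<Sum>m\<le>q. if m = 0 then c else 0)))
      \<in> O[inf (nhds z0) (principal S)](\<lambda>z. norm (z - z0) ^ Suc q)" for q :: nat
    by simp
qed

lemma taylor_expandable_Pair:
  assumes "taylor_expandable S z0 g1" "taylor_expandable S z0 g2"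
  shows "taylor_expandable S z0 (\<lambda>z. (g1 z, g2 z))"
proof -
  obtain M1 where M1: "\<And>m. bounded_multilinear m (M1 m)"
    "\<And>q. (\<lambda>z. norm (g1 z - (\<Sum>m\<le>q. M1 m (replicate m (z - z0)))))
      \<in> O[inf (nhds z0) (principal S)](\<lambda>z. norm (z - z0) ^ Suc q)"
    using assms(1) by (rule taylor_expandableE) (rule that)
  obtain M2 where M2: "\<And>m. bounded_multilinear m (M2 m)"
    "\<And>q. (\<lambda>z. norm (g2 z - (\<Sum>m\<le>q. M2 m (replicate m (z - z0)))))
      \<in> O[inf (nhds z0) (principal S)](\<lambda>z. norm (z - z0) ^ Suc q)"
    using assms(2) by (rule taylor_expandableE) (rule that)
  have sum_Pair: "(\<Sum>m\<in>I. (a m, b m)) = (sum a I, sum b I)" for I :: "nat set" and a :: "nat \<Rightarrow> 'b" and b :: "nat \<Rightarrow> 'c"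
    by (induction I rule: infinite_finite_induct) (auto simp: zero_prod_def)
  show ?thesis
    unfolding taylor_expandable_def
  proof (intro exI[of _ "\<lambda>m vs. (M1 m vs, M2 m vs)"] conjI allI)
    fix q
    show "(\<lambda>z. norm ((g1 z, g2 z) - (\<Sum>m\<le>q. (M1 m (replicate m (z - z0)), M2 m (replicate m (z - z0))))))
      \<in> O[inf (nhds z0) (principal S)](\<lambda>z. norm (z - z0) ^ Suc q)"
      by (rule landau_o.big_mono[THEN landau_o.big_trans, OF _ sum_in_bigo(1)[OF M1(2) M2(2)]])
         (auto intro!: always_eventually simp: sum_Pair norm_Pair_le)
  qed (intro bounded_multilinear_Pair M1 M2)
qed

lemma taylor_expandable_linear_comp:
  assumes g: "taylor_expandable S' (L z0) g" and L: "bounded_linear L" and S: "L ` S \<subseteq> S'"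
  shows "taylor_expandable S z0 (\<lambda>z. g (L z))"
proof -
  interpret L: bounded_linear L by fact
  obtain M where M: "\<And>m. bounded_multilinear m (M m)"
    "\<And>q. (\<lambda>z. norm (g z - (\<Sum>m\<le>q. M m (replicate m (z - L z0)))))
      \<in> O[inf (nhds (L z0)) (principal S')](\<lambda>z. norm (z - L z0) ^ Suc q)"
    using g by (rule taylor_expandableE) (rule that)
  have "filterlim L (nhds (L z0)) (nhds z0)"
    by (rule L.tendsto[OF filterlim_ident])
  then have lim: "filterlim L (inf (nhds (L z0)) (principal S')) (inf (nhds z0) (principal S))"
    unfolding filterlim_inf filterlim_principal using S
    by (auto simp: eventually_inf_principal intro!: always_eventually intro: filterlim_mono[OF _ order_refl inf_le1])
  show ?thesis
    unfolding taylor_expandable_def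
  proof (intro exI[of _ "\<lambda>m vs. M m (map L vs)"] conjI allI)
    fix q
    have "(\<lambda>z. norm (g (L z) - (\<Sum>m\<le>q. M m (replicate m (L z - L z0)))))
        \<in> O[inf (nhds z0) (principal S)](\<lambda>z. norm (L z - L z0) ^ Suc q)"
      by (rule landau_o.big.compose[OF M(2) lim])
    also have "(\<lambda>z. norm (L z - L z0) ^ Suc q) \<in> O[inf (nhds z0) (principal S)](\<lambda>z. norm (z - z0) ^ Suc q)"
    proof -
      obtain B where B: "B > 0" "\<And>v. norm (L v) \<le> norm v * B" using L.pos_bounded by blast
      have "(\<lambda>z. norm (L z - L z0)) \<in> O[inf (nhds z0) (principal S)](\<lambda>z. norm (z - z0))"
        by (rule norm_bigoI[where C = B], rule always_eventually)
           (use B(2) in \<open>auto simp: L.diff[symmetric] mult.commute\<close>)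
      then show ?thesis by (rule landau_o.big_power)
    qed
    finally show "(\<lambda>z. norm (g (L z) - (\<Sum>m\<le>q. M m (map L (replicate m (z - z0))))))
      \<in> O[inf (nhds z0) (principal S)](\<lambda>z. norm (z - z0) ^ Suc q)"
      by (simp add: L.diff)
  qed (intro bounded_multilinear_map M L)
qed

text \<open>A Cauchy product: the Taylor expansion of the linear form \<open>D 1 (P z)\<close> is
  applied to that of the vector \<open>g z\<close>, and terms of equal total degree are collected.
  With \<open>D\<close> the tower of \<eta>, this is the entropy production.\<close>

lemma taylor_expandable_tower_apply:
  assumes D: "derivative_tower UNIV D" and g: "taylor_expandable S z0 g" and P: "bounded_linear P"
  shows "taylor_expandable S z0 (\<lambda>z. D 1 (P z) [g z])"
proof -
  interpret P: bounded_linear P by fact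
  let ?F = "inf (nhds z0) (principal S)"
  obtain M where M: "\<And>m. bounded_multilinear m (M m)"
    "\<And>q. (\<lambda>z. norm (g z - (\<Sum>m\<le>q. M m (replicate m (z - z0))))) \<in> O[?F](\<lambda>z. norm (z - z0) ^ Suc q)"
    using g by (rule taylor_expandableE) (rule that)
  \<comment> \<open>The \<open>i\<close>-th Taylor coefficient of \<open>D 1\<close> at
    \<open>P z0\<close>, with the slot for the value of \<open>g\<close> kept last as in
    \<open>tower_taylor\<close>.\<close>
  define N where "N i vs u = (1 / fact i) *\<^sub>R D (Suc i) (P z0) (map P vs @ [u])" for i vs u
  have multi: "bounded_multilinear n (\<lambda>vs. \<Sum>i\<le>n. N i (take i vs) (M (n - i) (drop i vs)))" for n
  proof (rule bounded_multilinear_sum)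
    fix i assume "i \<in> {..n}"
    then have "bounded_multilinear (i + (n - i)) (\<lambda>vs. N i (take i vs) (M (n - i) (drop i vs)))"
      unfolding N_def
      by (intro bounded_multilinear_scaleR bounded_multilinear_insert_last tower_multilinear[OF D] M P) simp
    then show "bounded_multilinear n (\<lambda>vs. N i (take i vs) (M (n - i) (drop i vs)))"
      using \<open>i \<in> {..n}\<close> by simp
  qed
  have Nlin: "linear (N i vs)" if "length vs = i" for i vs
    unfolding N_def using that
    by (intro linear_compose_scale_right bounded_multilinear_linear[OF tower_multilinear[OF D]]) auto
  \<comment> \<open>\<open>N i\<close> supplies \<open>i\<close> factors of the distance to
    \<open>z0\<close>, so a remainder of \<open>g\<close> of degree \<open>q - i\<close> suffices in
    its last slot.\<close>
  have NO: "(\<lambda>z. norm (N i (replicate i (z - z0)) (r z))) \<in> O[?F](\<lambda>z. norm (z - z0) ^ Suc q)"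
    if "i \<le> q" "(\<lambda>z. norm (r z)) \<in> O[?F](\<lambda>z. norm (z - z0) ^ Suc (q - i))" for i q r
  proof -
    obtain K where K: "K > 0" "\<And>vs. length vs = Suc i \<Longrightarrow> norm (D (Suc i) (P z0) vs) \<le> K * prod_list (map norm vs)"
      using bounded_multilinear_bound[OF tower_multilinear[OF D]] by blast
    obtain B where B: "B > 0" "\<And>v. norm (P v) \<le> norm v * B" using P.pos_bounded by blast
    have "norm (N i (replicate i w) u) \<le> (K * B ^ i) * (norm w ^ i * norm u)" for w u
    proof -
      have "norm (N i (replicate i w) u) \<le> 1 * norm (D (Suc i) (P z0) (replicate i (P w) @ [u]))"
        unfolding N_def norm_scaleR map_replicate by (intro mult_right_mono) (auto simp: fact_ge_1)
      also have "\<dots> \<le> K * (norm (P w) ^ i * norm u)"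
        using K(2)[of "replicate i (P w) @ [u]"] by (simp add: prod_list_replicate)
      also have "\<dots> \<le> K * ((norm w * B) ^ i * norm u)"
        using K(1) B by (intro mult_left_mono mult_right_mono power_mono) auto
      finally show ?thesis by (simp add: power_mult_distrib mult_ac)
    qed
    then have "(\<lambda>z. norm (N i (replicate i (z - z0)) (r z))) \<in> O[?F](\<lambda>z. norm (z - z0) ^ i * norm (r z))"
      by (intro norm_bigoI always_eventually allI)
    also have "(\<lambda>z. norm (z - z0) ^ i * norm (r z)) \<in> O[?F](\<lambda>z. norm (z - z0) ^ i * norm (z - z0) ^ Suc (q - i))"
      by (rule landau_o.big.mult_left[OF that(2)])
    also have "(\<lambda>z. norm (z - z0) ^ i * norm (z - z0) ^ Suc (q - i)) = (\<lambda>z. norm (z - z0) ^ Suc q)"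
      unfolding power_add[symmetric] using that(1) by simp
    finally show ?thesis .
  qed
  have g_bounded: "(\<lambda>z. norm (g z)) \<in> O[?F](\<lambda>z. 1::real)"
  proof -
    have w: "(\<lambda>z. norm (z - z0) ^ Suc 0) \<in> O[?F](\<lambda>z. 1::real)"
    proof (rule bigoI[of _ 1])
      show "\<forall>\<^sub>F z in ?F. norm (norm (z - z0) ^ Suc 0) \<le> 1 * norm (1::real)"
        using eventually_near_within[OF zero_less_one] by eventually_elim simp
    qed
    have "(\<lambda>z. norm (g z - M 0 [])) \<in> O[?F](\<lambda>z. 1::real)"
      using landau_o.big_trans[OF M(2)[of 0] w] by simp
    from norm_add_bigo[OF this, of "\<lambda>_. M 0 []"] show ?thesis by simp
  qed
  show ?thesis
    unfolding taylor_expandable_def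
  proof (intro exI[of _ "\<lambda>n vs. \<Sum>i\<le>n. N i (take i vs) (M (n - i) (drop i vs))"] conjI allI multi)
    fix q
    obtain C d where d: "d > 0" and est: "\<forall>y\<in>UNIV. norm (y - P z0) < d \<longrightarrow> (\<forall>vs. length vs = 1 \<longrightarrow>
      norm (D 1 y vs - (\<Sum>m\<le>q. (1 / fact m) *\<^sub>R D (1 + m) (P z0) (replicate m (y - P z0) @ vs)))
        \<le> C * norm (y - P z0) ^ Suc q * prod_list (map norm vs))"
      using tower_taylor[OF D convex_UNIV UNIV_I, where k = 1 and x = "P z0" and q = q] by blast
    obtain B where B: "B > 0" "\<And>v. norm (P v) \<le> norm v * B" using P.pos_bounded by blast
    have bnd_at: "norm (D 1 (P z) [g z] - (\<Sum>i\<le>q. N i (replicate i (z - z0)) (g z)))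
        \<le> (\<bar>C\<bar> * B ^ Suc q) * (norm (z - z0) ^ Suc q * norm (g z))" if z: "norm (z - z0) < d / B" for z
    proof -
      have Pz: "norm (P z - P z0) \<le> norm (z - z0) * B" using B(2)[of "z - z0"] by (simp add: P.diff)
      also have "\<dots> < d" using z B(1) by (simp add: pos_less_divide_eq)
      finally have lt: "norm (P z - P z0) < d" .
      have "norm (D 1 (P z) [g z] - (\<Sum>i\<le>q. N i (replicate i (z - z0)) (g z)))
          \<le> C * norm (P z - P z0) ^ Suc q * norm (g z)"
        using est[rule_format, OF UNIV_I lt, of "[g z]"] by (simp add: N_def P.diff)
      also have "\<dots> \<le> \<bar>C\<bar> * (norm (z - z0) * B) ^ Suc q * norm (g z)"
        using Pz B(1) by (intro mult_mono mult_right_mono power_mono) auto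
      finally show ?thesis by (simp only: power_mult_distrib mult_ac)
    qed
    have "0 < d / B" using d B by simp
    from eventually_near_within[OF this] have bnd: "\<forall>\<^sub>F z in ?F.
        norm (D 1 (P z) [g z] - (\<Sum>i\<le>q. N i (replicate i (z - z0)) (g z)))
        \<le> (\<bar>C\<bar> * B ^ Suc q) * (norm (z - z0) ^ Suc q * norm (g z))"
      by (rule eventually_mono) (rule bnd_at, simp)
    have "(\<lambda>z. norm (D 1 (P z) [g z] - (\<Sum>i\<le>q. N i (replicate i (z - z0)) (g z))))
        \<in> O[?F](\<lambda>z. norm (z - z0) ^ Suc q * norm (g z))"
      by (rule norm_bigoI[OF bnd])
    also have "(\<lambda>z. norm (z - z0) ^ Suc q * norm (g z)) \<in> O[?F](\<lambda>z. norm (z - z0) ^ Suc q * 1)"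
      by (rule landau_o.big.mult_left[OF g_bounded])
    finally have 1: "(\<lambda>z. norm (D 1 (P z) [g z] - (\<Sum>i\<le>q. N i (replicate i (z - z0)) (g z))))
        \<in> O[?F](\<lambda>z. norm (z - z0) ^ Suc q)" by simp
    have 2: "(\<lambda>z. norm (\<Sum>i\<le>q. N i (replicate i (z - z0)) (g z - (\<Sum>m\<le>q - i. M m (replicate m (z - z0))))))
        \<in> O[?F](\<lambda>z. norm (z - z0) ^ Suc q)"
      by (intro norm_sum_bigo NO M) auto
    \<comment> \<open>The terms of total degree up to \<open>q\<close> fill the triangle i + j \<le>
      q; summing over j first gives precisely the truncations of \<open>g\<close> that
      \<open>NO\<close> asks for.\<close>
    have split: "D 1 (P z) [g z] - (\<Sum>n\<le>q. \<Sum>i\<le>n. N i (take i (replicate n (z - z0))) (M (n - i) (drop i (replicate n (z - z0))))) =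
        (D 1 (P z) [g z] - (\<Sum>i\<le>q. N i (replicate i (z - z0)) (g z))) +
        (\<Sum>i\<le>q. N i (replicate i (z - z0)) (g z - (\<Sum>m\<le>q - i. M m (replicate m (z - z0)))))" for z
    proof -
      let ?w = "z - z0"
      have "(\<Sum>n\<le>q. \<Sum>i\<le>n. N i (take i (replicate n ?w)) (M (n - i) (drop i (replicate n ?w)))) =
          (\<Sum>n\<le>q. \<Sum>i\<le>n. N i (replicate i ?w) (M (n - i) (replicate (n - i) ?w)))"
        by (intro sum.cong) (auto simp: min_def)
      also have "\<dots> = (\<Sum>(i, j)\<in>{(i, j). i + j \<le> q}. N i (replicate i ?w) (M j (replicate j ?w)))"
        by (rule sum.triangle_reindex_eq[symmetric])
      also have "{(i, j). i + j \<le> q} = Sigma {..q} (\<lambda>i. {..q - i})" by auto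
      also have "(\<Sum>(i, j)\<in>\<dots>. N i (replicate i ?w) (M j (replicate j ?w))) =
          (\<Sum>i\<le>q. \<Sum>j\<le>q - i. N i (replicate i ?w) (M j (replicate j ?w)))"
        by (rule sum.Sigma[symmetric]) auto
      also have "\<dots> = (\<Sum>i\<le>q. N i (replicate i ?w) (\<Sum>j\<le>q - i. M j (replicate j ?w)))"
        by (intro sum.cong refl linear_sum[symmetric] Nlin) simp
      finally show ?thesis
        by (simp add: linear_diff[OF Nlin] sum_subtractf)
    qed
    show "(\<lambda>z. norm (D 1 (P z) [g z] - (\<Sum>n\<le>q. \<Sum>i\<le>n. N i (take i (replicate n (z - z0))) (M (n - i) (drop i (replicate n (z - z0)))))))
        \<in> O[?F](\<lambda>z. norm (z - z0) ^ Suc q)"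
      unfolding split by (rule norm_add_bigo[OF 1 2])
  qed
qed

section \<open>Gradient and second derivative\<close>

text \<open>The representing vector is the minimizer of \<open>x \<mapsto> \<parallel>x\<parallel>\<^sup>2 - 2 \<phi>(x)\<close>; by the parallelogram law every
  minimizing sequence is a Cauchy sequence.\<close>

lemma riesz_representation:
  fixes \<phi> :: "'a::{real_inner, complete_space} \<Rightarrow> real"
  assumes "bounded_linear \<phi>"
  obtains x where "\<And>v. \<phi> v = v \<bullet> x"
proof -
  interpret \<phi>: bounded_linear \<phi> by fact
  obtain K where K: "\<And>v. norm (\<phi> v) \<le> norm v * K" using \<phi>.bounded by blast
  define J where "J x = x \<bullet> x - 2 * \<phi> x" for x
  have "- (K\<^sup>2) \<le> J x" for x
  proof -
    have "\<phi> x \<le> norm x * K" using K[of x] by simp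
    moreover have "0 \<le> (norm x - K)\<^sup>2" by simp
    ultimately show ?thesis
      unfolding J_def power2_norm_eq_inner[symmetric] by (simp add: power2_diff)
  qed
  then have bdd: "bdd_below (range J)" by (rule bdd_belowI2)
  define m where "m = Inf (range J)"
  have m: "m \<le> J x" for x unfolding m_def using bdd by (intro cInf_lower) auto
  have "\<exists>x. J x < m + inverse (real (Suc n))" for n
    using cInf_less_iff[of "range J" "m + inverse (real (Suc n))"] bdd by (auto simp: m_def)
  then obtain X where X: "\<And>n. J (X n) < m + inverse (real (Suc n))" by metis
  have par: "(dist x y)\<^sup>2 \<le> 2 * (J x - m) + 2 * (J y - m)" for x y
  proof -
    have "J x + J y = 2 * J ((1/2) *\<^sub>R (x + y)) + (dist x y)\<^sup>2 / 2"
      unfolding J_def dist_norm power2_norm_eq_inner \<phi>.scaleR \<phi>.add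
      by (simp add: inner_add inner_diff inner_commute[of y x] field_simps)
    with m[of "(1/2) *\<^sub>R (x + y)"] show ?thesis by simp
  qed
  have "Cauchy X"
  proof (rule metric_CauchyI)
    fix e :: real assume e: "e > 0"
    then obtain N where N: "inverse (real (Suc N)) < e\<^sup>2 / 4"
      using reals_Archimedean[of "e\<^sup>2 / 4"] by auto
    have near: "J (X n) < m + e\<^sup>2 / 4" if "n \<ge> N" for n
    proof -
      have "inverse (real (Suc n)) \<le> inverse (real (Suc N))"
        by (rule le_imp_inverse_le) (use that in auto)
      then have "inverse (real (Suc n)) < e\<^sup>2 / 4" using N by (rule order.strict_trans1)
      then show ?thesis by (rule order.strict_trans[OF X add_strict_left_mono])
    qed
    have "dist (X i) (X j) < e" if "i \<ge> N" "j \<ge> N" for i j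
    proof -
      have arith: "d \<le> 2 * (a - m) + 2 * (b - m) \<Longrightarrow> a < m + q / 4 \<Longrightarrow> b < m + q / 4 \<Longrightarrow> d < q"
        for a b d q :: real by (simp add: field_simps)
      have "(dist (X i) (X j))\<^sup>2 < e\<^sup>2"
        by (rule arith[OF par near[OF that(1)] near[OF that(2)]])
      then show ?thesis using e by (intro power2_less_imp_less[of _ e]) auto
    qed
    then show "\<exists>N. \<forall>i\<ge>N. \<forall>j\<ge>N. dist (X i) (X j) < e" by blast
  qed
  then obtain x where x: "X \<longlonglongrightarrow> x" using Cauchy_convergent convergent_def by blast
  have "(\<lambda>n. J (X n)) \<longlonglongrightarrow> J x"
    unfolding J_def by (intro tendsto_intros \<phi>.tendsto x)
  moreover have "(\<lambda>n. m + inverse (real (Suc n))) \<longlonglongrightarrow> m + 0"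
    by (intro tendsto_intros LIMSEQ_inverse_real_of_nat)
  ultimately have Jx: "J x \<le> m + 0"
    using X by (intro LIMSEQ_le[of "\<lambda>n. J (X n)"]) (auto intro: less_imp_le)
  have "\<phi> v = v \<bullet> x" for v
  proof (cases "v = 0")
    case False
    \<comment> \<open>\<open>s\<close> is the defect of the representation in direction
      \<open>v\<close>, and \<open>t\<close> the step minimizing the resulting quadratic. It would
      lower \<open>J\<close> by s^2 / (v \<bullet> v), so minimality forces s = 0.\<close>
    define s where "s = v \<bullet> x - \<phi> v"
    define t where "t = - (s / (v \<bullet> v))"
    have vv: "v \<bullet> v > 0" using False by simp
    have "J (x + t *\<^sub>R v) = J x + (t\<^sup>2 * (v \<bullet> v) + 2 * t * s)"
      unfolding J_def s_def \<phi>.add \<phi>.scaleR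
      by (simp add: inner_add inner_commute[of x v] power2_eq_square algebra_simps)
    then have "0 \<le> t\<^sup>2 * (v \<bullet> v) + 2 * t * s" using m[of "x + t *\<^sub>R v"] Jx by simp
    also have "\<dots> = - (s\<^sup>2 / (v \<bullet> v))"
      using vv by (simp add: t_def power2_eq_square field_simps)
    finally have "s\<^sup>2 / (v \<bullet> v) \<le> 0" by simp
    then have "s = 0" using vv by (simp add: divide_le_0_iff)
    then show ?thesis by (simp add: s_def)
  qed simp
  then show thesis by (rule that)
qed

text \<open>The definite description in \<open>gradient\<close> denotes something once the
  derivative is represented by a vector, and this is where completeness enters. Uniqueness comes
  from that of the derivative.\<close>

lemma gradient_inner:
  fixes \<eta> :: "'a::{real_inner, complete_space} \<Rightarrow> real"
  assumes "(\<eta> has_derivative \<phi>) (at x)"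
  shows "gradient \<eta> x \<bullet> v = \<phi> v"
proof -
  obtain d where d: "\<And>v. \<phi> v = v \<bullet> d"
    using riesz_representation[OF has_derivative_bounded_linear[OF assms]] by blast
  then have "\<phi> = (\<lambda>v. v \<bullet> d)" by auto
  with assms have "GDERIV \<eta> x :> d" by (simp add: gderiv_def)
  moreover have "d' = d" if "GDERIV \<eta> x :> d'" for d'
  proof -
    have "(\<lambda>v. v \<bullet> d') = \<phi>"
      using has_derivative_unique[OF _ assms] that by (simp add: gderiv_def)
    then have "v \<bullet> d' = v \<bullet> d" for v using d by (metis)
    then show ?thesis using vector_eq_ldot by blast
  qed
  ultimately have "gradient \<eta> x = d" unfolding gradient_def by (rule the_equality)
  then show ?thesis using d by (simp add: inner_commute)
qed

lemma tower_UNIV_has_derivative: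
  assumes "derivative_tower UNIV D" "\<And>x. D 0 x [] = f x"
  shows "(f has_derivative (\<lambda>v. D 1 x [v])) (at x)"
  using tower_has_derivative[OF assms(1) UNIV_I, of "[]" 0 x] assms(2) by simp

text \<open>The tower bounds the error of \<open>D 1\<close> uniformly in its argument, which is
  differentiability in the operator norm of the dual space. \<open>Blinfun\<close> is meaningful for
  bounded linear maps only, hence \<open>lin1\<close> and \<open>lin2\<close>.\<close>

lemma second_derivative_tower:
  fixes D :: "nat \<Rightarrow> 'a::real_normed_vector \<Rightarrow> 'a list \<Rightarrow> real"
  assumes D: "derivative_tower UNIV D" and D0: "\<And>x. D 0 x [] = f x"
  shows "second_derivative f x v w = D 2 x [v, w]"
proof -
  have lin1: "bounded_linear (\<lambda>v. D 1 y [v])" for y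
    using multilinear_bounded_linear_Cons[of 0 "D 1 y" "[]"] tower_multilinear[OF D UNIV_I, of 1 y] by simp
  have two: "bounded_multilinear 2 (D 2 x)" by (rule tower_multilinear[OF D]) simp
  have lin2: "bounded_linear (\<lambda>w. D 2 x [v, w])" for v
  proof -
    obtain K where K: "\<And>vs. length vs = 2 \<Longrightarrow> norm (D 2 x vs) \<le> K * prod_list (map norm vs)"
      using bounded_multilinear_bound[OF two] by blast
    have "linear (\<lambda>w. D 2 x ([v] @ w # []))"
      by (rule bounded_multilinear_linear[OF two]) simp
    moreover have "norm (D 2 x [v, w]) \<le> norm w * (K * norm v)" for w
      using K[of "[v, w]"] by (simp add: mult_ac)
    ultimately show ?thesis unfolding bounded_linear_def bounded_linear_axioms_def by auto
  qed
  let ?G = "\<lambda>y. Blinfun (\<lambda>v. D 1 y [v])"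
  let ?G' = "\<lambda>v. Blinfun (\<lambda>w. D 2 x [v, w])"
  have G: "blinfun_apply (?G y) w = D 1 y [w]" for y w
    by (simp only: bounded_linear_Blinfun_apply[OF lin1])
  have G': "blinfun_apply (?G' v) w = D 2 x [v, w]" for v w
    by (simp only: bounded_linear_Blinfun_apply[OF lin2])
  have "(?G has_derivative ?G') (at x)"
    unfolding has_derivative_within_alt
  proof (intro conjI allI impI)
    obtain K where K: "K > 0" "\<And>vs. length vs = 2 \<Longrightarrow> norm (D 2 x vs) \<le> K * prod_list (map norm vs)"
      using bounded_multilinear_bound[OF two] by blast
    show "bounded_linear ?G'"
    proof (rule bounded_linear_intro[where K = K])
      have lin: "linear (\<lambda>v. D 2 x [v, w])" for w
        using bounded_multilinear_linear[OF two, of "[]" "[w]"] by simp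
      show "?G' (a + b) = ?G' a + ?G' b" for a b
        by (rule blinfun_eqI) (unfold blinfun.add_left G', rule linear_add[OF lin])
      show "?G' (r *\<^sub>R a) = r *\<^sub>R ?G' a" for r a
        by (rule blinfun_eqI) (unfold blinfun.scaleR_left G', rule linear_scale[OF lin])
      show "norm (?G' a) \<le> norm a * K" for a
        by (rule norm_blinfun_bound) (use K(1) K(2)[of "[a, _]"] in \<open>auto simp: G' mult_ac\<close>)
    qed
    fix e :: real assume "e > 0"
    then obtain d where d: "d > 0" "\<And>y vs. y \<in> UNIV \<Longrightarrow> norm (y - x) < d \<Longrightarrow> length vs = 1 \<Longrightarrow>
      norm (D 1 y vs - D 1 x vs - D (Suc 1) x ((y - x) # vs)) \<le> e * norm (y - x) * prod_list (map norm vs)"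
      using tower_differentiable[OF D UNIV_I, where e = e and x = x and k = 1] by blast
    have "norm (?G y - ?G x - ?G' (y - x)) \<le> e * norm (y - x)" if "norm (y - x) < d" for y
    proof (rule norm_blinfun_bound)
      show "norm (blinfun_apply (?G y - ?G x - ?G' (y - x)) w) \<le> e * norm (y - x) * norm w" for w
        unfolding blinfun.diff_left G G' using d(2)[of y "[w]"] that by (simp add: numeral_2_eq_2)
    qed (use \<open>e > 0\<close> in simp)
    with d(1) show "\<exists>d>0. \<forall>y\<in>UNIV. norm (y - x) < d \<longrightarrow> norm (?G y - ?G x - ?G' (y - x)) \<le> e * norm (y - x)"
      by blast
  qed
  then have "frechet_derivative ?G (at x) = ?G'" by (rule frechet_derivative_at[symmetric])
  moreover have "frechet_derivative f (at y) = (\<lambda>v. D 1 y [v])" for y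
    by (rule frechet_derivative_at[symmetric]) (rule tower_UNIV_has_derivative[OF D D0])
  ultimately show ?thesis unfolding second_derivative_def by (simp add: G')
qed

lemma tower_locally_bounded:
  assumes "derivative_tower S D" "convex S" "x \<in> S"
  shows "\<exists>C d. C \<ge> 0 \<and> d > 0 \<and> (\<forall>y\<in>S. norm (y - x) < d \<longrightarrow>
    (\<forall>vs. length vs = k \<longrightarrow> norm (D k y vs) \<le> C * prod_list (map norm vs)))"
proof -
  obtain C d where C: "C \<ge> 0" "d > 0" and est: "\<forall>y\<in>S. norm (y - x) < d \<longrightarrow> (\<forall>vs. length vs = k \<longrightarrow>
    norm (D k y vs - (\<Sum>m\<le>0. (1 / fact m) *\<^sub>R D (k + m) x (replicate m (y - x) @ vs)))
      \<le> C * norm (y - x) ^ Suc 0 * prod_list (map norm vs))"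
    using tower_taylor[OF assms, of k 0] by blast
  obtain K where K: "K > 0" "\<And>vs. length vs = k \<Longrightarrow> norm (D k x vs) \<le> K * prod_list (map norm vs)"
    using bounded_multilinear_bound[OF tower_multilinear[OF assms(1,3)]] by blast
  have "norm (D k y vs) \<le> (C * d + K) * prod_list (map norm vs)"
    if "y \<in> S" "norm (y - x) < d" "length vs = k" for y vs
  proof -
    have "norm (D k y vs - D k x vs) \<le> C * norm (y - x) * prod_list (map norm vs)"
      using est that by simp
    also have "\<dots> \<le> C * d * prod_list (map norm vs)"
      using C that by (intro mult_right_mono mult_left_mono) auto
    finally have "norm (D k y vs) \<le> C * d * prod_list (map norm vs) + K * prod_list (map norm vs)"
      using K(2)[OF that(3)] norm_triangle_sub[of "D k y vs" "D k x vs"] by linarith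
    then show ?thesis by (simp add: distrib_right)
  qed
  moreover have "C * d + K \<ge> 0" using C K by simp
  ultimately show ?thesis using C(2) by blast
qed

lemma tower_UNIV_locally_lipschitz:
  assumes D: "derivative_tower UNIV D" and D0: "\<And>x. D 0 x [] = f x"
  obtains C d where "C \<ge> 0" "d > 0"
    "\<And>y z. norm (y - x) < d \<Longrightarrow> norm (z - x) < d \<Longrightarrow> norm (f y - f z) \<le> C * norm (y - z)"
proof -
  obtain C d where C: "C \<ge> 0" "d > 0" and bnd: "\<forall>y\<in>UNIV. norm (y - x) < d \<longrightarrow>
    (\<forall>vs. length vs = 1 \<longrightarrow> norm (D 1 y vs) \<le> C * prod_list (map norm vs))"
    using tower_locally_bounded[OF D convex_UNIV UNIV_I, where x = x and k = 1] by blast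
  have "norm (f y - f z) \<le> C * norm (y - z)" if "norm (y - x) < d" "norm (z - x) < d" for y z
  proof (rule differentiable_bound[of "ball x d"])
    show "(f has_derivative (\<lambda>v. D 1 w [v])) (at w within ball x d)" if "w \<in> ball x d" for w
      by (rule has_derivative_at_withinI[OF tower_UNIV_has_derivative[OF D D0]])
    show "onorm (\<lambda>v. D 1 w [v]) \<le> C" if "w \<in> ball x d" for w
    proof (rule onorm_bound[OF C(1)])
      show "norm (D 1 w [v]) \<le> C * norm v" for v
        using bnd[rule_format, OF UNIV_I, of w "[v]"] that by (simp add: dist_norm norm_minus_commute)
    qed
  qed (use that in \<open>auto simp: dist_norm norm_minus_commute\<close>)
  with C show thesis by (rule that)
qed

section \<open>Roots of convex functions on the line\<close>

text \<open>Convexity cleared of denominators, so that coinciding points need no separate treatment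
  in its applications.\<close>

lemma convex_on_three_points:
  fixes r :: "real \<Rightarrow> real"
  assumes r: "convex_on UNIV r" and "x \<le> y" "y \<le> z"
  shows "(z - x) * r y \<le> (z - y) * r x + (y - x) * r z"
proof (cases "x = z")
  case False
  then have "x < z" using assms by simp
  define l where "l = (y - x) / (z - x)"
  have l: "0 \<le> l" "l \<le> 1" "l * (z - x) = y - x"
    using assms \<open>x < z\<close> by (auto simp: l_def)
  have "(1 - l) *\<^sub>R x + l *\<^sub>R z = x + l * (z - x)" by (simp add: algebra_simps)
  with l(3) have "(1 - l) *\<^sub>R x + l *\<^sub>R z = y" by simp
  with convex_onD[OF r l(1,2), of x z] have "r y \<le> (1 - l) * r x + l * r z" by simp
  then have "(z - x) * r y \<le> (z - x) * ((1 - l) * r x + l * r z)"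
    using \<open>x < z\<close> by (intro mult_left_mono) auto
  also have "\<dots> = ((z - x) - l * (z - x)) * r x + (l * (z - x)) * r z" by (simp add: algebra_simps)
  also have "\<dots> = (z - y) * r x + (y - x) * r z" unfolding l(3) by simp
  finally show ?thesis .
qed (use assms in simp)

text \<open>On (0, a] the graph lies below the chord from the root 0 to a negative value, so no root
  occurs there. To the right of any further root the chord from \<open>a\<close> forces positive
  values, which excludes a second one and places the root below \<open>b\<close>.\<close>

lemma convex_root_unique:
  fixes r :: "real \<Rightarrow> real"
  assumes r: "convex_on UNIV r" "continuous_on UNIV r" "r 0 = 0"
    and ab: "0 < a" "a < b" "r a < 0" "r b > 0"
  shows "\<exists>!\<gamma>. \<gamma> > 0 \<and> r \<gamma> = 0" and "\<And>\<gamma>. \<gamma> > 0 \<Longrightarrow> r \<gamma> = 0 \<Longrightarrow> a < \<gamma> \<and> \<gamma> < b"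
proof -
  note conv = convex_on_three_points[OF r(1)]
  have gt_a: "a < \<gamma>" if "\<gamma> > 0" "r \<gamma> = 0" for \<gamma>
  proof (rule ccontr)
    assume "\<not> a < \<gamma>"
    then have "0 \<le> \<gamma> * r a" using conv[of 0 \<gamma> a] that r(3) by simp
    then show False using that ab by (simp add: zero_le_mult_iff)
  qed
  have uniq: "r z > 0" if "\<gamma> > 0" "r \<gamma> = 0" "z > \<gamma>" for \<gamma> z
  proof -
    have "0 \<le> (z - \<gamma>) * r a + (\<gamma> - a) * r z"
      using conv[of a \<gamma> z] gt_a[OF that(1,2)] that by simp
    moreover have "(z - \<gamma>) * r a < 0" using that ab by (simp add: mult_pos_neg)
    ultimately have "(\<gamma> - a) * r z > 0" by linarith
    then show ?thesis using gt_a[OF that(1,2)] by (simp add: zero_less_mult_iff)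
  qed
  show lt_b: "a < \<gamma> \<and> \<gamma> < b" if "\<gamma> > 0" "r \<gamma> = 0" for \<gamma>
  proof (intro conjI gt_a that)
    have "\<gamma> \<noteq> b" using that ab by auto
    moreover have "\<not> b < \<gamma>"
    proof
      assume "b < \<gamma>"
      then have "(\<gamma> - a) * r b \<le> (\<gamma> - b) * r a" using conv[of a b \<gamma>] ab that by simp
      moreover have "(\<gamma> - b) * r a < 0" using \<open>b < \<gamma>\<close> ab by (simp add: mult_pos_neg)
      moreover have "(\<gamma> - a) * r b > 0" using \<open>b < \<gamma>\<close> ab by simp
      ultimately show False by linarith
    qed
    ultimately show "\<gamma> < b" by linarith
  qed
  have "\<exists>\<gamma>. a \<le> \<gamma> \<and> \<gamma> \<le> b \<and> r \<gamma> = 0"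
    by (rule IVT') (use ab r(2) continuous_on_subset in auto)
  then obtain \<gamma> where \<gamma>: "\<gamma> > 0" "r \<gamma> = 0" using ab by (metis less_le_trans)
  show "\<exists>!\<gamma>. \<gamma> > 0 \<and> r \<gamma> = 0"
  proof (rule ex1I[of _ \<gamma>])
    fix \<gamma>' assume "\<gamma>' > 0 \<and> r \<gamma>' = 0"
    then show "\<gamma>' = \<gamma>" using uniq[of \<gamma> \<gamma>'] uniq[of \<gamma>' \<gamma>] \<gamma> by (cases \<gamma> \<gamma>' rule: linorder_cases) auto
  qed (use \<gamma> in simp)
qed

text \<open>Compare with the line through (a, r a) and the root: the graph is below it between the
  two points and above it beyond the root. So the size of \<open>r x\<close> is at least the
  distance from x to the root times the slope of the line, and that slope is at least - r a / (b -
  a).\<close>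

lemma convex_root_distance:
  fixes r :: "real \<Rightarrow> real"
  assumes r: "convex_on UNIV r" and a: "r a < 0" "a < \<gamma>" "a < x" and root: "r \<gamma> = 0" and b: "\<gamma> \<le> b" "x \<le> b"
  shows "\<bar>\<gamma> - x\<bar> * (- r a) \<le> (b - a) * \<bar>r x\<bar>"
proof (cases "x \<le> \<gamma>")
  case True
  have "(\<gamma> - a) * r x \<le> (\<gamma> - x) * r a"
    using convex_on_three_points[OF r, of a x \<gamma>] a True root by simp
  moreover have "(\<gamma> - a) * (- r x) \<le> (\<gamma> - a) * \<bar>r x\<bar>" using a by (intro mult_left_mono) auto
  moreover have "(\<gamma> - a) * \<bar>r x\<bar> \<le> (b - a) * \<bar>r x\<bar>" using b by (intro mult_right_mono) auto
  ultimately show ?thesis using True by (simp add: abs_real_def)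
next
  case False
  have "0 \<le> (x - \<gamma>) * r a + (\<gamma> - a) * r x"
    using convex_on_three_points[OF r, of a \<gamma> x] a False root by simp
  moreover have "(\<gamma> - a) * r x \<le> (\<gamma> - a) * \<bar>r x\<bar>" using a by (intro mult_left_mono) auto
  moreover have "(\<gamma> - a) * \<bar>r x\<bar> \<le> (b - a) * \<bar>r x\<bar>" using b by (intro mult_right_mono) auto
  ultimately show ?thesis using False by (simp add: abs_real_def)
qed

section \<open>The relaxed Runge--Kutta step\<close>

lemma small_steps_le: "small_steps T tn c \<le> at_right 0"
  unfolding small_steps_def by (rule at_le) auto

lemma small_steps_admissible:
  "\<forall>\<^sub>F h in small_steps T tn c. 0 < h \<and> (\<forall>i. tn + c $ i * h \<in> {0..T})"
  unfolding small_steps_def eventually_at_filter by (rule always_eventually) auto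

lemma eventually_small_step:
  assumes "\<delta> > 0"
  shows "\<forall>\<^sub>F h in small_steps T tn c. 0 < h \<and> h < \<delta>"
  using eventually_at_right_real[OF assms] small_steps_le
  by (auto simp: le_filter_def)

text \<open>The towers are parameters since the derivatives of \<eta> and f are referred to
  throughout. Convexity and the sign conditions come later; this part concerns small steps
  only.\<close>

locale rk_step =
  fixes \<eta> :: "'a::{real_inner, complete_space} \<Rightarrow> real"
    and f :: "real \<Rightarrow> 'a \<Rightarrow> 'a"
    and A :: "real^'s^'s" and b c :: "real^'s"
    and T tn t1 :: real and un :: 'a
    and y :: "real \<Rightarrow> 's \<Rightarrow> 'a"
    and u :: "real \<Rightarrow> 'a"
    and DE :: "nat \<Rightarrow> 'a \<Rightarrow> 'a list \<Rightarrow> real"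
    and DF :: "nat \<Rightarrow> real \<times> 'a \<Rightarrow> (real \<times> 'a) list \<Rightarrow> 'a"
  assumes DE: "derivative_tower UNIV DE" and DE0: "\<And>x. DE 0 x [] = \<eta> x"
    and DF: "derivative_tower ({0..T} \<times> UNIV) DF"
    and DF0: "\<And>t x. t \<in> {0..T} \<Longrightarrow> DF 0 (t, x) [] = f t x"
    and row_sums: "A *v 1 = c"
    and tn: "tn \<in> {0..<T}"
    and interval: "t1 \<in> {tn<..T}"
    and u_init: "u tn = un"
    and u_ode: "\<And>t. t \<in> {tn..t1} \<Longrightarrow> (u has_vector_derivative f t (u t)) (at t within {tn..t1})"
    and stages: "stage_branch f A c T tn un y"
begin

abbreviation "F \<equiv> small_steps T tn c"

abbreviation "f0 \<equiv> f tn un"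

definition slope :: "real \<Rightarrow> 's \<Rightarrow> 'a" where
  "slope h i = f (tn + c $ i * h) (y h i)"

definition mean_slope :: "real \<Rightarrow> 'a" where
  "mean_slope h = (\<Sum>i\<in>UNIV. b $ i *\<^sub>R slope h i)"

text \<open>The factor of \<gamma> in the residual, and at the same time the entropy component of an
  unmodified step for the augmented system.\<close>

definition entropy_increment :: "real \<Rightarrow> real" where
  "entropy_increment h = h * (\<Sum>i\<in>UNIV. b $ i * DE 1 (y h i) [slope h i])"

lemma rk_update_eq: "rk_update f b c tn un y h \<gamma> = un + (\<gamma> * h) *\<^sub>R mean_slope h"
  by (simp add: rk_update_def mean_slope_def slope_def)

lemma relaxation_residual_eq:
  "relaxation_residual \<eta> f b c tn un y h \<gamma> =
     \<eta> (un + \<gamma> *\<^sub>R (h *\<^sub>R mean_slope h)) - \<eta> un - \<gamma> * entropy_increment h"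
  using gradient_inner[OF tower_UNIV_has_derivative[OF DE DE0]]
  by (simp add: relaxation_residual_def rk_update_eq entropy_increment_def slope_def)

section \<open>Asymptotics of stages and slopes\<close>

lemma c_eq: "c $ i = (\<Sum>j\<in>UNIV. A $ i $ j)"
  unfolding row_sums[symmetric] matrix_vector_mult_def by simp

lemma stage_eq:
  "\<forall>\<^sub>F h in F. \<forall>i. y h i = un + h *\<^sub>R (\<Sum>j\<in>UNIV. A $ i $ j *\<^sub>R slope h j)"
  using stages unfolding stage_branch_def slope_def by blast

lemma y_tendsto: "((\<lambda>h. y h i) \<longlongrightarrow> un) F"
  using stages unfolding stage_branch_def by blast

text \<open>All comparisons are with the initial point, so the Taylor expansion of degree zero is
  enough.\<close>

lemma f_lipschitz_at:
  obtains C d where "C \<ge> 0" "d > 0"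
    "\<And>t x. t \<in> {0..T} \<Longrightarrow> \<bar>t - tn\<bar> + norm (x - un) < d \<Longrightarrow> norm (f t x - f0) \<le> C * (\<bar>t - tn\<bar> + norm (x - un))"
proof -
  have conv: "convex ({0..T} \<times> (UNIV :: 'a set))" by (intro convex_Times) auto
  have z0: "(tn, un) \<in> {0..T} \<times> UNIV" using tn by simp
  obtain C d where C: "C \<ge> 0" "d > 0" and est: "\<forall>z\<in>{0..T} \<times> UNIV. norm (z - (tn, un)) < d \<longrightarrow> (\<forall>vs. length vs = 0 \<longrightarrow>
    norm (DF 0 z vs - (\<Sum>m\<le>0. (1 / fact m) *\<^sub>R DF (0 + m) (tn, un) (replicate m (z - (tn, un)) @ vs)))
      \<le> C * norm (z - (tn, un)) ^ Suc 0 * prod_list (map norm vs))"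
    using tower_taylor[OF DF conv z0, of 0 0] by blast
  have "norm (f t x - f0) \<le> C * (\<bar>t - tn\<bar> + norm (x - un))"
    if "t \<in> {0..T}" "\<bar>t - tn\<bar> + norm (x - un) < d" for t x
  proof -
    have le: "norm ((t, x) - (tn, un)) \<le> \<bar>t - tn\<bar> + norm (x - un)"
      using norm_Pair_le[of "t - tn" "x - un"] by simp
    have "norm (f t x - f0) \<le> C * norm ((t, x) - (tn, un))"
      using est[rule_format, of "(t, x)" "[]"] le that tn by (simp add: DF0)
    also have "\<dots> \<le> C * (\<bar>t - tn\<bar> + norm (x - un))" by (rule mult_left_mono[OF le C(1)])
    finally show ?thesis .
  qed
  with C show thesis by (rule that)
qed

lemma stage_time_bigo: "(\<lambda>h. \<bar>tn + c $ i * h - tn\<bar>) \<in> O[F](\<lambda>h. h)"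
  by (cases "c $ i = 0") auto

lemma slope_le:
  obtains C where "C \<ge> 0"
    "\<forall>\<^sub>F h in F. norm (slope h i - f0) \<le> C * (\<bar>c $ i * h\<bar> + norm (y h i - un))"
proof -
  obtain C d where C: "C \<ge> 0" "d > 0" and lip:
    "\<And>t x. t \<in> {0..T} \<Longrightarrow> \<bar>t - tn\<bar> + norm (x - un) < d \<Longrightarrow> norm (f t x - f0) \<le> C * (\<bar>t - tn\<bar> + norm (x - un))"
    by (rule f_lipschitz_at) (rule that)
  have h0: "((\<lambda>h. h) \<longlongrightarrow> 0) F" by (rule tendsto_mono[OF small_steps_le]) (rule tendsto_ident_at)
  have "((\<lambda>h. \<bar>c $ i * h\<bar> + norm (y h i - un)) \<longlongrightarrow> \<bar>c $ i * 0\<bar> + norm (un - un)) F"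
    by (intro tendsto_intros y_tendsto h0)
  then have "\<forall>\<^sub>F h in F. \<bar>c $ i * h\<bar> + norm (y h i - un) < d"
    by (rule order_tendstoD) (use C in simp)
  with small_steps_admissible have "\<forall>\<^sub>F h in F. norm (slope h i - f0) \<le> C * (\<bar>c $ i * h\<bar> + norm (y h i - un))"
  proof eventually_elim
    case (elim h)
    then show ?case using lip[of "tn + c $ i * h" "y h i"] by (simp add: slope_def)
  qed
  with C(1) show thesis by (rule that)
qed

lemma step_tendsto: "((\<lambda>h. h) \<longlongrightarrow> 0) F"
  by (rule tendsto_mono[OF small_steps_le]) (rule tendsto_ident_at)

lemma slope_tendsto: "((\<lambda>h. slope h i) \<longlongrightarrow> f0) F"
proof -
  obtain C where C: "\<forall>\<^sub>F h in F. norm (slope h i - f0) \<le> C * (\<bar>c $ i * h\<bar> + norm (y h i - un))"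
    by (rule slope_le)
  have "((\<lambda>h. C * (\<bar>c $ i * h\<bar> + norm (y h i - un))) \<longlongrightarrow> C * (\<bar>c $ i * 0\<bar> + norm (un - un))) F"
    by (intro tendsto_intros y_tendsto step_tendsto)
  then have "((\<lambda>h. C * (\<bar>c $ i * h\<bar> + norm (y h i - un))) \<longlongrightarrow> 0) F" by simp
  with C have "((\<lambda>h. slope h i - f0) \<longlongrightarrow> 0) F" by (rule Lim_null_comparison)
  then show ?thesis by (simp add: LIM_zero_iff)
qed

lemma mean_slope_tendsto: "(mean_slope \<longlongrightarrow> sum (($) b) UNIV *\<^sub>R f0) F"
  unfolding mean_slope_def[abs_def] scaleR_sum_left by (intro tendsto_intros slope_tendsto)

text \<open>A bootstrap: \<open>stage_branch\<close> provides mere convergence of the stages, hence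
  convergent and bounded slopes, and the factor \<open>h\<close> in the stage equations turns this
  into a rate.\<close>

lemma stage_bigo: "(\<lambda>h. norm (y h i - un)) \<in> O[F](\<lambda>h. h)"
proof -
  have "(\<lambda>h. norm (h *\<^sub>R (\<Sum>j\<in>UNIV. A $ i $ j *\<^sub>R slope h j))) \<in> O[F](\<lambda>h. h * (1 * 1))"
    by (intro norm_scaleR_bigo norm_sum_bigo norm_tendsto_bigo_one[OF slope_tendsto]) auto
  then have "(\<lambda>h. norm (h *\<^sub>R (\<Sum>j\<in>UNIV. A $ i $ j *\<^sub>R slope h j))) \<in> O[F](\<lambda>h. h)" by simp
  then show ?thesis
    by (rule norm_bigo_le) (use stage_eq in eventually_elim, simp)
qed

lemma slope_bigo: "(\<lambda>h. norm (slope h i - f0)) \<in> O[F](\<lambda>h. h)"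
proof -
  obtain C where C: "\<forall>\<^sub>F h in F. norm (slope h i - f0) \<le> C * (\<bar>c $ i * h\<bar> + norm (y h i - un))"
    by (rule slope_le)
  have "(\<lambda>h. norm (slope h i - f0)) \<in> O[F](\<lambda>h. \<bar>c $ i * h\<bar> + norm (y h i - un))"
    by (rule norm_bigoI[OF C])
  also have "(\<lambda>h. \<bar>c $ i * h\<bar> + norm (y h i - un)) \<in> O[F](\<lambda>h. h)"
    by (intro sum_in_bigo stage_bigo) (use stage_time_bigo in simp)
  finally show ?thesis .
qed

lemma stage_quotient_tendsto: "((\<lambda>h. (1 / h) *\<^sub>R (y h i - un)) \<longlongrightarrow> c $ i *\<^sub>R f0) F"
proof -
  have "((\<lambda>h. \<Sum>j\<in>UNIV. A $ i $ j *\<^sub>R slope h j) \<longlongrightarrow> c $ i *\<^sub>R f0) F"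
    unfolding c_eq scaleR_sum_left by (intro tendsto_intros slope_tendsto)
  then show ?thesis
  proof (rule Lim_transform_eventually)
    show "\<forall>\<^sub>F h in F. (\<Sum>j\<in>UNIV. A $ i $ j *\<^sub>R slope h j) = (1 / h) *\<^sub>R (y h i - un)"
      using stage_eq small_steps_admissible
    proof eventually_elim
      case (elim h)
      then have "y h i - un = h *\<^sub>R (\<Sum>j\<in>UNIV. A $ i $ j *\<^sub>R slope h j)"
        by (metis add_diff_cancel_left')
      with elim show ?case by simp
    qed
  qed
qed

section \<open>Increments of the exact solution\<close>

lemma solution_shift:
  assumes "s \<in> {0..t1 - tn}"
  shows "((\<lambda>s. u (tn + s)) has_vector_derivative f (tn + s) (u (tn + s))) (at s within {0..t1 - tn})"
proof -
  have "(+) tn ` {0..t1 - tn} = {tn..t1}" by simp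
  then have "(u has_vector_derivative f (tn + s) (u (tn + s))) (at (tn + s) within (+) tn ` {0..t1 - tn})"
    using u_ode[of "tn + s"] assms by simp
  then have "((\<lambda>s. u (tn + s)) has_vector_derivative 1 *\<^sub>R f (tn + s) (u (tn + s))) (at s within {0..t1 - tn})"
    by (intro vector_diff_chain_within[of "(+) tn" 1 s "{0..t1 - tn}" u, unfolded o_def])
       (auto intro!: derivative_eq_intros)
  then show ?thesis by simp
qed

text \<open>On [0, \<rho>] the velocity of \<open>u\<close> differs from \<open>f0\<close> by
  O(\<rho>). Both factors, \<rho> and the length of the time shift, are kept, because the relaxation
  estimate needs their product.\<close>

lemma solution_increment:
  obtains C \<delta> where "C \<ge> 0" "\<delta> > 0" "tn + \<delta> \<le> t1"
    "\<And>\<rho> s s'. \<rho> \<le> \<delta> \<Longrightarrow> s \<in> {0..\<rho>} \<Longrightarrow> s' \<in> {0..\<rho>} \<Longrightarrow>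
      norm (u (tn + s) - u (tn + s') - (s - s') *\<^sub>R f0) \<le> C * \<rho> * \<bar>s - s'\<bar>"
proof -
  obtain C d where C: "C \<ge> 0" "d > 0" and lip:
    "\<And>t x. t \<in> {0..T} \<Longrightarrow> \<bar>t - tn\<bar> + norm (x - un) < d \<Longrightarrow> norm (f t x - f0) \<le> C * (\<bar>t - tn\<bar> + norm (x - un))"
    by (rule f_lipschitz_at) (rule that)
  have "\<exists>e>0. \<forall>t\<in>{tn..t1}. norm (t - tn) < e \<longrightarrow> norm (u t - u tn - (t - tn) *\<^sub>R f0) \<le> 1 * norm (t - tn)"
    using u_ode[of tn, unfolded has_vector_derivative_def has_derivative_within_alt, THEN conjunct2,
        rule_format, of 1] interval u_init by simp
  then obtain e where e: "e > 0" "\<And>t. t \<in> {tn..t1} \<Longrightarrow> \<bar>t - tn\<bar> < e \<Longrightarrow>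
      norm (u t - un - (t - tn) *\<^sub>R f0) \<le> \<bar>t - tn\<bar>"
    using u_init by auto
  \<comment> \<open>One unit of \<open>K\<close> accounts for the time, one for the tolerance 1 in
    the derivative of \<open>u\<close> at \<open>tn\<close>, and \<open>norm f0\<close> for the
    linear part. Then \<open>K * \<delta> < d\<close> keeps the trajectory where the Lipschitz bound
    applies.\<close>
  define K where "K = 2 + norm f0"
  have K: "K > 0" unfolding K_def using norm_ge_zero[of f0] by linarith
  define \<delta> where "\<delta> = min (e / 2) (min (t1 - tn) (d / (2 * K)))"
  have "\<delta> > 0" using e(1) C(2) K interval by (simp add: \<delta>_def)
  moreover have "\<delta> \<le> e / 2" "\<delta> \<le> t1 - tn" "\<delta> \<le> d / (2 * K)"
    unfolding \<delta>_def by (rule order_refl min.cobounded1 min.coboundedI2)+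
  moreover from this(3) have "K * \<delta> \<le> K * (d / (2 * K))" using K by (intro mult_left_mono) auto
  ultimately have \<delta>: "\<delta> > 0" "\<delta> < e" "tn + \<delta> \<le> t1" "K * \<delta> < d"
    using e(1) C(2) K by auto
  have near: "\<bar>s\<bar> + norm (u (tn + s) - un) \<le> K * s" if "s \<in> {0..\<delta>}" for s
  proof -
    have "norm (u (tn + s) - un - s *\<^sub>R f0) \<le> s" using e(2)[of "tn + s"] that \<delta> by simp
    then have "norm (u (tn + s) - un) \<le> s + norm (s *\<^sub>R f0)"
      using norm_triangle_sub[of "u (tn + s) - un" "s *\<^sub>R f0"] by linarith
    then show ?thesis using that by (simp add: K_def algebra_simps)
  qed
  have "norm (u (tn + s) - u (tn + s') - (s - s') *\<^sub>R f0) \<le> (C * K) * \<rho> * \<bar>s - s'\<bar>"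
    if \<rho>: "\<rho> \<le> \<delta>" and s: "s \<in> {0..\<rho>}" "s' \<in> {0..\<rho>}" for \<rho> s s'
  proof -
    let ?w = "\<lambda>s. u (tn + s) - s *\<^sub>R f0"
    have "norm (?w s - ?w s') \<le> (C * K * \<rho>) * norm (s - s')"
    proof (rule differentiable_bound[OF convex_real_interval(5)[of 0 \<rho>]])
      fix r assume r: "r \<in> {0..\<rho>}"
      have "((\<lambda>s. u (tn + s)) has_vector_derivative f (tn + r) (u (tn + r))) (at r within {0..\<rho>})"
        by (rule has_vector_derivative_within_subset[OF solution_shift]) (use r \<rho> \<delta>(3) in auto)
      then have "(?w has_vector_derivative (f (tn + r) (u (tn + r)) - f0)) (at r within {0..\<rho>})"
        by (auto intro!: derivative_eq_intros)
      then show "(?w has_derivative (\<lambda>h. h *\<^sub>R (f (tn + r) (u (tn + r)) - f0))) (at r within {0..\<rho>})"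
        unfolding has_vector_derivative_def .
      have rd: "r \<in> {0..\<delta>}" using r \<rho> by auto
      have "K * r \<le> K * \<delta>" using rd K by (intro mult_left_mono) auto
      then have "norm (f (tn + r) (u (tn + r)) - f0) \<le> C * (\<bar>r\<bar> + norm (u (tn + r) - un))"
        using lip[of "tn + r" "u (tn + r)"] near[OF rd] \<delta>(3,4) rd tn interval by auto
      also have "\<dots> \<le> C * (K * \<rho>)"
        using near[OF rd] r K C by (intro mult_left_mono order_trans[OF near[OF rd]]) auto
      finally have le: "norm (f (tn + r) (u (tn + r)) - f0) \<le> C * K * \<rho>" by (simp add: mult.assoc)
      show "onorm (\<lambda>h. h *\<^sub>R (f (tn + r) (u (tn + r)) - f0)) \<le> C * K * \<rho>"
      proof (rule onorm_bound)
        show "0 \<le> C * K * \<rho>" using le norm_ge_zero order_trans by blast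
        show "norm (h *\<^sub>R (f (tn + r) (u (tn + r)) - f0)) \<le> C * K * \<rho> * norm h" for h :: real
          using mult_left_mono[OF le, of "\<bar>h\<bar>"] by (simp add: mult.commute)
      qed
    qed (use s in auto)
    then show ?thesis by (simp add: algebra_simps)
  qed
  moreover have "C * K \<ge> 0" using C K by simp
  ultimately show thesis using that[of "C * K" \<delta>] \<delta> by blast
qed

end

lemma bigo_Suc_quotient_tendsto:
  fixes a :: "real \<Rightarrow> real"
  assumes F: "F \<le> at_right 0" and a: "a \<in> O[F](\<lambda>h. h ^ Suc n)"
  shows "((\<lambda>h. a h / h ^ n) \<longlongrightarrow> 0) F"
proof -
  have "(\<lambda>h. norm (a h)) \<in> O[F](\<lambda>h. h ^ Suc n)" using a by simp
  then obtain C where C: "\<forall>\<^sub>F h in F. norm (a h) \<le> C * \<bar>h ^ Suc n\<bar>" by (rule norm_bigoE)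
  have pos: "\<forall>\<^sub>F h in F. 0 < h" by (rule filter_leD[OF F]) (rule eventually_at_right_less)
  show ?thesis
  proof (rule norm_bigo_ident_tendsto[OF F norm_bigoI])
    show "\<forall>\<^sub>F h in F. norm (a h / h ^ n) \<le> C * h"
      using C pos
    proof eventually_elim
      case (elim h)
      then show ?case by (simp add: pos_divide_le_eq mult.assoc)
    qed
  qed
qed

context rk_step
begin

section \<open>Order of the update and of the entropy quadrature\<close>

lemma entropy_slope_bigo: "(\<lambda>h. norm (DE 1 (y h i) [slope h i])) \<in> O[F](\<lambda>h. 1)"
proof -
  obtain C d where C: "C \<ge> 0" "d > 0" and bnd: "\<forall>z\<in>UNIV. norm (z - un) < d \<longrightarrow>
    (\<forall>vs. length vs = 1 \<longrightarrow> norm (DE 1 z vs) \<le> C * prod_list (map norm vs))"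
    using tower_locally_bounded[OF DE convex_UNIV UNIV_I, where x = un and k = 1] by blast
  have "\<forall>\<^sub>F h in F. norm (y h i - un) < d"
    using tendstoD[OF y_tendsto C(2)] by (simp add: dist_norm)
  then have "\<forall>\<^sub>F h in F. norm (DE 1 (y h i) [slope h i]) \<le> C * norm (slope h i)"
  proof eventually_elim
    case (elim h)
    then show ?case using bnd[rule_format, OF UNIV_I, of "y h i" "[slope h i]"] by simp
  qed
  then have "(\<lambda>h. norm (DE 1 (y h i) [slope h i])) \<in> O[F](\<lambda>h. norm (slope h i))"
    by (rule norm_bigoI)
  also have "(\<lambda>h. norm (slope h i)) \<in> O[F](\<lambda>h. 1)"
    by (rule norm_tendsto_bigo_one[OF slope_tendsto])
  finally show ?thesis .
qed

text \<open>The order of the quadrature of the entropy follows from the order of the method for the augmented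
  autonomous system \<open>(t, x, e)' = (1, f(t, x), \<eta>'(x) f(t, x))\<close>.\<close>

lemma augmented_order:
  assumes order: "rk_order_accurate A b (Suc k)"
  shows "(\<lambda>h. norm (un + h *\<^sub>R mean_slope h - u (tn + h))) \<in> O[F](\<lambda>h. h ^ Suc (Suc k))"
    and "(\<lambda>h. norm (\<eta> un + entropy_increment h - \<eta> (u (tn + h)))) \<in> O[F](\<lambda>h. h ^ Suc (Suc k))"
proof -
  \<comment> \<open>\<open>DF 0\<close> stands for \<open>f\<close>, with which it agrees for times
    in [0, T], because the tower supplies its expansion. The entropy variable itself does not occur
    in \<open>g\<close>.\<close>
  define g where "g z = (1::real, DF 0 (fst z, fst (snd z)) [],
    DE 1 (fst (snd z)) [DF 0 (fst z, fst (snd z)) []])" for z :: "real \<times> 'a \<times> real"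
  define S where "S = {z :: real \<times> 'a \<times> real. fst z \<in> {0..T}}"
  define z0 where "z0 = (tn, un, \<eta> un)"
  \<comment> \<open>Since \<open>g\<close> does not read the entropy variable, the stage
    displacement of the latter is an explicit quadrature and no new implicit equation arises. The
    time displacement is \<open>c $ i * h\<close> by the row sums.\<close>
  define v where "v h i = (c $ i * h, y h i - un, h * (\<Sum>j\<in>UNIV. A $ i $ j * DE 1 (y h j) [slope h j]))" for h i
  define z where "z s = (tn + s, u (tn + s), \<eta> (u (tn + s)))" for s
  have L: "bounded_linear (\<lambda>z :: real \<times> 'a \<times> real. (fst z, fst (snd z)))"
    by (intro bounded_linear_Pair bounded_linear_fst bounded_linear_compose[OF bounded_linear_fst bounded_linear_snd])
  have P: "bounded_linear (\<lambda>z :: real \<times> 'a \<times> real. fst (snd z))"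
    by (rule bounded_linear_compose[OF bounded_linear_fst bounded_linear_snd])
  have "taylor_expandable ({0..T} \<times> UNIV) (tn, un) (\<lambda>z. DF 0 z [])"
    by (rule taylor_expandable_tower[OF DF convex_Times]) (use tn in auto)
  then have tF: "taylor_expandable S z0 (\<lambda>z. DF 0 (fst z, fst (snd z)) [])"
    by (intro taylor_expandable_linear_comp[OF _ L]) (auto simp: z0_def S_def)
  have "taylor_expandable S z0 g"
    unfolding g_def[abs_def]
    by (intro taylor_expandable_Pair taylor_expandable_const tF taylor_expandable_tower_apply[OF DE tF P])
  then obtain M where M: "\<And>m. bounded_multilinear m (M m)"
    "\<And>q. (\<lambda>z. norm (g z - (\<Sum>m\<le>q. M m (replicate m (z - z0)))))
      \<in> O[inf (nhds z0) (principal S)](\<lambda>z. norm (z - z0) ^ Suc q)"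
    by (rule taylor_expandableE) (rule that)
  interpret taylor_field g z0 S M by unfold_locales (rule M)+
  have g_eq: "g (t, x, e) = (1, f t x, DE 1 x [f t x])" if "t \<in> {0..T}" for t x e
    using that by (simp add: g_def DF0)
  have zv: "z0 + v h i = (tn + c $ i * h, y h i, \<eta> un + h * (\<Sum>j\<in>UNIV. A $ i $ j * DE 1 (y h j) [slope h j]))" for h i
    by (simp add: z0_def v_def)
  have g_stage: "g (z0 + v h i) = (1, slope h i, DE 1 (y h i) [slope h i])" if "tn + c $ i * h \<in> {0..T}" for h i
    unfolding zv slope_def by (rule g_eq[OF that])
  have sum_triple: "(\<Sum>j\<in>UNIV. w j *\<^sub>R (1::real, p j, q j)) = (\<Sum>j\<in>UNIV. w j, \<Sum>j\<in>UNIV. w j *\<^sub>R p j, \<Sum>j\<in>UNIV. w j * q j)"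
    for w :: "'s \<Rightarrow> real" and p :: "'s \<Rightarrow> 'a" and q :: "'s \<Rightarrow> real"
    by (simp add: prod_eq_iff fst_sum snd_sum)
  have stage: "\<forall>\<^sub>F h in F. \<forall>i. v h i = h *\<^sub>R (\<Sum>j\<in>UNIV. A $ i $ j *\<^sub>R g (z0 + v h j))"
    using small_steps_admissible stage_eq
  proof eventually_elim
    case (elim h)
    have yi: "y h i - un = h *\<^sub>R (\<Sum>j\<in>UNIV. A $ i $ j *\<^sub>R slope h j)" for i
      using elim(2) by (metis add_diff_cancel_left')
    have gs: "g (z0 + v h j) = (1, slope h j, DE 1 (y h j) [slope h j])" for j
      using elim(1) g_stage by blast
    show ?case unfolding gs sum_triple by (simp add: v_def c_eq yi mult.commute)
  qed
  have vS: "\<forall>\<^sub>F h in F. \<forall>i. z0 + v h i \<in> S"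
    using small_steps_admissible by eventually_elim (simp add: zv S_def)
  have vO: "(\<lambda>h. norm (v h i)) \<in> O[F](\<lambda>h. h)" for i
  proof -
    have 3: "(\<lambda>h. norm (h *\<^sub>R (\<Sum>j\<in>UNIV. A $ i $ j *\<^sub>R DE 1 (y h j) [slope h j]))) \<in> O[F](\<lambda>h. h * (1 * 1))"
      by (intro norm_scaleR_bigo norm_sum_bigo entropy_slope_bigo) auto
    define B where "B h = \<bar>c $ i * h\<bar> +
      (norm (y h i - un) + norm (h *\<^sub>R (\<Sum>j\<in>UNIV. A $ i $ j *\<^sub>R DE 1 (y h j) [slope h j])))" for h
    have "B \<in> O[F](\<lambda>h. h)"
      unfolding B_def[abs_def] by (intro sum_in_bigo stage_bigo) (use stage_time_bigo 3 in simp_all)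
    then have "(\<lambda>h. norm (B h)) \<in> O[F](\<lambda>h. h)" by simp
    moreover have "norm (v h i) \<le> norm (B h)" for h
      unfolding v_def B_def
      using norm_Pair_le[of "c $ i * h"] norm_Pair_le[of "y h i - un"]
      by (smt (verit) real_norm_def real_scaleR_def sum.cong)
    then have "\<forall>\<^sub>F h in F. norm (v h i) \<le> norm (B h)" by (intro always_eventually allI)
    ultimately show ?thesis by (rule norm_bigo_le)
  qed
  have ode: "(z has_vector_derivative g (z s)) (at s within {0..t1 - tn})" if s: "s \<in> {0..t1 - tn}" for s
  proof -
    let ?X = "{0..t1 - tn}"
    have du: "((\<lambda>s. u (tn + s)) has_derivative (\<lambda>h. h *\<^sub>R f (tn + s) (u (tn + s)))) (at s within ?X)"
      using solution_shift[OF s] by (simp add: has_vector_derivative_def)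
    have scale: "DE 1 x [h *\<^sub>R w] = h *\<^sub>R DE 1 x [w]" for x h w
      using multilinear_scale_replicate[OF tower_multilinear[OF DE UNIV_I], of 1 "[]" 1 x h w] by simp
    have de: "((\<lambda>s. \<eta> (u (tn + s))) has_derivative (\<lambda>h. DE 1 (u (tn + s)) [h *\<^sub>R f (tn + s) (u (tn + s))])) (at s within ?X)"
      by (rule has_derivative_compose[OF du tower_UNIV_has_derivative[OF DE DE0]])
    have "(z has_derivative (\<lambda>h. (h, h *\<^sub>R f (tn + s) (u (tn + s)), DE 1 (u (tn + s)) [h *\<^sub>R f (tn + s) (u (tn + s))]))) (at s within ?X)"
      unfolding z_def[abs_def] by (intro has_derivative_Pair du de) (auto intro!: derivative_eq_intros)
    moreover have "g (z s) = (1, f (tn + s) (u (tn + s)), DE 1 (u (tn + s)) [f (tn + s) (u (tn + s))])"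
      unfolding z_def by (rule g_eq) (use s tn interval in auto)
    ultimately show ?thesis
      unfolding has_vector_derivative_def by (simp only: scale scaleR_Pair real_scaleR_def mult_1_right)
  qed
  define err where "err h = z0 + h *\<^sub>R (\<Sum>i\<in>UNIV. b $ i *\<^sub>R g (z0 + v h i)) - z h" for h
  have err: "(\<lambda>h. norm (err h)) \<in> O[F](\<lambda>h. h ^ Suc (Suc k))"
    unfolding err_def
    by (rule runge_kutta_order[OF small_steps_le stage vS vO _ _ ode _ order])
       (use interval tn u_init in \<open>auto simp: z_def z0_def S_def\<close>)
  have err_eq: "\<forall>\<^sub>F h in F. snd (err h) =
      (un + h *\<^sub>R mean_slope h - u (tn + h), \<eta> un + entropy_increment h - \<eta> (u (tn + h)))"
    using small_steps_admissible
  proof eventually_elim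
    case (elim h)
    have gs: "g (z0 + v h j) = (1, slope h j, DE 1 (y h j) [slope h j])" for j
      using elim g_stage by blast
    show ?case
      unfolding err_def gs sum_triple by (simp add: z_def z0_def mean_slope_def entropy_increment_def)
  qed
  have norm_snd: "norm (snd q) \<le> norm q" for q :: "real \<times> 'a \<times> real"
    using norm_snd_le[of "snd q" "fst q"] by simp
  have "norm (fst (snd q)) \<le> norm q" "norm (snd (snd q)) \<le> norm q" for q :: "real \<times> 'a \<times> real"
    using norm_fst_le[of "fst (snd q)" "snd (snd q)"] norm_snd_le[of "snd (snd q)" "fst (snd q)"] norm_snd[of q]
    by auto
  note components = this[of "err _"]
  have "\<forall>\<^sub>F h in F. norm (un + h *\<^sub>R mean_slope h - u (tn + h)) \<le> norm (err h)"
    using err_eq by eventually_elim (metis components(1) fst_conv)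
  then show "(\<lambda>h. norm (un + h *\<^sub>R mean_slope h - u (tn + h))) \<in> O[F](\<lambda>h. h ^ Suc (Suc k))"
    by (rule norm_bigo_le[OF err])
  have "\<forall>\<^sub>F h in F. norm (\<eta> un + entropy_increment h - \<eta> (u (tn + h))) \<le> norm (err h)"
    using err_eq by eventually_elim (metis components(2) snd_conv)
  then show "(\<lambda>h. norm (\<eta> un + entropy_increment h - \<eta> (u (tn + h)))) \<in> O[F](\<lambda>h. h ^ Suc (Suc k))"
    by (rule norm_bigo_le[OF err])
qed

section \<open>Size of the residual at 1 and its limiting parabola\<close>

lemma update_tendsto: "((\<lambda>h. un + \<gamma> *\<^sub>R (h *\<^sub>R mean_slope h)) \<longlongrightarrow> un) F"
proof -
  have "((\<lambda>h. un + \<gamma> *\<^sub>R (h *\<^sub>R mean_slope h)) \<longlongrightarrow> un + \<gamma> *\<^sub>R (0 *\<^sub>R (sum (($) b) UNIV *\<^sub>R f0))) F"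
    by (intro tendsto_intros step_tendsto mean_slope_tendsto)
  then show ?thesis by simp
qed

lemma solution_tendsto: "((\<lambda>h. u (tn + h)) \<longlongrightarrow> un) F"
proof -
  obtain C \<delta> where C: "C \<ge> 0" "\<delta> > 0" "tn + \<delta> \<le> t1"
    "\<And>\<rho> s s'. \<rho> \<le> \<delta> \<Longrightarrow> s \<in> {0..\<rho>} \<Longrightarrow> s' \<in> {0..\<rho>} \<Longrightarrow>
      norm (u (tn + s) - u (tn + s') - (s - s') *\<^sub>R f0) \<le> C * \<rho> * \<bar>s - s'\<bar>"
    by (rule solution_increment) (rule that)
  have "\<forall>\<^sub>F h in F. norm (u (tn + h) - un - h *\<^sub>R f0) \<le> C * h * \<bar>h\<bar>"
    using eventually_small_step[OF C(2)] by eventually_elim (use C(4)[of h h 0 for h] u_init in auto)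
  moreover have "((\<lambda>h. C * h * \<bar>h\<bar>) \<longlongrightarrow> C * 0 * \<bar>0\<bar>) F" by (intro tendsto_intros step_tendsto)
  then have "((\<lambda>h. C * h * \<bar>h\<bar>) \<longlongrightarrow> 0) F" by simp
  ultimately have "((\<lambda>h. u (tn + h) - un - h *\<^sub>R f0) \<longlongrightarrow> 0) F"
    by (rule Lim_null_comparison)
  from tendsto_add[OF this tendsto_add[OF tendsto_const[of un] tendsto_scaleR[OF step_tendsto tendsto_const[of f0]]]]
  show ?thesis by simp
qed

text \<open>Inserting the exact entropy \<open>\<eta> (u (tn + h))\<close> splits r(1) into the
  entropy error of the update, bounded by local Lipschitz continuity of \<eta>, and the error of the
  entropy quadrature.\<close>

lemma residual_one_bigo:
  assumes order: "rk_order_accurate A b (Suc k)"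
  shows "(\<lambda>h. relaxation_residual \<eta> f b c tn un y h 1) \<in> O[F](\<lambda>h. h ^ Suc (Suc k))"
proof -
  obtain C d where C: "C \<ge> 0" "d > 0"
    and lip: "\<And>x z. norm (x - un) < d \<Longrightarrow> norm (z - un) < d \<Longrightarrow> norm (\<eta> x - \<eta> z) \<le> C * norm (x - z)"
    by (rule tower_UNIV_locally_lipschitz[OF DE DE0]) (rule that)
  have "\<forall>\<^sub>F h in F. norm (un + 1 *\<^sub>R (h *\<^sub>R mean_slope h) - un) < d" "\<forall>\<^sub>F h in F. norm (u (tn + h) - un) < d"
    using tendstoD[OF update_tendsto[of 1] C(2)] tendstoD[OF solution_tendsto C(2)] by (auto simp: dist_norm)
  then have "\<forall>\<^sub>F h in F. norm (\<eta> (un + h *\<^sub>R mean_slope h) - \<eta> (u (tn + h))) \<le>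
      C * norm (un + h *\<^sub>R mean_slope h - u (tn + h))"
    by eventually_elim (use lip in simp)
  then have "(\<lambda>h. norm (\<eta> (un + h *\<^sub>R mean_slope h) - \<eta> (u (tn + h)))) \<in>
      O[F](\<lambda>h. norm (un + h *\<^sub>R mean_slope h - u (tn + h)))"
    by (rule norm_bigoI)
  also note augmented_order(1)[OF order]
  finally have "(\<lambda>h. norm (\<eta> (un + h *\<^sub>R mean_slope h) - \<eta> (u (tn + h)))) \<in> O[F](\<lambda>h. h ^ Suc (Suc k))" .
  from norm_diff_bigo[OF this augmented_order(2)[OF order]]
  have "(\<lambda>h. norm (relaxation_residual \<eta> f b c tn un y h 1)) \<in> O[F](\<lambda>h. h ^ Suc (Suc k))"
    by (simp add: relaxation_residual_eq algebra_simps)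
  then show ?thesis by simp
qed

lemma bounded_bilinear_hessian: "bounded_bilinear (\<lambda>v w. DE 2 un [v, w])"
proof -
  have two: "bounded_multilinear 2 (DE 2 un)" by (rule tower_multilinear[OF DE UNIV_I])
  obtain K where K: "K > 0" "\<And>vs. length vs = 2 \<Longrightarrow> norm (DE 2 un vs) \<le> K * prod_list (map norm vs)"
    using bounded_multilinear_bound[OF two] by blast
  have l1: "linear (\<lambda>v. DE 2 un ([] @ v # [w]))" and l2: "linear (\<lambda>w. DE 2 un ([v] @ w # []))" for v w
    by (rule bounded_multilinear_linear[OF two], simp)+
  show ?thesis
  proof (rule bounded_bilinear.intro)
    show "\<exists>K. \<forall>v w. norm (DE 2 un [v, w]) \<le> norm v * norm w * K"
      using K(2)[of "[_, _]"] by (intro exI[of _ K]) (auto simp: mult_ac)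
  qed (use linear_add[OF l1] linear_add[OF l2] linear_scale[OF l1] linear_scale[OF l2] in auto)
qed

text \<open>The terms with the first derivative of \<eta> at \<open>un\<close> cancel exactly. At
  order h^2 the update contributes half the Hessian evaluated twice at \<gamma> B f0, and the
  quadrature the Hessian at c_i f0 and f0, because y_i - un is asymptotically c_i h f0.\<close>

lemma residual_tendsto:
  "((\<lambda>h. relaxation_residual \<eta> f b c tn un y h \<gamma> / h\<^sup>2) \<longlongrightarrow>
     DE 2 un [f0, f0] * (\<gamma>\<^sup>2 * (sum (($) b) UNIV)\<^sup>2 / 2 - \<gamma> * (\<Sum>i\<in>UNIV. b $ i * c $ i))) F"
proof -
  interpret H: bounded_bilinear "\<lambda>v w. DE 2 un [v, w]" by (rule bounded_bilinear_hessian)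
  have lin1: "linear (\<lambda>v. DE 1 x ([] @ v # []))" for x
    by (rule bounded_multilinear_linear[OF tower_multilinear[OF DE UNIV_I]]) simp
  define w where "w h = \<gamma> *\<^sub>R (h *\<^sub>R mean_slope h)" for h
  define R1 where "R1 h = \<eta> (un + w h) - \<eta> un - DE 1 un [w h] - DE 2 un [w h, w h] / 2" for h
  \<comment> \<open>One order less than for \<open>R1\<close> suffices, as the quadrature carries a
    factor \<open>h\<close> of its own.\<close>
  define R2 where "R2 i h = DE 1 (y h i) [slope h i] - DE 1 un [slope h i] - DE 2 un [y h i - un, slope h i]" for i h
  have R1: "R1 \<in> O[F](\<lambda>h. h ^ Suc 2)"
  proof -
    obtain C d where C: "C \<ge> 0" "d > 0" and est: "\<forall>z\<in>UNIV. norm (z - un) < d \<longrightarrow> (\<forall>vs. length vs = 0 \<longrightarrow>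
      norm (DE 0 z vs - (\<Sum>m\<le>2. (1 / fact m) *\<^sub>R DE (0 + m) un (replicate m (z - un) @ vs)))
        \<le> C * norm (z - un) ^ Suc 2 * prod_list (map norm vs))"
      using tower_taylor[OF DE convex_UNIV UNIV_I, where x = un and k = 0 and q = 2] by blast
    have "\<forall>\<^sub>F h in F. norm (un + w h - un) < d"
      using tendstoD[OF update_tendsto[of \<gamma>] C(2)] by (simp add: dist_norm w_def)
    then have "\<forall>\<^sub>F h in F. norm (R1 h) \<le> C * norm (w h) ^ 3"
    proof eventually_elim
      case (elim h)
      have "(\<Sum>m\<le>2. (1 / fact m) *\<^sub>R DE (0 + m) un (replicate m (w h))) =
          \<eta> un + DE 1 un [w h] + DE 2 un [w h, w h] / 2"
        by (simp add: numeral_2_eq_2 DE0)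
      then show ?case
        using est[rule_format, OF UNIV_I elim, of "[]"] by (simp add: R1_def DE0 diff_diff_eq eval_nat_numeral)
    qed
    then have "(\<lambda>h. norm (R1 h)) \<in> O[F](\<lambda>h. norm (w h) ^ 3)" by (rule norm_bigoI)
    also have "(\<lambda>h. norm (w h) ^ 3) \<in> O[F](\<lambda>h. h ^ 3)"
    proof (rule landau_o.big_power)
      have "(\<lambda>h. norm (\<gamma> *\<^sub>R (h *\<^sub>R mean_slope h))) \<in> O[F](\<lambda>h. 1 * (h * 1))"
        by (intro norm_scaleR_bigo norm_tendsto_bigo_one[OF mean_slope_tendsto]) auto
      then show "(\<lambda>h. norm (w h)) \<in> O[F](\<lambda>h. h)" by (simp add: w_def)
    qed
    finally show ?thesis by (simp add: eval_nat_numeral)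
  qed
  have R2: "R2 i \<in> O[F](\<lambda>h. h ^ Suc 1)" for i
  proof -
    obtain C d where C: "C \<ge> 0" "d > 0" and est: "\<forall>z\<in>UNIV. norm (z - un) < d \<longrightarrow> (\<forall>vs. length vs = 1 \<longrightarrow>
      norm (DE 1 z vs - (\<Sum>m\<le>1. (1 / fact m) *\<^sub>R DE (1 + m) un (replicate m (z - un) @ vs)))
        \<le> C * norm (z - un) ^ Suc 1 * prod_list (map norm vs))"
      using tower_taylor[OF DE convex_UNIV UNIV_I, where x = un and k = 1 and q = 1] by blast
    have "\<forall>\<^sub>F h in F. norm (y h i - un) < d"
      using tendstoD[OF y_tendsto C(2)] by (simp add: dist_norm)
    then have "\<forall>\<^sub>F h in F. norm (R2 i h) \<le> C * (norm (y h i - un) ^ 2 * norm (slope h i))"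
    proof eventually_elim
      case (elim h)
      then show ?case
        using est[rule_format, OF UNIV_I elim, of "[slope h i]"]
        by (simp add: R2_def diff_diff_eq eval_nat_numeral mult.assoc)
    qed
    then have "(\<lambda>h. norm (R2 i h)) \<in> O[F](\<lambda>h. norm (y h i - un) ^ 2 * norm (slope h i))" by (rule norm_bigoI)
    also have "(\<lambda>h. norm (y h i - un) ^ 2 * norm (slope h i)) \<in> O[F](\<lambda>h. h ^ 2 * 1)"
      by (intro landau_o.big.mult landau_o.big_power stage_bigo norm_tendsto_bigo_one[OF slope_tendsto])
    finally show ?thesis by (simp add: eval_nat_numeral)
  qed
  let ?q = "\<lambda>h. R1 h / h ^ 2 + \<gamma>\<^sup>2 / 2 * DE 2 un [mean_slope h, mean_slope h]
      - \<gamma> * (\<Sum>i\<in>UNIV. b $ i * (R2 i h / h ^ 1 + DE 2 un [(1 / h) *\<^sub>R (y h i - un), slope h i]))"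
  have "(?q \<longlongrightarrow> 0 + \<gamma>\<^sup>2 / 2 * DE 2 un [sum (($) b) UNIV *\<^sub>R f0, sum (($) b) UNIV *\<^sub>R f0]
      - \<gamma> * (\<Sum>i\<in>UNIV. b $ i * (0 + DE 2 un [c $ i *\<^sub>R f0, f0]))) F"
    by (intro tendsto_add tendsto_diff tendsto_mult tendsto_sum tendsto_const H.tendsto mean_slope_tendsto
        slope_tendsto stage_quotient_tendsto bigo_Suc_quotient_tendsto[OF small_steps_le R1]
        bigo_Suc_quotient_tendsto[OF small_steps_le R2])
  also have "0 + \<gamma>\<^sup>2 / 2 * DE 2 un [sum (($) b) UNIV *\<^sub>R f0, sum (($) b) UNIV *\<^sub>R f0]
      - \<gamma> * (\<Sum>i\<in>UNIV. b $ i * (0 + DE 2 un [c $ i *\<^sub>R f0, f0])) =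
     DE 2 un [f0, f0] * (\<gamma>\<^sup>2 * (sum (($) b) UNIV)\<^sup>2 / 2 - \<gamma> * (\<Sum>i\<in>UNIV. b $ i * c $ i))"
    by (simp add: H.scaleR_left H.scaleR_right power2_eq_square sum_distrib_left sum_distrib_right algebra_simps)
  finally have lim: "(?q \<longlongrightarrow>
     DE 2 un [f0, f0] * (\<gamma>\<^sup>2 * (sum (($) b) UNIV)\<^sup>2 / 2 - \<gamma> * (\<Sum>i\<in>UNIV. b $ i * c $ i))) F" .
  show ?thesis
  proof (rule Lim_transform_eventually[OF lim])
    show "\<forall>\<^sub>F h in F. ?q h = relaxation_residual \<eta> f b c tn un y h \<gamma> / h\<^sup>2"
      using small_steps_admissible
    proof eventually_elim
      case (elim h)
      then have h: "h > 0" by simp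
      have w1: "DE 1 un [w h] = \<gamma> * h * (\<Sum>i\<in>UNIV. b $ i * DE 1 un [slope h i])"
      proof -
        have "DE 1 un ([] @ w h # []) = \<gamma> * (h * (\<Sum>i\<in>UNIV. b $ i * DE 1 un ([] @ slope h i # [])))"
          unfolding w_def mean_slope_def linear_scale[OF lin1] linear_sum[OF lin1] by simp
        then show ?thesis by simp
      qed
      have w2: "DE 2 un [w h, w h] = \<gamma>\<^sup>2 * h\<^sup>2 * DE 2 un [mean_slope h, mean_slope h]"
        by (simp add: w_def H.scaleR_left H.scaleR_right power2_eq_square)
      have y2: "DE 2 un [y h i - un, slope h i] = h * DE 2 un [(1 / h) *\<^sub>R (y h i - un), slope h i]" for i
        using h by (simp add: H.scaleR_left)
      have "entropy_increment h = h * (\<Sum>i\<in>UNIV. b $ i * (R2 i h + DE 1 un [slope h i] + DE 2 un [y h i - un, slope h i]))"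
        by (simp add: entropy_increment_def R2_def)
      also have "\<dots> = h * (\<Sum>i\<in>UNIV. b $ i * DE 1 un [slope h i]) +
          h\<^sup>2 * (\<Sum>i\<in>UNIV. b $ i * (R2 i h / h ^ 1 + DE 2 un [(1 / h) *\<^sub>R (y h i - un), slope h i]))"
        unfolding y2 sum_distrib_left sum.distrib[symmetric]
        using h by (intro sum.cong refl) (simp add: field_simps power2_eq_square)
      finally have E: "entropy_increment h = \<dots>" .
      have "relaxation_residual \<eta> f b c tn un y h \<gamma> =
          R1 h + DE 1 un [w h] + DE 2 un [w h, w h] / 2 - \<gamma> * entropy_increment h"
        by (simp add: relaxation_residual_eq R1_def w_def)
      also have "\<dots> = h\<^sup>2 * ?q h"
        unfolding E w1 w2 using h by (simp add: distrib_left right_diff_distrib mult_ac)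
      finally show ?case using h by simp
    qed
  qed
qed

end

section \<open>Existence, uniqueness and location of the root\<close>

locale relaxed_rk_step = rk_step +
  assumes convex: "convex_on UNIV \<eta>"
    and pos: "(\<Sum>i\<in>UNIV. b $ i * c $ i) > 0"
    and neg: "(\<Sum>i\<in>UNIV. b $ i * c $ i) < (sum (($) b) UNIV)\<^sup>2"
    and curvature: "DE 2 un [f0, f0] > 0"
begin

abbreviation "r h \<equiv> relaxation_residual \<eta> f b c tn un y h"

abbreviation "\<gamma>\<^sub>n \<equiv> relaxation_parameter \<eta> f b c tn un y"

text \<open>Half of the limit of the relaxation parameter.\<close>

definition \<gamma>_low :: real where
  "\<gamma>_low = (\<Sum>i\<in>UNIV. b $ i * c $ i) / (sum (($) b) UNIV)\<^sup>2"

lemma sum_b_pos: "(sum (($) b) UNIV)\<^sup>2 > 0"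
  using pos neg by linarith

text \<open>The upper bound puts 1 to the right of \<open>\<gamma>_low\<close>, as required for
  measuring the distance of the root from 1 by a chord that starts at
  \<open>\<gamma>_low\<close>.\<close>

lemma \<gamma>_low_bounds: "0 < \<gamma>_low" "\<gamma>_low < 1"
  unfolding \<gamma>_low_def using divide_pos_pos[OF pos sum_b_pos] divide_less_eq_1_pos[OF sum_b_pos] neg
  by blast+

lemma residual_convex: "convex_on UNIV (r h)"
proof (rule convex_onI)
  fix t x z :: real
  assume t: "0 < t" "t < 1"
  let ?w = "h *\<^sub>R mean_slope h"
  have "un + ((1 - t) *\<^sub>R x + t *\<^sub>R z) *\<^sub>R ?w = (1 - t) *\<^sub>R (un + x *\<^sub>R ?w) + t *\<^sub>R (un + z *\<^sub>R ?w)"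
    by (simp add: algebra_simps)
  then have "\<eta> (un + ((1 - t) *\<^sub>R x + t *\<^sub>R z) *\<^sub>R ?w) \<le> (1 - t) * \<eta> (un + x *\<^sub>R ?w) + t * \<eta> (un + z *\<^sub>R ?w)"
    using convex_onD[OF convex, of t] t by simp
  then show "r h ((1 - t) *\<^sub>R x + t *\<^sub>R z) \<le> (1 - t) * r h x + t * r h z"
    unfolding relaxation_residual_eq by (simp add: algebra_simps)
qed simp

lemma residual_continuous: "continuous_on UNIV (r h)"
proof -
  have "continuous_on UNIV \<eta>"
    using tower_UNIV_has_derivative[OF DE DE0] has_derivative_continuous
    by (metis continuous_at_imp_continuous_on)
  then have "continuous_on UNIV (\<lambda>\<gamma>. \<eta> (un + \<gamma> *\<^sub>R (h *\<^sub>R mean_slope h)))"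
    by (rule continuous_on_compose2) (auto intro!: continuous_intros)
  then show ?thesis
    unfolding relaxation_residual_eq[abs_def] by (intro continuous_intros)
qed

text \<open>\<open>\<gamma>_low\<close> is the minimizer of the limiting parabola, whose value there
  is negative. Half of that value leaves room for the convergence of r(\<gamma>) / h^2.\<close>

lemma residual_low:
  obtains \<epsilon> where "\<epsilon> > 0" "\<forall>\<^sub>F h in F. r h \<gamma>_low \<le> - \<epsilon> * h\<^sup>2"
proof -
  let ?B = "sum (($) b) UNIV" and ?S = "\<Sum>i\<in>UNIV. b $ i * c $ i"
  define l where "l = DE 2 un [f0, f0] * (\<gamma>_low\<^sup>2 * ?B\<^sup>2 / 2 - \<gamma>_low * ?S)"
  have "\<gamma>_low * ?B\<^sup>2 = ?S" using sum_b_pos by (simp add: \<gamma>_low_def)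
  then have "\<gamma>_low\<^sup>2 * ?B\<^sup>2 = \<gamma>_low * ?S" by (metis power2_eq_square mult.assoc)
  then have "\<gamma>_low\<^sup>2 * ?B\<^sup>2 / 2 - \<gamma>_low * ?S = - (\<gamma>_low * ?S / 2)" by linarith
  then have "l = - (DE 2 un [f0, f0] * (\<gamma>_low * ?S / 2))" by (simp add: l_def)
  moreover have "DE 2 un [f0, f0] * (\<gamma>_low * ?S / 2) > 0"
    using curvature pos \<gamma>_low_bounds(1) by simp
  ultimately have l: "l < 0" by linarith
  have "\<forall>\<^sub>F h in F. r h \<gamma>_low / h\<^sup>2 < l / 2"
    using order_tendstoD(2)[OF residual_tendsto[of \<gamma>_low], of "l / 2"] l by (simp add: l_def)
  then have "\<forall>\<^sub>F h in F. r h \<gamma>_low \<le> - (- l / 2) * h\<^sup>2"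
    using small_steps_admissible
  proof eventually_elim
    case (elim h)
    then show ?case by (simp add: pos_divide_less_eq less_imp_le)
  qed
  with l show thesis by (intro that[of "- l / 2"]) auto
qed

text \<open>By \<open>neg\<close> the limiting root 2 S / B^2 is below 2, so the limiting parabola
  is positive at 3.\<close>

lemma residual_high: "\<forall>\<^sub>F h in F. r h 3 > 0"
proof -
  let ?B = "sum (($) b) UNIV" and ?S = "\<Sum>i\<in>UNIV. b $ i * c $ i"
  define l where "l = DE 2 un [f0, f0] * (3\<^sup>2 * ?B\<^sup>2 / 2 - 3 * ?S)"
  have "3\<^sup>2 * ?B\<^sup>2 / 2 - 3 * ?S > 0" using pos neg by (simp add: power2_eq_square)
  then have "l > 0" using curvature by (simp add: l_def)
  have "\<forall>\<^sub>F h in F. r h 3 / h\<^sup>2 > 0"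
    using order_tendstoD(1)[OF residual_tendsto[of 3], of 0] \<open>l > 0\<close> by (simp add: l_def)
  then show ?thesis using small_steps_admissible
    by eventually_elim (auto simp: zero_less_divide_iff)
qed

lemma root_exists:
  "\<forall>\<^sub>F h in F. (\<exists>!\<gamma>. \<gamma> > 0 \<and> r h \<gamma> = 0) \<and> r h (\<gamma>\<^sub>n h) = 0 \<and> \<gamma>_low < \<gamma>\<^sub>n h \<and> \<gamma>\<^sub>n h < 3"
proof -
  obtain \<epsilon> where \<epsilon>: "\<epsilon> > 0" "\<forall>\<^sub>F h in F. r h \<gamma>_low \<le> - \<epsilon> * h\<^sup>2" by (rule residual_low)
  from \<epsilon>(2) residual_high small_steps_admissible show ?thesis
  proof eventually_elim
    case (elim h)
    have "r h \<gamma>_low < 0" using elim(1,3) \<epsilon>(1) by (simp add: order.strict_trans1)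
    then have "r h \<gamma>_low < 0" "r h 0 = 0" "\<gamma>_low < 3"
      using \<gamma>_low_bounds by (auto simp: relaxation_residual_eq)
    note root = convex_root_unique[OF residual_convex residual_continuous this(2) \<gamma>_low_bounds(1) this(3,1) elim(2)]
    have "\<gamma>\<^sub>n h > 0 \<and> r h (\<gamma>\<^sub>n h) = 0"
      unfolding relaxation_parameter_def by (rule theI'[OF root(1)])
    then show ?case using root by blast
  qed
qed

lemma root_bounds: "\<forall>\<^sub>F h in F. r h (\<gamma>\<^sub>n h) = 0 \<and> \<gamma>_low < \<gamma>\<^sub>n h \<and> \<gamma>\<^sub>n h < 3"
  using root_exists by (rule eventually_mono) blast

text \<open>\<open>convex_root_distance\<close> on the interval from \<open>\<gamma>_low\<close> to
  3 divides r(1) = O(h^(k+2)) by -r(\<open>\<gamma>_low\<close>), which is at least of order h^2;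
  for k = 0 the bounds on the root suffice.\<close>

lemma root_distance_bigo:
  assumes order: "rk_order_accurate A b (Suc k)"
  shows "(\<lambda>h. \<gamma>\<^sub>n h - 1) \<in> O[F](\<lambda>h. h ^ k)"
proof (cases k)
  case 0
  have "\<forall>\<^sub>F h in F. norm (\<gamma>\<^sub>n h - 1) \<le> 2 * 1"
    using root_bounds by eventually_elim (use \<gamma>_low_bounds in auto)
  then have "(\<lambda>h. norm (\<gamma>\<^sub>n h - 1)) \<in> O[F](\<lambda>h. 1)" by (rule norm_bigoI)
  then show ?thesis using 0 by simp
next
  case (Suc k')
  obtain \<epsilon> where \<epsilon>: "\<epsilon> > 0" "\<forall>\<^sub>F h in F. r h \<gamma>_low \<le> - \<epsilon> * h\<^sup>2" by (rule residual_low)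
  have "(\<lambda>h. norm (r h 1)) \<in> O[F](\<lambda>h. h ^ Suc (Suc k))"
    using residual_one_bigo[OF order] by simp
  then obtain C where C: "C > 0" "\<forall>\<^sub>F h in F. norm (r h 1) \<le> C * \<bar>h ^ Suc (Suc k)\<bar>" by (rule norm_bigoE)
  have "\<forall>\<^sub>F h in F. norm (\<gamma>\<^sub>n h - 1) \<le> (3 * C / \<epsilon>) * h ^ k"
    using \<epsilon>(2) C(2) small_steps_admissible root_bounds
  proof eventually_elim
    case (elim h)
    have h: "h > 0" using elim(3) by simp
    have low: "\<epsilon> * h\<^sup>2 \<le> - r h \<gamma>_low" "r h \<gamma>_low < 0"
      using elim(1) h \<epsilon>(1) by (auto intro: order.strict_trans1)
    have "\<bar>\<gamma>\<^sub>n h - 1\<bar> * (\<epsilon> * h\<^sup>2) \<le> \<bar>\<gamma>\<^sub>n h - 1\<bar> * (- r h \<gamma>_low)"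
      using low by (intro mult_left_mono) auto
    also have "\<dots> \<le> (3 - \<gamma>_low) * \<bar>r h 1\<bar>"
      by (rule convex_root_distance[OF residual_convex low(2)]) (use elim(4) \<gamma>_low_bounds in auto)
    also have "\<dots> \<le> 3 * (C * h ^ Suc (Suc k))"
      using elim(2) h \<gamma>_low_bounds by (intro mult_mono) auto
    also have "\<dots> = (3 * C / \<epsilon>) * h ^ k * (\<epsilon> * h\<^sup>2)"
      using \<epsilon>(1) by (simp add: power2_eq_square)
    finally have "\<bar>\<gamma>\<^sub>n h - 1\<bar> * (\<epsilon> * h\<^sup>2) \<le> (3 * C / \<epsilon>) * h ^ k * (\<epsilon> * h\<^sup>2)" .
    moreover have "\<epsilon> * h\<^sup>2 > 0" using \<epsilon>(1) h by simp
    ultimately show ?case by (metis mult_le_cancel_right_pos real_norm_def)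
  qed
  then have "(\<lambda>h. norm (\<gamma>\<^sub>n h - 1)) \<in> O[F](\<lambda>h. h ^ k)" by (rule norm_bigoI)
  then show ?thesis by simp
qed

section \<open>Orders of the two interpretations\<close>

lemma update_increment_bigo:
  "(\<lambda>h. norm (rk_update f b c tn un y h (\<gamma>\<^sub>n h) - un)) \<in> O[F](\<lambda>h. h)"
proof -
  have "\<forall>\<^sub>F h in F. norm (\<gamma>\<^sub>n h) \<le> 3 * 1"
    using root_bounds by eventually_elim (use \<gamma>_low_bounds in auto)
  then have "(\<lambda>h. norm (\<gamma>\<^sub>n h)) \<in> O[F](\<lambda>h. 1)" by (rule norm_bigoI)
  then have "(\<lambda>h. norm (\<gamma>\<^sub>n h *\<^sub>R (h *\<^sub>R mean_slope h))) \<in> O[F](\<lambda>h. 1 * (h * 1))"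
    by (intro norm_scaleR_bigo norm_tendsto_bigo_one[OF mean_slope_tendsto]) auto
  then show ?thesis by (simp add: rk_update_eq)
qed

text \<open>Meant for p = 0, with \<open>\<theta>\<close> constantly 1 or equal to the relaxation
  parameter: numerical and exact value then both stay within O(h) of \<open>un\<close>.\<close>

lemma solution_increment_bigo:
  assumes "\<forall>\<^sub>F h in F. 0 \<le> \<theta> h \<and> \<theta> h \<le> 3"
  shows "(\<lambda>h. norm (u (tn + \<theta> h * h) - un)) \<in> O[F](\<lambda>h. h)"
proof -
  obtain C \<delta> where C: "C \<ge> 0" "\<delta> > 0" "tn + \<delta> \<le> t1"
    "\<And>\<rho> s s'. \<rho> \<le> \<delta> \<Longrightarrow> s \<in> {0..\<rho>} \<Longrightarrow> s' \<in> {0..\<rho>} \<Longrightarrow>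
      norm (u (tn + s) - u (tn + s') - (s - s') *\<^sub>R f0) \<le> C * \<rho> * \<bar>s - s'\<bar>"
    by (rule solution_increment) (rule that)
  have "\<forall>\<^sub>F h in F. 0 < h \<and> h < \<delta> / 3" by (rule eventually_small_step) (use C(2) in simp)
  with assms have "\<forall>\<^sub>F h in F. norm (u (tn + \<theta> h * h) - un) \<le> ((C * \<delta> + norm f0) * 3) * h"
  proof eventually_elim
    case (elim h)
    let ?s = "\<theta> h * h"
    have s: "0 \<le> ?s" "?s \<le> 3 * h" using elim by (auto intro: mult_right_mono)
    have "norm (u (tn + ?s) - un - ?s *\<^sub>R f0) \<le> C * \<delta> * ?s"
      using C(4)[of \<delta> ?s 0] s elim u_init C(2) by auto
    then have "norm (u (tn + ?s) - un) \<le> C * \<delta> * ?s + norm (?s *\<^sub>R f0)"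
      using norm_triangle_sub[of "u (tn + ?s) - un" "?s *\<^sub>R f0"] by linarith
    also have "\<dots> = (C * \<delta> + norm f0) * ?s" using s by (simp add: algebra_simps)
    also have "\<dots> \<le> (C * \<delta> + norm f0) * (3 * h)" using s C by (intro mult_left_mono) auto
    finally show ?case by (simp only: mult.assoc)
  qed
  then show ?thesis by (rule norm_bigoI)
qed

text \<open>The excess (\<gamma> - 1) h times the mean slope is not matched by a shift of the exact
  solution. It has order h^(p-1) h, one power short of the unmodified error.\<close>

lemma idt_order:
  assumes order: "rk_order_accurate A b p"
  shows "(\<lambda>h. norm (rk_update f b c tn un y h (\<gamma>\<^sub>n h) - u (tn + h))) \<in> O[F](\<lambda>h. h ^ p)"
proof (cases p)
  case 0
  have "(\<lambda>h. norm ((rk_update f b c tn un y h (\<gamma>\<^sub>n h) - un) - (u (tn + 1 * h) - un))) \<in> O[F](\<lambda>h. h)"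
    by (intro norm_diff_bigo update_increment_bigo solution_increment_bigo) simp
  then have "(\<lambda>h. norm (rk_update f b c tn un y h (\<gamma>\<^sub>n h) - u (tn + h))) \<in> O[F](\<lambda>h. h ^ 1)" by simp
  also have "(\<lambda>h. h ^ 1) \<in> O[F](\<lambda>h. h ^ p)"
    by (rule bigo_power_mono[OF small_steps_le]) (use 0 in simp)
  finally show ?thesis .
next
  case (Suc k)
  note order' = order[unfolded Suc]
  have "(\<lambda>h. norm (un + h *\<^sub>R mean_slope h - u (tn + h))) \<in> O[F](\<lambda>h. h ^ p)"
    by (rule landau_o.big_trans[OF augmented_order(1)[OF order'] bigo_power_mono[OF small_steps_le]])
       (use Suc in simp)
  moreover have "(\<lambda>h. norm ((\<gamma>\<^sub>n h - 1) *\<^sub>R (h *\<^sub>R mean_slope h))) \<in> O[F](\<lambda>h. h ^ k * (h * 1))"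
    by (intro norm_scaleR_bigo root_distance_bigo[OF order'] norm_tendsto_bigo_one[OF mean_slope_tendsto]) auto
  then have "(\<lambda>h. norm ((\<gamma>\<^sub>n h - 1) *\<^sub>R (h *\<^sub>R mean_slope h))) \<in> O[F](\<lambda>h. h ^ p)"
    by (simp add: Suc mult.commute)
  ultimately have "(\<lambda>h. norm ((un + h *\<^sub>R mean_slope h - u (tn + h)) + (\<gamma>\<^sub>n h - 1) *\<^sub>R (h *\<^sub>R mean_slope h))) \<in> O[F](\<lambda>h. h ^ p)"
    by (rule norm_add_bigo)
  moreover have "(un + h *\<^sub>R mean_slope h - u (tn + h)) + (\<gamma>\<^sub>n h - 1) *\<^sub>R (h *\<^sub>R mean_slope h) =
      rk_update f b c tn un y h (\<gamma>\<^sub>n h) - u (tn + h)" for h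
    by (simp add: rk_update_eq algebra_simps)
  ultimately show ?thesis by (simp only:)
qed

text \<open>Update and solution are shifted by the same time (\<gamma> - 1) h with velocities that
  both equal f0 + O(h). The shifts differ by O(h^(p-1) h h), which matches the unmodified
  error.\<close>

lemma relaxation_order:
  assumes order: "rk_order_accurate A b p"
  shows "(\<lambda>h. norm (rk_update f b c tn un y h (\<gamma>\<^sub>n h) - u (tn + \<gamma>\<^sub>n h * h))) \<in> O[F](\<lambda>h. h ^ (p + 1))"
proof (cases p)
  case 0
  have "\<forall>\<^sub>F h in F. 0 \<le> \<gamma>\<^sub>n h \<and> \<gamma>\<^sub>n h \<le> 3"
    using root_bounds by eventually_elim (use \<gamma>_low_bounds in auto)
  then have "(\<lambda>h. norm ((rk_update f b c tn un y h (\<gamma>\<^sub>n h) - un) - (u (tn + \<gamma>\<^sub>n h * h) - un))) \<in> O[F](\<lambda>h. h)"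
    by (intro norm_diff_bigo update_increment_bigo solution_increment_bigo)
  then show ?thesis using 0 by simp
next
  case (Suc k)
  note order' = order[unfolded Suc]
  let ?O = "O[F](\<lambda>h. h ^ Suc (Suc k))"
  \<comment> \<open>The one-vertex tree gives B = 1, which makes the mean slope converge to
    \<open>f0\<close> itself and not to a multiple.\<close>
  have "tree_order (Node []) \<le> p" using Suc by simp
  with order have "(\<Sum>i\<in>UNIV. b $ i * stage_weight A (Node []) i) = 1 / real (tree_density (Node []))"
    unfolding rk_order_accurate_def by blast
  then have B: "sum (($) b) UNIV = 1" by simp
  have 1: "(\<lambda>h. norm (un + h *\<^sub>R mean_slope h - u (tn + h))) \<in> ?O"
    by (rule augmented_order(1)[OF order'])
  have "(\<lambda>h. norm (\<Sum>i\<in>UNIV. b $ i *\<^sub>R (slope h i - f0))) \<in> O[F](\<lambda>h. 1 * h)"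
    by (intro norm_sum_bigo norm_scaleR_bigo slope_bigo) auto
  moreover have "(\<Sum>i\<in>UNIV. b $ i *\<^sub>R (slope h i - f0)) = mean_slope h - f0" for h
    using B by (simp add: mean_slope_def scaleR_diff_right sum_subtractf scaleR_sum_left[symmetric])
  ultimately have "(\<lambda>h. norm (mean_slope h - f0)) \<in> O[F](\<lambda>h. h)" by simp
  then have "(\<lambda>h. norm ((\<gamma>\<^sub>n h - 1) *\<^sub>R (h *\<^sub>R (mean_slope h - f0)))) \<in> O[F](\<lambda>h. h ^ k * (h * h))"
    by (intro norm_scaleR_bigo root_distance_bigo[OF order']) auto
  then have 2: "(\<lambda>h. norm ((\<gamma>\<^sub>n h - 1) *\<^sub>R (h *\<^sub>R (mean_slope h - f0)))) \<in> ?O"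
    by (simp add: mult_ac)
  obtain C \<delta> where C: "C \<ge> 0" "\<delta> > 0" "tn + \<delta> \<le> t1"
    "\<And>\<rho> s s'. \<rho> \<le> \<delta> \<Longrightarrow> s \<in> {0..\<rho>} \<Longrightarrow> s' \<in> {0..\<rho>} \<Longrightarrow>
      norm (u (tn + s) - u (tn + s') - (s - s') *\<^sub>R f0) \<le> C * \<rho> * \<bar>s - s'\<bar>"
    by (rule solution_increment) (rule that)
  have "\<forall>\<^sub>F h in F. 0 < h \<and> h < \<delta> / 3" by (rule eventually_small_step) (use C(2) in simp)
  with root_bounds have "\<forall>\<^sub>F h in F. norm (u (tn + \<gamma>\<^sub>n h * h) - u (tn + h) - (\<gamma>\<^sub>n h * h - h) *\<^sub>R f0)
      \<le> (3 * C) * norm ((\<gamma>\<^sub>n h - 1) *\<^sub>R (h * h))"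
  proof eventually_elim
    case (elim h)
    have h: "0 < h" "3 * h \<le> \<delta>" "0 < \<gamma>\<^sub>n h" "\<gamma>\<^sub>n h < 3" using elim \<gamma>_low_bounds by auto
    \<comment> \<open>With \<rho> = 3 h the interval contains both times, since the root is below
      3.\<close>
    have "norm (u (tn + \<gamma>\<^sub>n h * h) - u (tn + h) - (\<gamma>\<^sub>n h * h - h) *\<^sub>R f0) \<le> C * (3 * h) * \<bar>\<gamma>\<^sub>n h * h - h\<bar>"
      using h by (intro C(4)) (auto intro: mult_right_mono)
    also have "\<bar>\<gamma>\<^sub>n h * h - h\<bar> = \<bar>\<gamma>\<^sub>n h - 1\<bar> * h"
      using h abs_mult[of "\<gamma>\<^sub>n h - 1" h] by (simp add: left_diff_distrib)
    finally show ?case using h by (simp add: abs_mult mult_ac)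
  qed
  then have "(\<lambda>h. norm (u (tn + \<gamma>\<^sub>n h * h) - u (tn + h) - (\<gamma>\<^sub>n h * h - h) *\<^sub>R f0))
      \<in> O[F](\<lambda>h. norm ((\<gamma>\<^sub>n h - 1) *\<^sub>R (h * h)))"
    by (rule norm_bigoI)
  also have "(\<lambda>h. norm ((\<gamma>\<^sub>n h - 1) *\<^sub>R (h * h))) \<in> O[F](\<lambda>h. h ^ k * (h * h))"
    by (intro norm_scaleR_bigo root_distance_bigo[OF order']) simp
  finally have 3: "(\<lambda>h. norm (u (tn + \<gamma>\<^sub>n h * h) - u (tn + h) - (\<gamma>\<^sub>n h * h - h) *\<^sub>R f0)) \<in> ?O"
    by (simp add: mult_ac)
  \<comment> \<open>The multiple of \<open>f0\<close> subtracted from the numerical shift is the one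
    subtracted from the exact shift, so both drop out.\<close>
  have eq: "(un + h *\<^sub>R mean_slope h - u (tn + h)) + (\<gamma>\<^sub>n h - 1) *\<^sub>R (h *\<^sub>R (mean_slope h - f0))
      - (u (tn + \<gamma>\<^sub>n h * h) - u (tn + h) - (\<gamma>\<^sub>n h * h - h) *\<^sub>R f0) =
      rk_update f b c tn un y h (\<gamma>\<^sub>n h) - u (tn + \<gamma>\<^sub>n h * h)" for h
    by (simp add: rk_update_eq algebra_simps)
  from norm_diff_bigo[OF norm_add_bigo[OF 1 2] 3] show ?thesis
    by (simp only: eq Suc Suc_eq_plus1)
qed

end

theorem theorem2p15:
  fixes \<eta> :: "'a::{real_inner, complete_space} \<Rightarrow> real"
    and f :: "real \<Rightarrow> 'a \<Rightarrow> 'a"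
    and A :: "real^'s^'s" and b c :: "real^'s"
    and p :: nat
    and T tn t1 :: real and un :: 'a
    and y :: "real \<Rightarrow> 's \<Rightarrow> 'a"
    and u :: "real \<Rightarrow> 'a"
  assumes eta_smooth: "smooth_on UNIV \<eta>"
    and eta_convex: "convex_on UNIV \<eta>"
    and f_smooth: "smooth_on ({0..T} \<times> UNIV) (\<lambda>(t, x). f t x)"
    and row_sums: "A *v 1 = c"
    and order: "rk_order_accurate A b p"
    and pos: "(\<Sum>i\<in>UNIV. \<Sum>j\<in>UNIV. b $ i * A $ i $ j) > 0"
    and neg: "(\<Sum>i\<in>UNIV. \<Sum>j\<in>UNIV. b $ i * (A $ i $ j - b $ j)) < 0"
    and tn: "tn \<in> {0..<T}"
    and curvature: "second_derivative \<eta> un (f tn un) (f tn un) > 0"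
    and interval: "t1 \<in> {tn<..T}"
    and u_init: "u tn = un"
    and u_ode: "\<And>t. t \<in> {tn..t1} \<Longrightarrow> (u has_vector_derivative f t (u t)) (at t within {tn..t1})"
    and stages: "stage_branch f A c T tn un y"
  shows "(\<forall>\<^sub>F h in small_steps T tn c. \<exists>!\<gamma>. \<gamma> > 0 \<and> relaxation_residual \<eta> f b c tn un y h \<gamma> = 0) \<and>
    (\<lambda>h. norm (rk_update f b c tn un y h (relaxation_parameter \<eta> f b c tn un y h) - u (tn + h)))
      \<in> O[small_steps T tn c](\<lambda>h. h ^ p) \<and>
    (\<lambda>h. norm (rk_update f b c tn un y h (relaxation_parameter \<eta> f b c tn un y h)
                 - u (tn + relaxation_parameter \<eta> f b c tn un y h * h)))
      \<in> O[small_steps T tn c](\<lambda>h. h ^ (p + 1))"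
proof -
  obtain DE where DE: "derivative_tower UNIV DE" "\<And>x. DE 0 x [] = \<eta> x"
    using smooth_on_tower[OF eta_smooth] by auto
  obtain DF where DF: "derivative_tower ({0..T} \<times> UNIV) DF"
    "\<And>z. z \<in> {0..T} \<times> UNIV \<Longrightarrow> DF 0 z [] = (case z of (t, x) \<Rightarrow> f t x)"
    using smooth_on_tower[OF f_smooth] by blast
  interpret rk_step \<eta> f A b c T tn t1 un y u DE DF
    by unfold_locales (use DE DF row_sums tn interval u_init u_ode stages in auto)
  have S: "(\<Sum>i\<in>UNIV. \<Sum>j\<in>UNIV. b $ i * A $ i $ j) = (\<Sum>i\<in>UNIV. b $ i * c $ i)"
    by (simp add: c_eq sum_distrib_left)
  \<comment> \<open>The double sum of b_i b_j is B^2, so the second sign condition reads S < B^2: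
    the limiting root is less than 2.\<close>
  have "(\<Sum>i\<in>UNIV. \<Sum>j\<in>UNIV. b $ i * (A $ i $ j - b $ j)) =
      (\<Sum>i\<in>UNIV. b $ i * c $ i) - (sum (($) b) UNIV)\<^sup>2"
    by (simp add: S[symmetric] right_diff_distrib sum_subtractf power2_eq_square sum_product)
  with neg have "(\<Sum>i\<in>UNIV. b $ i * c $ i) < (sum (($) b) UNIV)\<^sup>2" by simp
  moreover have "DE 2 un [f tn un, f tn un] > 0"
    using curvature second_derivative_tower[OF DE DE0] by simp
  ultimately interpret relaxed_rk_step \<eta> f A b c T tn t1 un y u DE DF
    by unfold_locales (use eta_convex pos S in auto)
  have "\<forall>\<^sub>F h in small_steps T tn c. \<exists>!\<gamma>. \<gamma> > 0 \<and> relaxation_residual \<eta> f b c tn un y h \<gamma> = 0"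
    using root_exists by eventually_elim blast
  then show ?thesis using idt_order[OF order] relaxation_order[OF order] by blast
qed

end
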